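(* Let $\beta\in\mathbb R$. Let $\ell$ be a simple loop in $\mathbb Z^2$ and set $a_\ell=\operatorname{area}(\ell)$. For $n\in\mathbb N=\{1,2,\dots\}$ let $\ell^n$ denote the loop $\ell$ wound around itself $n$ times. Then $$c(\ell^n,K_{\ell^n})=\frac{(-1)^{n+1}}{n}\binom{na_\ell-2}{n-1},$$ where, when $a_\ell=1$, the right-hand side is interpreted as $\mathbf 1_{\{n=1\}}$. In particular, $$\phi(\ell^n)=\frac{(-1)^{n+1}}{n}\binom{na_\ell-2}{n-1}\,\beta^{na_\ell}$$ (with the same interpretation when $a_\ell=1$).
   Context: **Lattice and loops.** $E$ is the set of oriented nearest-neighbour edges of $\mathbb Z^2$; $e^{-1}$ is $e$ reversed. A loop is a closed walk $\ell=e_1e_2\cdots e_n$ of oriented edges, considered up to cyclic rotation; the null-loop $\emptyset$ has no edges. A backtrack is an occurrence $\ell=\pi_1\,e\,e^{-1}\,\pi_2$ (cyclically); removing it gives $\pi_1\pi_2$. A loop is trivial if removing all its backtracks gives $\emptyset$. A simple loop is a non-null loop without backtracks such that the endpoints of all its edges are distinct; $\operatorname{area}(\ell)$ is the number of unit squares it encloses. A plaquette is an oriented loop of four edges around a unit square; $\mathcal P$ is the set of all plaquettes, $p^{-1}$ is $p$ reversed, $\mathcal P^+$ is the set of positively oriented ones (leftmost edge oriented upwards), $\mathcal P(e)$ is the set of plaquettes containing the oriented edge $e$. Two plaquettes are adjacent if they share exactly one unoriented edge. **Plaquette assignments.** A plaquette assignment is a map $K:\mathcal P\to\mathbb Z_{\ge0}$;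 it is finite if $\operatorname{area}(K)=\sum_p K(p)<\infty$. If $K(p)\ge1$, $K\setminus p$ is $K$ with its value at $p$ decreased by $1$. Let $n_e(\ell)$ be the number of copies of $e$ in $\ell$ and $n_e(\ell,K)=n_e(\ell)+\sum_{p\in\mathcal P(e)}K(p)$. The pair $(\ell,K)$ is balanced if $n_e(\ell,K)=n_{e^{-1}}(\ell,K)$ for all $e\in E$. **Loop operations** at a specific copy $\mathbf e$ of an edge $e$ in $\ell$ (backtracks created are not removed). Positive splittings: for each other copy $\mathbf e'$ of $e$ in $\ell$, writing $\ell=\pi_1\mathbf e\pi_2\mathbf e'\pi_3$, the pair $\{\pi_1\mathbf e\pi_3,\ \pi_2\mathbf e'\}$; the multiset of these is $\mathbb S_+(\mathbf e,\ell)$. Negative splittings: for each copy $\mathbf e^{-1}$ of $e^{-1}$ in $\ell$, writing $\ell=\pi_1\mathbf e\pi_2\mathbf e^{-1}\pi_3$, the pair $\{\pi_1\pi_3,\ \pi_2\}$; the multiset of these is $\mathbb S_-(\mathbf e,\ell)$. Deformations: with $\ell=\mathbf e\pi_1$, for $q=\mathbf e'\pi_2\in\mathcal P(e)$ set $\ell\oplus_{\mathbf e}q=\mathbf e\pi_2\mathbf e'\pi_1$; for $p=\mathbf e^{-1}\pi_2\in\mathcal P(e^{-1})$ set $\ell\ominus_{\mathbf e}p=\pi_2\pi_1$. **Coefficients and surface sums.** The real coefficients $c(\ell,K)$ ($\ell$ a loop, $K$ a finite plaquette assignment) of the large-$N$ lattice Yang–Mills surface sum are the unique ones such that: (1) $c(\ell,K)=0$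 if $(\ell,K)$ is not balanced; (2) $c(\ell,0)=0$ for non-trivial $\ell$, $c(\emptyset,0)=1$, and $c(\emptyset,K)=0$ for $K\neq0$; (3) (master loop equation) for every non-null loop $\ell$, every finite $K$ and every choice of a copy $\mathbf e$ of an edge $e$ in $\ell$, $$c(\ell,K)=\sum_{\{\ell_1,\ell_2\}\in\mathbb S_-(\mathbf e,\ell)}\ \sum_{K_1+K_2=K}c(\ell_1,K_1)c(\ell_2,K_2)-\sum_{\{\ell_1,\ell_2\}\in\mathbb S_+(\mathbf e,\ell)}\ \sum_{K_1+K_2=K}c(\ell_1,K_1)c(\ell_2,K_2)+\sum_{p\in\mathcal P(e^{-1}),K(p)\ge1}c(\ell\ominus_{\mathbf e}p,K\setminus p)-\sum_{q\in\mathcal P(e),K(q)\ge1}c(\ell\oplus_{\mathbf e}q,K\setminus q).$$ It is known that such coefficients exist and that $c(\pi_1ee^{-1}\pi_2,K)=c(\pi_1\pi_2,K)$ for balanced pairs. For $\beta\in\mathbb R$, $\phi^K(\ell)=c(\ell,K)\beta^{\operatorname{area}(K)}$ (with $\beta^0=1$) and $\phi(\ell)=\sum_K\phi^K(\ell)$, the sum being over all finite plaquette assignments. **Height.** $h_\ell:\mathcal P\to\mathbb Z$ is the unique function with $h_\ell(p^{-1})=h_\ell(p)$, $h_\ell(p)=0$ for plaquettes outside a large box containing $\ell$, and, for adjacent $p,q\in\mathcal P^+$, $h_\ell(q)=h_\ell(p)+n-m$, where $n$ (resp. $m$) is the number of times $\ell$ crosses the oriented segment from the center of $p$ to the center of $q$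 from right to left (resp. left to right). **Height plaquette assignment** $K_\ell$: for $p\in\mathcal P^+$, $(K_\ell(p),K_\ell(p^{-1}))=(0,|h_\ell(p)|)$ if $h_\ell(p)\ge0$ and $(|h_\ell(p)|,0)$ if $h_\ell(p)<0$. *)

theory Defs
  imports "HOL-Library.Multiset" "HOL-Analysis.Infinite_Sum"
begin

section \<open>Lattice and loops\<close>

type_synonym vertex = "int \<times> int"
type_synonym oedge = "vertex \<times> vertex"

definition lattice_edges :: "oedge set" where
  "lattice_edges = {((x, y), (x', y')). \<bar>x - x'\<bar> + \<bar>y - y'\<bar> = 1}"

abbreviation edge_inv :: "oedge \<Rightarrow> oedge" where
  "edge_inv \<equiv> prod.swap"

text \<open>A loop is represented by any of the edge lists obtained by choosing a starting edge; the
  null-loop is the empty list. Functions of loops are functions of lists that are invariant under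
  rotation.\<close>

definition is_loop :: "oedge list \<Rightarrow> bool" where
  "is_loop l \<longleftrightarrow> set l \<subseteq> lattice_edges \<and>
     (\<forall>i<length l. snd (l ! i) = fst (l ! (Suc i mod length l)))"

text \<open>The second rule is the backtrack that straddles the chosen starting point of the list.\<close>

inductive removes_backtrack :: "oedge list \<Rightarrow> oedge list \<Rightarrow> bool" where
  inner: "removes_backtrack (\<pi>1 @ e # edge_inv e # \<pi>2) (\<pi>1 @ \<pi>2)"
| cyclic: "removes_backtrack (edge_inv e # \<pi> @ [e]) \<pi>"

definition trivial_loop :: "oedge list \<Rightarrow> bool" where
  "trivial_loop l \<longleftrightarrow> removes_backtrack\<^sup>*\<^sup>* l []"

definition simple_loop :: "oedge list \<Rightarrow> bool" where
  "simple_loop l \<longleftrightarrow> is_loop l \<and> l \<noteq> [] \<and> (\<nexists>l'. removes_backtrack l l') \<and> distinct (map snd l)"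

definition loop_power :: "oedge list \<Rightarrow> nat \<Rightarrow> oedge list" where
  "loop_power l n = concat (replicate n l)"


section \<open>Plaquettes\<close>

text \<open>A plaquette is given by the lower left corner of its unit square and its orientation, where
  \<^term>\<open>True\<close> stands for the positive orientation: leftmost edge upwards, that is, clockwise.\<close>

type_synonym plaquette = "vertex \<times> bool"

fun square_path :: "vertex \<Rightarrow> oedge list" where
  "square_path (x, y) =
     [((x, y), (x, y + 1)), ((x, y + 1), (x + 1, y + 1)),
      ((x + 1, y + 1), (x + 1, y)), ((x + 1, y), (x, y))]"

definition plaq_path :: "plaquette \<Rightarrow> oedge list" where
  "plaq_path p =
     (if snd p then square_path (fst p) else map edge_inv (rev (square_path (fst p))))"

definition plaq_inv :: "plaquette \<Rightarrow> plaquette" where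
  "plaq_inv p = (fst p, \<not> snd p)"

definition positive_plaquettes :: "plaquette set" where
  "positive_plaquettes = {p. snd p}"

definition plaquettes_at :: "oedge \<Rightarrow> plaquette set" where
  "plaquettes_at e = {p. e \<in> set (plaq_path p)}"

definition unoriented_edges :: "plaquette \<Rightarrow> vertex set set" where
  "unoriented_edges p = (\<lambda>(u, v). {u, v}) ` set (plaq_path p)"

definition adjacent :: "plaquette \<Rightarrow> plaquette \<Rightarrow> bool" where
  "adjacent p q \<longleftrightarrow> card (unoriented_edges p \<inter> unoriented_edges q) = 1"

text \<open>If \<open>p\<close>, read from its edge \<open>e\<close>, is \<open>e \<pi>\<close>, then \<open>plaq_rest e p = \<pi>\<close>.\<close>

definition plaq_rest :: "oedge \<Rightarrow> plaquette \<Rightarrow> oedge list" where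
  "plaq_rest e p =
     tl (dropWhile (\<lambda>f. f \<noteq> e) (plaq_path p)) @ takeWhile (\<lambda>f. f \<noteq> e) (plaq_path p)"


section \<open>Area enclosed by a loop\<close>

text \<open>Unit squares are named by their lower left corners. A square is enclosed by \<open>l\<close> if, moving
  between squares through common sides not traversed by \<open>l\<close> in either direction, only finitely
  many squares can be reached from it.\<close>

definition square_step :: "oedge list \<Rightarrow> vertex \<Rightarrow> vertex \<Rightarrow> bool" where
  "square_step l s t \<longleftrightarrow>
     (\<exists>e. e \<in> set (square_path t) \<and> edge_inv e \<in> set (square_path s) \<and>
          e \<notin> set l \<and> edge_inv e \<notin> set l)"

definition enclosed_squares :: "oedge list \<Rightarrow> vertex set" where
  "enclosed_squares l = {s. finite {t. (square_step l)\<^sup>*\<^sup>* s t}}"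

definition loop_area :: "oedge list \<Rightarrow> nat" where
  "loop_area l = card (enclosed_squares l)"


section \<open>Plaquette assignments\<close>

type_synonym assignment = "plaquette \<Rightarrow> nat"

definition finite_assignments :: "assignment set" where
  "finite_assignments = {K. finite {p. K p \<noteq> 0}}"

definition assignment_area :: "assignment \<Rightarrow> nat" where
  "assignment_area K = (\<Sum>p | K p \<noteq> 0. K p)"

definition assignment_remove :: "assignment \<Rightarrow> plaquette \<Rightarrow> assignment" where
  "assignment_remove K p = K(p := K p - 1)"

definition edge_count :: "oedge \<Rightarrow> oedge list \<Rightarrow> assignment \<Rightarrow> nat" where
  "edge_count e l K = count_list l e + (\<Sum>p\<in>plaquettes_at e. K p)"

definition balanced :: "oedge list \<Rightarrow> assignment \<Rightarrow> bool" where
  "balanced l K \<longleftrightarrow> (\<forall>e\<in>lattice_edges. edge_count e l K = edge_count (edge_inv e) l K)"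


section \<open>Loop operations\<close>

text \<open>All operations act at the first edge of the loop \<open>e # \<pi>\<close>. An operation at another copy of
  an edge is obtained by rotating the list so that it starts at that copy. The index \<open>j\<close> runs over
  the positions in \<open>\<pi>\<close> of the other copies of \<open>e\<close>, respectively of the copies of \<open>e\<inverse>\<close>.\<close>

definition positive_splittings :: "oedge \<Rightarrow> oedge list \<Rightarrow> (oedge list \<times> oedge list) multiset" where
  "positive_splittings e \<pi> =
     image_mset (\<lambda>j. (e # drop (Suc j) \<pi>, take j \<pi> @ [e])) (mset_set {j. j < length \<pi> \<and> \<pi> ! j = e})"

definition negative_splittings :: "oedge \<Rightarrow> oedge list \<Rightarrow> (oedge list \<times> oedge list) multiset" where
  "negative_splittings e \<pi> =
     image_mset (\<lambda>j. (drop (Suc j) \<pi>, take j \<pi>)) (mset_set {j. j < length \<pi> \<and> \<pi> ! j = edge_inv e})"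

definition positive_deformation :: "oedge \<Rightarrow> oedge list \<Rightarrow> plaquette \<Rightarrow> oedge list" where
  "positive_deformation e \<pi> q = e # plaq_rest e q @ e # \<pi>"

definition negative_deformation :: "oedge \<Rightarrow> oedge list \<Rightarrow> plaquette \<Rightarrow> oedge list" where
  "negative_deformation e \<pi> p = plaq_rest (edge_inv e) p @ \<pi>"


section \<open>Coefficients and surface sums\<close>

definition master_rhs ::
  "(oedge list \<Rightarrow> assignment \<Rightarrow> real) \<Rightarrow> oedge \<Rightarrow> oedge list \<Rightarrow> assignment \<Rightarrow> real" where
  "master_rhs c e \<pi> K =
     (\<Sum>(l1, l2)\<in>#negative_splittings e \<pi>.
        \<Sum>(K1, K2) | (\<forall>p. K1 p + K2 p = K p). c l1 K1 * c l2 K2)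
   - (\<Sum>(l1, l2)\<in>#positive_splittings e \<pi>.
        \<Sum>(K1, K2) | (\<forall>p. K1 p + K2 p = K p). c l1 K1 * c l2 K2)
   + (\<Sum>p | p \<in> plaquettes_at (edge_inv e) \<and> K p \<ge> 1.
        c (negative_deformation e \<pi> p) (assignment_remove K p))
   - (\<Sum>q | q \<in> plaquettes_at e \<and> K q \<ge> 1.
        c (positive_deformation e \<pi> q) (assignment_remove K q))"

text \<open>The first clause says that \<open>c\<close> is a function of loops up to rotation; because of it, the
  last clause is the master loop equation at every copy of every edge of a loop.\<close>

definition surface_coefficients :: "(oedge list \<Rightarrow> assignment \<Rightarrow> real) \<Rightarrow> bool" where
  "surface_coefficients c \<longleftrightarrow>
     (\<forall>l. \<forall>K\<in>finite_assignments. is_loop l \<longrightarrow> c (rotate1 l) K = c l K) \<and>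
     (\<forall>l. \<forall>K\<in>finite_assignments. is_loop l \<longrightarrow> \<not> balanced l K \<longrightarrow> c l K = 0) \<and>
     (\<forall>l. is_loop l \<longrightarrow> \<not> trivial_loop l \<longrightarrow> c l (\<lambda>_. 0) = 0) \<and>
     c [] (\<lambda>_. 0) = 1 \<and>
     (\<forall>K\<in>finite_assignments. K \<noteq> (\<lambda>_. 0) \<longrightarrow> c [] K = 0) \<and>
     (\<forall>e \<pi>. \<forall>K\<in>finite_assignments. is_loop (e # \<pi>) \<longrightarrow> c (e # \<pi>) K = master_rhs c e \<pi> K)"

definition phi_term ::
  "(oedge list \<Rightarrow> assignment \<Rightarrow> real) \<Rightarrow> real \<Rightarrow> oedge list \<Rightarrow> assignment \<Rightarrow> real" where
  "phi_term c \<beta> l K = c l K * \<beta> ^ assignment_area K"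

definition phi :: "(oedge list \<Rightarrow> assignment \<Rightarrow> real) \<Rightarrow> real \<Rightarrow> oedge list \<Rightarrow> real" where
  "phi c \<beta> l = (\<Sum>\<^sub>\<infinity>K\<in>finite_assignments. phi_term c \<beta> l K)"


section \<open>Height\<close>

text \<open>For adjacent positive plaquettes \<open>p\<close>, \<open>q\<close>, the number of times \<open>l\<close> crosses the segment from
  the center of \<open>p\<close> to the center of \<open>q\<close> from right to left: since \<open>q\<close> is clockwise, the shared edge
  with the orientation it has in \<open>q\<close> points from the right to the left of that segment (for \<open>q\<close>
  to the east of \<open>p\<close> it is the left edge of \<open>q\<close>, oriented upwards). The crossings from left to
  right are \<open>crossings l q p\<close>.\<close>

definition crossings :: "oedge list \<Rightarrow> plaquette \<Rightarrow> plaquette \<Rightarrow> nat" where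
  "crossings l p q =
     length (filter (\<lambda>e. e \<in> set (plaq_path q) \<and> edge_inv e \<in> set (plaq_path p)) l)"

definition in_box :: "int \<Rightarrow> vertex \<Rightarrow> bool" where
  "in_box R v \<longleftrightarrow> \<bar>fst v\<bar> \<le> R \<and> \<bar>snd v\<bar> \<le> R"

definition is_height :: "oedge list \<Rightarrow> (plaquette \<Rightarrow> int) \<Rightarrow> bool" where
  "is_height l h \<longleftrightarrow>
     (\<forall>p. h (plaq_inv p) = h p) \<and>
     (\<exists>R. (\<forall>e\<in>set l. in_box R (fst e) \<and> in_box R (snd e)) \<and>
          (\<forall>p. \<not> in_box R (fst p) \<longrightarrow> h p = 0)) \<and>
     (\<forall>p\<in>positive_plaquettes. \<forall>q\<in>positive_plaquettes. adjacent p q \<longrightarrow>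
        h q = h p + int (crossings l p q) - int (crossings l q p))"

definition height :: "oedge list \<Rightarrow> plaquette \<Rightarrow> int" where
  "height l = (THE h. is_height l h)"

definition height_assignment :: "oedge list \<Rightarrow> assignment" where
  "height_assignment l p =
     (if p \<in> positive_plaquettes
      then (if height l p \<ge> 0 then 0 else nat \<bar>height l p\<bar>)
      else (if height l (plaq_inv p) \<ge> 0 then nat \<bar>height l (plaq_inv p)\<bar> else 0))"

end

theory Submission
  imports Defs "HOL-Computational_Algebra.Formal_Power_Series"
begin

text \<open>Write \<open>\<Phi>(l)\<close> for the formal sum of \<open>c l K x\<^sup>K\<close> over all assignments \<open>K\<close>. In the plane the
  plaquette loops behave like free random variables, the first moment of a plaquette being the
  variable of the reversed plaquette and its higher moments being zero. A simple loop around \<open>a\<close>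
  squares is a product of \<open>a\<close> conjugated plaquette loops of the same orientation, so that its
  moments are those of a product of \<open>a\<close> free variables, each with S-transform \<open>(1 + z) / \<mu>\<close> if
  \<open>\<mu>\<close> is its first moment. Every first moment then enters \<open>\<Phi>(l\<^sup>n)\<close> with the power \<open>n\<close>, and the
  numerical factor is the coefficient of \<open>z\<^sup>n\<close> in the compositional inverse of
  \<open>z (1 + z)\<^bsup>a - 1\<^esup>\<close>, which Lagrange inversion evaluates. The proof extracts what it needs of this
  picture from the master loop equation, by peeling off one square at a time.

  Backtracks can be erased (\<open>spur_erasure\<close>): in the sum of the master loop equations at the two
  edges of a backtrack all terms cancel but the one in which the backtrack is split off. For a
  backtrack along an edge that the loop does not use, a single equation then says that the
  insertion of the plaquette on one side of the edge, taken in one orientation minus the other, has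
  the same effect as that of the plaquette on the other side. Hence a plaquette that can escape
  to infinity without crossing the loop has no effect at all (\<open>defect_outside\<close>), because a finite
  assignment vanishes far away.

  Now let \<open>l = e \<rho>\<close> be the contour of a set of squares, with the square \<open>s\<close> inside at \<open>e\<close> and the
  outside on the other side of \<open>e\<close>. Up to backtracks \<open>l = Q R\<close>, where \<open>Q\<close> is the plaquette loop of
  \<open>s\<close> starting with \<open>e\<close>, and \<open>R\<close> is the contour of the squares other than \<open>s\<close>. For words in \<open>Q\<close> and \<open>R\<close> the
  master loop equation at \<open>e\<close> closes up: with \<open>p\<close> and \<open>q\<close> the variables of the square \<open>s\<close> in the
  orientation opposite to \<open>Q\<close> and in that of \<open>Q\<close>,
  \<open>\<Phi>(Q u) = p \<Phi>(u) - q \<Phi>(Q Q u) - \<Sum> \<Phi>(Q v) \<Phi>(Q w)\<close>, the sum being over \<open>u = v Q w\<close>. An induction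
  on the area of the assignment gives \<open>\<Phi>(Q Q u) = 0\<close>, so that \<open>\<Phi>\<close> of a word is a number times the
  obvious monomial (\<open>vanishing\<close>). For the numbers \<open>f m j\<close> of the words \<open>(Q R)\<^sup>m R\<^sup>j\<close> what remains
  is a recursion in which one recognises the multiplicativity of the S-transform
  (\<open>moment_series_Suc\<close>).

  The topology is that of collapsing a disc to a tree. A discrete Jordan curve theorem
  (\<open>simple_loop_bounds\<close>) shows that a simple loop is a contour of the squares that it encloses;
  peeling preserves contours in the sense of \<open>bounds\<close> (\<open>peel_bounds\<close>), and a contour of the empty
  set runs around a tree, hence is erased by removing backtracks (\<open>tree_contour_cancels\<close>).\<close>

unbundle fps_syntax

section \<open>Moments of products of free variables\<close>

text \<open>The recurrence of the closed form in \<open>fps_nth_power_of_root\<close>. Both binomial coefficients of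
  lower index \<open>m + 1\<close> are multiples of \<open>w gchoose m\<close>, which leaves a polynomial identity.\<close>
lemma gbinomial_ballot_step:
  fixes w y b :: real
  assumes "w = y - real (Suc (Suc m)) * b - 2"
  shows "y / real (Suc (Suc m)) * ((w + 1) gchoose Suc m)
       - (y - 1) / real (Suc (Suc m)) * (w gchoose Suc m)
       = (y - 1 - b) / real (Suc m) * (w gchoose m)"
proof -
  have 1: "(w + 1) gchoose Suc m = (w gchoose m) + (w gchoose Suc m)"
    by (rule gbinomial_Suc_Suc)
  have 2: "w gchoose Suc m = (w - real m) / real (Suc m) * (w gchoose m)"
    using gbinomial_absorb_comp[of w m] gbinomial_absorption[of m w]
    by (simp add: field_simps)
  have y: "y = w + real (Suc (Suc m)) * b + 2" using assms by simp
  have aux: "(w + (M + 2) * b + 2) / (M + 2) * (g + (w - M) / (M + 1) * g)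
       - (w + (M + 2) * b + 2 - 1) / (M + 2) * ((w - M) / (M + 1) * g)
       = (w + (M + 2) * b + 2 - 1 - b) / (M + 1) * g" if "M \<ge> 0" for M g :: real
  proof -
    have "M + 1 \<noteq> 0" "M + 2 \<noteq> 0" using that by auto
    thus ?thesis by (simp add: divide_simps) algebra
  qed
  have S: "real (Suc (Suc m)) = real m + 2" "real (Suc m) = real m + 1" by simp_all
  show ?thesis unfolding 1 2 y S by (rule aux) simp
qed

text \<open>Lagrange inversion for the series \<open>V\<close>: the hypothesis gives
  \<open>V\<^bsup>k + 1\<^esup> = V\<^bsup>k\<^esup> - X V\<^bsup>k + 1 + b\<^esup>\<close>, which determines the coefficients of all powers of \<open>V\<close> by
  induction on the index and then on the exponent.\<close>
lemma fps_nth_power_of_root: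
  fixes V :: "real fps"
  assumes V: "V * (1 + fps_X * V ^ b) = 1"
  shows "V ^ k $ Suc n = - real k / real (Suc n) *
     ((- real k - real (Suc n) * real b - 1) gchoose n)"
proof (induction n arbitrary: k)
  have step: "V ^ Suc k $ Suc n = V ^ k $ Suc n - V ^ (Suc k + b) $ n" for k n
  proof -
    have "V ^ k = V ^ k * (V * (1 + fps_X * V ^ b))" using V by simp
    also have "\<dots> = V ^ Suc k + fps_X * V ^ (Suc k + b)"
      by (simp add: algebra_simps power_add)
    finally have "V ^ k $ Suc n = (V ^ Suc k + fps_X * V ^ (Suc k + b)) $ Suc n" by simp
    thus ?thesis by simp
  qed
  {
    case 0
    have "V $ 0 = 1"
      using arg_cong[OF V, of "\<lambda>f. f $ 0"] by simp
    hence V0: "V ^ k $ 0 = 1" for k by (simp add: fps_power_zeroth)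
    show ?case
      by (induction k) (simp_all add: step V0 del: power_Suc)
  next
    case (Suc n)
    show ?case
    proof (induction k)
      case 0 thus ?case by simp
    next
      case (Suc k)
      have "V ^ Suc k $ Suc (Suc n) = V ^ k $ Suc (Suc n) - V ^ (Suc k + b) $ Suc n"
        by (rule step)
      also have "\<dots> = - real k / real (Suc (Suc n)) *
          ((- real k - real (Suc (Suc n)) * real b - 1) gchoose Suc n)
        - (- real (Suc k + b) / real (Suc n) *
          ((- real (Suc k + b) - real (Suc n) * real b - 1) gchoose n))"
        by (simp only: Suc.IH \<open>\<And>k. V ^ k $ Suc n = _ k\<close>)
      also have "\<dots> = - real (Suc k) / real (Suc (Suc n)) *
          ((- real (Suc k) - real (Suc (Suc n)) * real b - 1) gchoose Suc n)"
      proof -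
        define w where "w = - real k - real (Suc (Suc n)) * real b - 2"
        have w: "- real k - real (Suc (Suc n)) * real b - 1 = w + 1"
          "- real (Suc k + b) - real (Suc n) * real b - 1 = w"
          "- real (Suc k) - real (Suc (Suc n)) * real b - 1 = w"
          by (simp_all add: w_def algebra_simps)
        have y: "- real k - 1 - real b = - real (Suc k + b)" "- real k - 1 = - real (Suc k)"
          by simp_all
        show ?thesis
          using gbinomial_ballot_step[OF w_def] unfolding w y(1) unfolding y(2)
          by linarith
      qed
      finally show ?case .
    qed
  }
qed

text \<open>The generating functions of the moments of a product of \<open>a\<close> free variables with S-transform
  \<open>1 + z\<close>. For \<open>a \<ge> 1\<close> the equation says that \<open>z (1 + z)\<^bsup>a - 1\<^esup>\<close> is the compositional inverse of
  \<open>\<psi>\<close>; the additional factor \<open>1 + \<psi>\<close> makes sense of \<open>a = 0\<close>, the moments of the constant 1.\<close>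
definition moment_series :: "nat \<Rightarrow> real fps \<Rightarrow> bool" where
  "moment_series a \<psi> \<longleftrightarrow> \<psi> $ 0 = 0 \<and> \<psi> * (1 + \<psi>) ^ a = fps_X * (1 + \<psi>)"

text \<open>With \<open>V = 1 / (1 + \<psi>)\<close> the equation becomes \<open>\<psi> = X V\<^bsup>a - 1\<^esup>\<close>, so the coefficients of \<open>\<psi>\<close> are
  those of a power of \<open>V\<close>.\<close>
lemma moment_series_nth:
  assumes "moment_series a \<psi>" "a \<ge> 1" "n \<ge> 1"
  shows "\<psi> $ n = (if a = 1 then (if n = 1 then 1 else 0)
     else (-1) ^ (n + 1) / real n * real ((n * a - 2) choose (n - 1)))"
proof -
  obtain b where a: "a = Suc b" using assms(2) by (cases a) auto
  have p0: "\<psi> $ 0 = 0" and eq: "\<psi> * (1 + \<psi>) ^ a = fps_X * (1 + \<psi>)"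
    using assms(1) by (auto simp: moment_series_def)
  define V where "V = inverse (1 + \<psi>)"
  have inv: "V * (1 + \<psi>) = 1"
    unfolding V_def by (rule inverse_mult_eq_1) (simp add: p0)
  have psi: "\<psi> = fps_X * V ^ b"
  proof -
    have "V ^ a * (\<psi> * (1 + \<psi>) ^ a) = V ^ a * (fps_X * (1 + \<psi>))" by (simp add: eq)
    hence "\<psi> * (V * (1 + \<psi>)) ^ a = fps_X * V ^ b * (V * (1 + \<psi>))"
      by (simp only: a power_mult_distrib power_Suc ac_simps)
    thus ?thesis by (simp add: inv)
  qed
  have V: "V * (1 + fps_X * V ^ b) = 1" using inv psi by simp
  obtain m where n: "n = Suc m" using assms(3) by (cases n) auto
  have nth: "\<psi> $ n = V ^ b $ m" by (subst psi) (simp add: n)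
  have V0: "V $ 0 = 1"
    using arg_cong[OF V, of "\<lambda>f. f $ 0"] by simp
  show ?thesis
  proof (cases "b = 0")
    case True
    thus ?thesis using nth by (simp add: a n)
  next
    case False
    have "V ^ b $ m = (-1) ^ m / real n * real ((n * a - 2) choose m)"
    proof (cases m)
      case 0 thus ?thesis by (simp add: n V0 fps_power_zeroth)
    next
      case (Suc k)
      have ab: "((- real n * real b) gchoose Suc k)
          = - real n * real b / real (Suc k) * ((- real n * real b - 1) gchoose k)"
        using gbinomial_absorption[of k "- real n * real b"] by (simp add: field_simps)
      have "V ^ b $ m = - real b / real (Suc k) * ((- real b - real (Suc k) * real b - 1) gchoose k)"
        using fps_nth_power_of_root[OF V, of b k] Suc by simp
      also have "\<dots> = 1 / real n * ((- real n * real b) gchoose Suc k)"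
      proof -
        have "- real b - real (Suc k) * real b - 1 = - real n * real b - 1"
          by (simp add: n Suc algebra_simps)
        moreover have "real n \<noteq> 0" by (simp add: n)
        ultimately show ?thesis unfolding ab by (simp del: of_nat_Suc)
      qed
      also have "(- real n * real b) gchoose Suc k =
          (-1) ^ m * ((real n * real b + real m - 1) gchoose m)"
        using gbinomial_minus[of "real n * real b" m] Suc by simp
      also have "real n * real b + real m - 1 = real (n * a - 2)"
      proof -
        have "n * a \<ge> 2" using False by (simp add: n a Suc)
        hence "real (n * a - 2) = real n * real a - 2" by (simp add: of_nat_diff)
        thus ?thesis by (simp add: n a algebra_simps)
      qed
      finally show ?thesis by (simp add: binomial_gbinomial)
    qed
    thus ?thesis using False nth by (simp add: a n)
  qed
qed

text \<open>Multiplication by one more free variable. In terms of \<open>F j = \<Sum>m. f m j X\<^sup>m\<close> and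
  \<open>F 0 = 1 + \<psi>'\<close> the recursion reads \<open>F j = f 0 j + w F (j + 1)\<close> with \<open>w = X / (1 + \<psi>')\<close>.
  Iterating it gives \<open>1 + \<psi>' = (1 + \<psi>) \<circ> w\<close>, and substituting \<open>w\<close> into the equation of \<open>\<psi>\<close> yields that
  of \<open>\<psi>'\<close>.\<close>
lemma moment_series_Suc:
  fixes f :: "nat \<Rightarrow> nat \<Rightarrow> real"
  assumes ms: "moment_series a \<psi>"
    and f0: "f 0 0 = 1" "\<And>j. f 0 (Suc j) = \<psi> $ Suc j"
    and fS: "\<And>m j. f (Suc m) j = f m (Suc j) - (\<Sum>k<m. f (Suc k) 0 * f (m - k) j)"
  shows "moment_series (Suc a) (Abs_fps (\<lambda>m. if m = 0 then 0 else f m 0))"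
proof -
  define \<psi>' where "\<psi>' = Abs_fps (\<lambda>m. if m = 0 then 0 else f m 0)"
  define F where "F = (\<lambda>j. Abs_fps (\<lambda>m. f m j))"
  define M where "M = 1 + \<psi>"
  have p0: "\<psi> $ 0 = 0" and eq: "\<psi> * (1 + \<psi>) ^ a = fps_X * (1 + \<psi>)"
    using ms by (auto simp: moment_series_def)
  have Mnth: "M $ j = f 0 j" for j by (cases j) (simp_all add: M_def f0 p0)
  have F0: "F 0 = 1 + \<psi>'"
    by (rule fps_ext) (simp add: F_def \<psi>'_def f0)
  define V where "V = inverse (1 + \<psi>')"
  have inv: "V * (1 + \<psi>') = 1"
    unfolding V_def by (rule inverse_mult_eq_1) (simp add: \<psi>'_def)
  define w where "w = fps_X * V"
  have rec: "(1 + \<psi>') * (F j - fps_const (f 0 j)) = fps_X * F (Suc j)" for j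
  proof (rule fps_ext)
    fix n
    show "((1 + \<psi>') * (F j - fps_const (f 0 j))) $ n = (fps_X * F (Suc j)) $ n"
    proof (cases n)
      case 0 thus ?thesis by (simp add: F_def)
    next
      case (Suc m)
      have "(\<psi>' * (F j - fps_const (f 0 j))) $ Suc m
          = (\<Sum>i=0..Suc m. \<psi>' $ i * (F j - fps_const (f 0 j)) $ (Suc m - i))"
        by (rule fps_mult_nth)
      also have "\<dots> = (\<Sum>i<Suc (Suc m). \<psi>' $ i * (F j - fps_const (f 0 j)) $ (Suc m - i))"
        by (rule sum.cong) auto
      also have "\<dots> = (\<Sum>k<m. f (Suc k) 0 * f (m - k) j)"
        by (subst sum.lessThan_Suc_shift, subst sum.lessThan_Suc)
           (auto simp: \<psi>'_def F_def intro!: sum.cong)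
      finally show ?thesis using fS[of m j] unfolding Suc
        by (simp add: distrib_right F_def)
    qed
  qed
  have step: "F j = fps_const (f 0 j) + w * F (Suc j)" for j
  proof -
    have "V * ((1 + \<psi>') * (F j - fps_const (f 0 j))) = w * F (Suc j)"
      by (simp only: rec w_def ac_simps)
    hence "F j - fps_const (f 0 j) = w * F (Suc j)"
      by (simp add: mult.assoc[symmetric] inv)
    thus ?thesis by (simp add: algebra_simps)
  qed
  have expand: "F 0 = (\<Sum>i<J. fps_const (f 0 i) * w ^ i) + w ^ J * F J" for J
  proof (induction J)
    case (Suc J)
    thus ?case by (subst (asm) (2) step) (simp add: algebra_simps)
  qed simp
  have w0: "w $ 0 = 0" by (simp add: w_def)
  have comp: "F 0 = M oo w"
  proof (rule fps_ext)
    fix n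
    have "w ^ Suc n * F (Suc n) = fps_X ^ Suc n * (V ^ Suc n * F (Suc n))"
      by (simp only: w_def power_mult_distrib mult.assoc)
    hence z: "(w ^ Suc n * F (Suc n)) $ n = 0"
      by (simp only: fps_X_power_mult_nth if_True lessI)
    have "F 0 $ n = (\<Sum>i<Suc n. f 0 i * (w ^ i) $ n)"
      by (subst expand[of "Suc n"]) (simp add: fps_sum_nth z del: power_Suc sum.lessThan_Suc)
    also have "\<dots> = (M oo w) $ n"
      unfolding fps_compose_nth by (rule sum.cong) (auto simp: Mnth)
    finally show "F 0 $ n = (M oo w) $ n" .
  qed
  have c1: "1 + \<psi>' = (1 + \<psi>) oo w" using comp F0 by (simp add: M_def)
  hence c2: "\<psi>' = \<psi> oo w" by (simp add: fps_compose_add_distrib)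
  have "(\<psi> * (1 + \<psi>) ^ a) oo w = (fps_X * (1 + \<psi>)) oo w" by (simp add: eq)
  hence "\<psi>' * (1 + \<psi>') ^ a = w * (1 + \<psi>')"
    by (simp add: fps_compose_mult_distrib[OF w0] fps_compose_power[OF w0, symmetric] c1 c2[symmetric] w0)
  also have "\<dots> = fps_X" by (simp add: w_def mult.assoc inv)
  finally have "\<psi>' * (1 + \<psi>') ^ Suc a = fps_X * (1 + \<psi>')"
    by (simp add: algebra_simps)
  thus ?thesis by (simp add: moment_series_def \<psi>'_def)
qed

section \<open>Assignments and splittings\<close>

(* Assignments are treated as functions of an atomic variable; only later do plaquettes have
   coordinates. *)
declare split_paired_All [simp del] split_paired_Ex [simp del]

abbreviation finitary :: "assignment \<Rightarrow> bool" where
  "finitary K \<equiv> K \<in> finite_assignments"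

definition convolution ::
    "(assignment \<Rightarrow> real) \<Rightarrow> (assignment \<Rightarrow> real) \<Rightarrow> assignment \<Rightarrow> real" where
  "convolution f g K = (\<Sum>(K1, K2) | (\<forall>p. K1 p + K2 p = K p). f K1 * g K2)"

lemma finite_decompositions:
  assumes "finitary K"
  shows "finite {(K1, K2). \<forall>p. K1 p + K2 p = K p}"
proof -
  let ?A = "{p. K p \<noteq> 0}"
  let ?F = "{f. \<forall>p. (p \<in> ?A \<longrightarrow> f p \<in> {..Max (K ` ?A)}) \<and> (p \<notin> ?A \<longrightarrow> f p = (0::nat))}"
  have fA: "finite ?A" using assms by (simp add: finite_assignments_def)
  have fF: "finite ?F" using fA by (intro finite_set_of_finite_funs) auto
  have "K' \<in> ?F" if "\<And>p. K' p \<le> K p" for K'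
  proof -
    have "K' p \<le> Max (K ` ?A)" if "p \<in> ?A" for p
    proof -
      have "K p \<le> Max (K ` ?A)" using fA that by (intro Max_ge) auto
      thus ?thesis using \<open>K' p \<le> K p\<close> by (rule order_trans[rotated])
    qed
    moreover have "K' p = 0" if "p \<notin> ?A" for p
      using \<open>K' p \<le> K p\<close> that by simp
    ultimately show ?thesis by simp
  qed
  note F = this
  have "{(K1, K2). \<forall>p. K1 p + K2 p = K p} \<subseteq> ?F \<times> ?F"
  proof (rule subrelI)
    fix K1 K2 assume "(K1, K2) \<in> {(K1, K2). \<forall>p. K1 p + K2 p = K p}"
    hence s: "\<forall>p. K1 p + K2 p = K p" by simp
    have le: "K1 p \<le> K p" "K2 p \<le> K p" for p
      using s[rule_format, of p] by linarith+
    have "K1 \<in> ?F" "K2 \<in> ?F" by (rule F, rule le)+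
    thus "(K1, K2) \<in> ?F \<times> ?F" by (rule SigmaI)
  qed
  thus ?thesis by (rule finite_subset) (rule finite_cartesian_product[OF fF fF])
qed

lemma decomposition_finitary:
  assumes "finitary K" "\<And>p. K1 p + K2 p = K p"
  shows "finitary K1" "finitary K2"
proof -
  have "{p. K1 p \<noteq> 0} \<subseteq> {p. K p \<noteq> 0}" "{p. K2 p \<noteq> 0} \<subseteq> {p. K p \<noteq> 0}"
    using assms(2) by (metis (mono_tags, lifting) Collect_mono add_is_0)+
  thus "finitary K1" "finitary K2"
    using assms(1) unfolding finite_assignments_def by (auto intro: finite_subset)
qed

lemma assignment_area_superset:
  assumes "finite A" "{p. K p \<noteq> 0} \<subseteq> A"
  shows "assignment_area K = sum K A"
  unfolding assignment_area_def by (rule sum.mono_neutral_left) (use assms in auto)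

lemma decomposition_area:
  assumes "finitary K" "\<And>p. K1 p + K2 p = K p"
  shows "assignment_area K1 + assignment_area K2 = assignment_area K"
proof -
  let ?A = "{p. K p \<noteq> 0}"
  have A: "finite ?A" using assms(1) by (simp add: finite_assignments_def)
  have "{p. K1 p \<noteq> 0} \<subseteq> ?A" "{p. K2 p \<noteq> 0} \<subseteq> ?A"
    using assms(2) by (metis (mono_tags, lifting) Collect_mono add_is_0)+
  thus ?thesis
    by (simp add: assignment_area_superset[OF A] sum.distrib[symmetric] assms(2))
qed

lemma convolution_cong:
  assumes "finitary K"
    and "\<And>K'. finitary K' \<Longrightarrow> assignment_area K' \<le> assignment_area K \<Longrightarrow> f K' = f' K'"
    and "\<And>K'. finitary K' \<Longrightarrow> assignment_area K' \<le> assignment_area K \<Longrightarrow> g K' = g' K'"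
  shows "convolution f g K = convolution f' g' K"
  unfolding convolution_def
proof (rule sum.cong[OF refl], clarify)
  fix K1 K2 assume "\<forall>p. K1 p + K2 p = K p"
  thus "f K1 * g K2 = f' K1 * g' K2"
    using decomposition_finitary[OF assms(1), of K1 K2] decomposition_area[OF assms(1), of K1 K2]
    by (simp add: assms(2,3))
qed

lemma convolution_commute: "convolution f g K = convolution g f K"
  unfolding convolution_def
  by (rule sum.reindex_bij_witness[of _ prod.swap prod.swap]) (auto simp: add.commute mult.commute)

lemma convolution_concentrated:
  assumes K: "finitary K"
    and f: "\<And>K'. finitary K' \<Longrightarrow> assignment_area K' \<le> assignment_area K \<Longrightarrow> K' \<noteq> A \<Longrightarrow> f K' = 0"
    and g: "\<And>K'. finitary K' \<Longrightarrow> assignment_area K' \<le> assignment_area K \<Longrightarrow> K' \<noteq> B \<Longrightarrow> g K' = 0"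
  shows "convolution f g K = (if \<forall>p. A p + B p = K p then f A * g B else 0)"
proof -
  let ?D = "{(K1, K2). \<forall>p. K1 p + K2 p = K p}"
  have z: "f K1 * g K2 = 0" if "(K1, K2) \<in> ?D" "(K1, K2) \<noteq> (A, B)" for K1 K2
  proof -
    have s: "K1 p + K2 p = K p" for p using that(1) by simp
    note d = decomposition_finitary[OF K s] decomposition_area[OF K s]
    have "f K1 = 0 \<or> g K2 = 0"
      using that(2) f[of K1] g[of K2] d by fastforce
    thus ?thesis by auto
  qed
  show ?thesis
  proof (cases "(A, B) \<in> ?D")
    case True
    have "convolution f g K = (\<Sum>(K1, K2)\<in>{(A, B)}. f K1 * g K2)"
      unfolding convolution_def
    proof (rule sum.mono_neutral_right)
      show "finite ?D" by (rule finite_decompositions[OF K])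
      show "{(A, B)} \<subseteq> ?D" using True by simp
      show "\<forall>i\<in>?D - {(A, B)}. (case i of (K1, K2) \<Rightarrow> f K1 * g K2) = 0"
      proof
        fix i assume i: "i \<in> ?D - {(A, B)}"
        obtain K1 K2 where "i = (K1, K2)" by (cases i)
        thus "(case i of (K1, K2) \<Rightarrow> f K1 * g K2) = 0" using z[of K1 K2] i by simp
      qed
    qed
    thus ?thesis using True by simp
  next
    case False
    have "convolution f g K = 0"
      unfolding convolution_def
    proof (rule sum.neutral, clarify)
      fix K1 K2 assume "\<forall>p. K1 p + K2 p = K p"
      hence D: "(K1, K2) \<in> ?D" by simp
      moreover have "(K1, K2) \<noteq> (A, B)" using D False by metis
      ultimately show "f K1 * g K2 = 0" by (rule z)
    qed
    moreover have "\<not> (\<forall>p. A p + B p = K p)" using False by simp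
    ultimately show ?thesis by (simp only: if_False)
  qed
qed

lemma finitary_zero: "finitary (\<lambda>_. 0)"
  by (simp add: finite_assignments_def)

lemma convolution_unit:
  assumes "finitary K" "\<And>K'. finitary K' \<Longrightarrow> u K' = (if K' = (\<lambda>_. 0) then 1 else 0)"
  shows "convolution f u K = f K"
proof -
  have "convolution f u K = convolution (\<lambda>K'. if K' = K then f K else 0) u K"
    unfolding convolution_def
  proof (rule sum.cong[OF refl], clarify)
    fix K1 K2 assume s: "\<forall>p. K1 p + K2 p = K p"
    have f2: "finitary K2" by (rule decomposition_finitary(2)[OF assms(1) s[rule_format]])
    have "K1 = K" if "K2 = (\<lambda>_. 0)"
      by (rule ext) (use s that in simp)
    thus "f K1 * u K2 = (if K1 = K then f K else 0) * u K2"
      unfolding assms(2)[OF f2] by simp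
  qed
  also have "\<dots> = f K"
    by (subst convolution_concentrated[OF assms(1), where A = K and B = "\<lambda>_. 0"])
      (simp_all add: assms(2) finitary_zero)
  finally show ?thesis .
qed

lemma assignment_remove_finitary:
  assumes "finitary K"
  shows "finitary (assignment_remove K p)"
proof -
  have "{x. assignment_remove K p x \<noteq> 0} \<subseteq> {x. K x \<noteq> 0}"
    by (auto simp: assignment_remove_def split: if_splits)
  thus ?thesis using assms finite_subset unfolding finite_assignments_def by blast
qed

lemma assignment_remove_area:
  assumes "finitary K" "K p \<ge> 1"
  shows "assignment_area (assignment_remove K p) < assignment_area K"
proof -
  let ?A = "{p. K p \<noteq> 0}"
  have A: "finite ?A" using assms(1) by (simp add: finite_assignments_def)
  have "assignment_area (assignment_remove K p) = sum (assignment_remove K p) ?A"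
    by (rule assignment_area_superset[OF A]) (auto simp: assignment_remove_def)
  also have "\<dots> < sum K ?A"
    by (rule sum_strict_mono_ex1[OF A]) (use assms(2) in \<open>auto simp: assignment_remove_def\<close>)
  finally show ?thesis by (simp add: assignment_area_def)
qed

text \<open>A sum over the cuts of a list at the entries satisfying \<open>P\<close>, where \<open>a\<close> is the part that has
  already been passed. In this recursive form the splittings of a loop can be followed through a
  concatenation of lists.\<close>
fun split_sum :: "('a \<Rightarrow> bool) \<Rightarrow> ('a list \<Rightarrow> 'a list \<Rightarrow> real) \<Rightarrow> 'a list \<Rightarrow> 'a list \<Rightarrow> real" where
  "split_sum P g a [] = 0"
| "split_sum P g a (x # b) = (if P x then g a b else 0) + split_sum P g (a @ [x]) b"

lemma split_sum_cong:
  assumes "\<And>b x c. l = b @ x # c \<Longrightarrow> P x \<Longrightarrow> g (a @ b) c = g' (a' @ b) c"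
  shows "split_sum P g a l = split_sum P g' a' l"
  using assms
proof (induction l arbitrary: a a')
  case (Cons x l)
  have "split_sum P g (a @ [x]) l = split_sum P g' (a' @ [x]) l"
    using Cons.prems[of "x # _"] by (intro Cons.IH) simp
  moreover have "P x \<Longrightarrow> g a l = g' a' l" using Cons.prems[of "[]"] by simp
  ultimately show ?case by simp
qed simp

lemma split_sum_append:
  "split_sum P g a (b @ c) = split_sum P (\<lambda>x y. g x (y @ c)) a b + split_sum P g (a @ b) c"
  by (induction b arbitrary: a) simp_all

lemma split_sum_none: "(\<And>x. x \<in> set l \<Longrightarrow> \<not> P x) \<Longrightarrow> split_sum P g a l = 0"
  by (induction l arbitrary: a) simp_all

lemma split_sum_zero:
  assumes "\<And>b x c. l = b @ x # c \<Longrightarrow> P x \<Longrightarrow> g (a @ b) c = 0"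
  shows "split_sum P g a l = 0"
proof -
  have "split_sum P g a l = split_sum P (\<lambda>_ _. 0) a l"
    using assms by (rule split_sum_cong)
  also have "\<dots> = 0" by (induction l arbitrary: a) simp_all
  finally show ?thesis .
qed

lemma split_sum_index:
  "split_sum P g a l = (\<Sum>j | j < length l \<and> P (l ! j). g (a @ take j l) (drop (Suc j) l))"
proof (induction l arbitrary: a)
  case (Cons x l)
  have fin: "finite {j. j < length l \<and> P (l ! j)}" by simp
  have e: "{j. j < length (x # l) \<and> P ((x # l) ! j)}
      = (if P x then {0} else {}) \<union> Suc ` {j. j < length l \<and> P (l ! j)}"
    by (auto simp: image_iff less_Suc_eq_0_disj)
  show ?case unfolding e
    by (subst sum.union_disjoint) (auto simp: Cons.IH sum.reindex fin)
qed simp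

section \<open>Loops spelled with two letters\<close>

text \<open>In a word \<open>True\<close> stands for the plaquette loop \<open>Q\<close> around the square that is peeled off and
  \<open>False\<close> for the remaining loop \<open>R\<close>. The plaquettes \<open>p\<close> and \<open>q\<close> are that square in the orientation
  opposite to \<open>Q\<close> and in the orientation of \<open>Q\<close>, and \<open>L\<close> is the assignment on which \<open>R\<close> itself is
  concentrated.\<close>
locale two_letter_sum =
  fixes \<Phi> :: "bool list \<Rightarrow> assignment \<Rightarrow> real"
    and p q :: plaquette and L :: assignment and \<psi> :: "real fps" and a :: nat
  assumes rotate: "\<And>u v K. finitary K \<Longrightarrow> \<Phi> (u @ v) K = \<Phi> (v @ u) K"
    and pure: "\<And>j K. finitary K \<Longrightarrow>
      \<Phi> (replicate j False) K = (if K = (\<lambda>x. j * L x) then (1 + \<psi>) $ j else 0)"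
    and moments: "moment_series a \<psi>"
    and L_finitary: "finitary L"
    and master: "\<And>u K. finitary K \<Longrightarrow> \<Phi> (True # u) K =
        (if K p \<ge> 1 then \<Phi> u (assignment_remove K p) else 0)
      - (if K q \<ge> 1 then \<Phi> (True # True # u) (assignment_remove K q) else 0)
      - split_sum (\<lambda>x. x) (\<lambda>v w. convolution (\<Phi> (True # v)) (\<Phi> (True # w)) K) [] u"
begin

text \<open>The only assignment for which a word can have a non-zero coefficient: every \<open>Q\<close> uses up one
  \<open>p\<close> and every \<open>R\<close> one copy of \<open>L\<close>.\<close>
definition content :: "bool list \<Rightarrow> assignment" where
  "content w = (\<lambda>x. (if x = p then count_list w True else 0) + count_list w False * L x)"

lemma content_append: "content (u @ v) x = content u x + content v x"
  by (simp add: content_def algebra_simps)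

lemma content_finitary: "finitary (content w)"
proof -
  have "{x. content w x \<noteq> 0} \<subseteq> insert p {x. L x \<noteq> 0}" by (auto simp: content_def)
  thus ?thesis using L_finitary unfolding finite_assignments_def
    by (auto intro: finite_subset)
qed

lemma content_True: "content (True # u) = (content u)(p := Suc (content u p))"
  by (auto simp: content_def)

lemma remove_content: "assignment_remove (content (True # u)) p = content u"
  by (auto simp: content_True assignment_remove_def)

lemma remove_eq_content:
  assumes "K p \<ge> 1" "assignment_remove K p = content u"
  shows "K = content (True # u)"
  using assms unfolding content_True assignment_remove_def
  by (metis One_nat_def Suc_pred' fun_upd_idem_iff fun_upd_same fun_upd_upd less_eq_Suc_le)

lemma content_pure: "content (replicate j False) = (\<lambda>x. j * L x)"
proof -
  have "count_list (replicate j False) True = 0" "count_list (replicate j False) False = j"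
    by (induction j) simp_all
  thus ?thesis by (intro ext) (simp only: content_def if_cancel add_0)
qed

text \<open>The two claims need each other. A word with two adjacent copies of \<open>Q\<close> vanishes because in its
  master equation the term with \<open>p\<close> cancels against the splitting between these copies, which
  splits off \<open>Q\<close> with coefficient 1, while all other terms leave the adjacent copies together, in a
  shorter word or with a smaller assignment. Its vanishing in turn removes the term with \<open>q\<close> from the master equation of
  every word, and the remaining terms only see assignments that add up to the content.\<close>
lemma vanishing:
  "finitary K \<Longrightarrow> (K \<noteq> content w \<longrightarrow> \<Phi> w K = 0) \<and> (\<forall>u. w = True # True # u \<longrightarrow> \<Phi> w K = 0)"
proof (induction "(assignment_area K, length w)" arbitrary: K w rule: wf_induct_rule[OF wf_lex_prod[OF wf_less_than wf_less_than]])
  case (1 K w)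
  note K = \<open>finitary K\<close>
  have IH: "(K' \<noteq> content w' \<longrightarrow> \<Phi> w' K' = 0) \<and> (\<forall>u. w' = True # True # u \<longrightarrow> \<Phi> w' K' = 0)"
    if "assignment_area K' < assignment_area K \<or> assignment_area K' \<le> assignment_area K \<and> length w' < length w"
      "finitary K'" for K' w'
    using 1(1)[of K' w'] that by (auto simp: le_less)
  have A: "\<Phi> (True # u) K = 0" if len: "length w = Suc (length u)" and ne: "K \<noteq> content (True # u)" for u
  proof -
    have "K p \<ge> 1 \<Longrightarrow> \<Phi> u (assignment_remove K p) = 0"
      using IH[of "assignment_remove K p" u] remove_eq_content[of K u] ne
        assignment_remove_finitary[OF K] assignment_remove_area[OF K] by blast
    moreover have "K q \<ge> 1 \<Longrightarrow> \<Phi> (True # True # u) (assignment_remove K q) = 0"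
      using IH[of "assignment_remove K q" "True # True # u"]
        assignment_remove_finitary[OF K] assignment_remove_area[OF K] by blast
    moreover have "split_sum (\<lambda>x. x) (\<lambda>v w. convolution (\<Phi> (True # v)) (\<Phi> (True # w)) K) [] u = 0"
    proof (rule split_sum_zero)
      fix v x v' assume u: "u = v @ x # v'" and x: x
      have "convolution (\<Phi> (True # v)) (\<Phi> (True # v')) K
        = (if \<forall>p. content (True # v) p + content (True # v') p = K p
           then \<Phi> (True # v) (content (True # v)) * \<Phi> (True # v') (content (True # v')) else 0)"
        by (rule convolution_concentrated[OF K]; use IH len u in auto)
      moreover have "\<not> (\<forall>p. content (True # v) p + content (True # v') p = K p)"
      proof
        assume *: "\<forall>p. content (True # v) p + content (True # v') p = K p"
        have "content (True # u) y = content (True # v) y + content (True # v') y" for y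
          using content_append[of "True # v" "True # v'" y] u x by simp
        hence "K = content (True # u)" using * by auto
        thus False using ne by simp
      qed
      ultimately show "convolution (\<Phi> (True # [] @ v)) (\<Phi> (True # v')) K = 0" by simp
    qed
    ultimately show ?thesis by (simp add: master[OF K])
  qed
  have B: "\<Phi> w K = 0" if w: "w = True # True # u" and eq: "K = content w" for u
  proof -
    have Kp: "K p \<ge> 1" unfolding eq w by (simp add: content_True)
    have q0: "K q \<ge> 1 \<Longrightarrow> \<Phi> (True # True # True # u) (assignment_remove K q) = 0"
      using IH[of "assignment_remove K q" "True # True # True # u"]
        assignment_remove_finitary[OF K] assignment_remove_area[OF K] by blast
    \<comment> \<open>The first moment of a plaquette: its loop is filled by one copy of the reversed plaquette.\<close>
    have one: "\<Phi> [True] (content [True]) = 1"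
    proof -
      have fc: "finitary (content [True])" by (rule content_finitary)
      have "\<Phi> [] (content []) = 1"
        using pure[OF finitary_zero, of 0] moments content_pure[of 0]
        by (simp add: moment_series_def)
      moreover have "content [True] q \<ge> 1 \<Longrightarrow> \<Phi> [True, True] (assignment_remove (content [True]) q) = 0"
      proof -
        assume c: "content [True] q \<ge> 1"
        have "K x = content [True] x + content (True # u) x" for x
          using content_append[of "[True]" "True # u" x] by (simp add: eq w)
        from decomposition_area[OF K this[symmetric]]
        have "assignment_area (assignment_remove (content [True]) q) < assignment_area K"
          using assignment_remove_area[OF fc c] by linarith
        thus ?thesis using IH assignment_remove_finitary[OF fc] by blast
      qed
      moreover have "content [True] p \<ge> 1" by (simp add: content_True)
      ultimately show ?thesis using master[OF fc, of "[]"]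
        by (auto simp: remove_content)
    qed
    have "split_sum (\<lambda>x. x) (\<lambda>v w. convolution (\<Phi> (True # v)) (\<Phi> (True # w)) K) [True] u = 0"
    proof (rule split_sum_zero)
      fix v x v' assume u: "u = v @ x # v'" and x: x
      have "convolution (\<Phi> (True # True # v)) (\<Phi> (True # v')) K
        = (if \<forall>p. content (True # True # v) p + content (True # v') p = K p
           then \<Phi> (True # True # v) (content (True # True # v)) * \<Phi> (True # v') (content (True # v')) else 0)"
        by (rule convolution_concentrated[OF K]; use IH w u in auto)
      moreover have "\<Phi> (True # True # v) (content (True # True # v)) = 0"
        if "\<forall>p. content (True # True # v) p + content (True # v') p = K p"
        using IH[of "content (True # True # v)" "True # True # v"] w u content_finitary
          decomposition_area[OF K that[rule_format]] by auto
      ultimately show "convolution (\<Phi> (True # [True] @ v)) (\<Phi> (True # v')) K = 0" by simp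
    qed
    moreover have "convolution (\<Phi> [True]) (\<Phi> (True # u)) K = \<Phi> (True # u) (content (True # u))"
    proof -
      have "convolution (\<Phi> [True]) (\<Phi> (True # u)) K
        = (if \<forall>p. content [True] p + content (True # u) p = K p
           then \<Phi> [True] (content [True]) * \<Phi> (True # u) (content (True # u)) else 0)"
        by (rule convolution_concentrated[OF K]; use IH w in auto)
      moreover have "\<forall>x. content [True] x + content (True # u) x = K x"
        using content_append[of "[True]" "True # u"] by (simp add: eq w)
      ultimately show ?thesis using one by simp
    qed
    moreover have "\<Phi> (True # u) (assignment_remove K p) = \<Phi> (True # u) (content (True # u))"
      by (simp add: eq w remove_content)
    ultimately show ?thesis using master[OF K, of "True # u"] Kp q0 by (simp add: w)
  qed
  show ?case
  proof (cases "True \<in> set w")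
    case False
    hence "w = replicate (length w) False"
      by (metis (full_types) replicate_length_same)
    then obtain j where w: "w = replicate j False" by blast
    have "content w = (\<lambda>x. j * L x)" by (simp add: w content_pure)
    thus ?thesis using pure[OF K, of j] w by (cases j) auto
  next
    case True
    then obtain v u where w: "w = v @ True # u" by (meson split_list)
    have r: "\<Phi> w K = \<Phi> (True # u @ v) K" using rotate[OF K, of v "True # u"] w by simp
    have c: "content w = content (True # u @ v)"
      by (auto simp: content_def w)
    have "K \<noteq> content w \<longrightarrow> \<Phi> w K = 0" using A[of "u @ v"] r c w by simp
    thus ?thesis using B by blast
  qed
qed

lemma support: "finitary K \<Longrightarrow> K \<noteq> content w \<Longrightarrow> \<Phi> w K = 0"
  using vanishing by blast

definition value_of :: "bool list \<Rightarrow> real" where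
  "value_of w = \<Phi> w (content w)"

lemma value_rotate: "value_of (u @ v) = value_of (v @ u)"
proof -
  have "content (u @ v) = content (v @ u)" by (auto simp: content_append)
  thus ?thesis unfolding value_of_def using rotate[OF content_finitary] by simp
qed

lemma value_master:
  "value_of (True # u) = value_of u
     - split_sum (\<lambda>x. x) (\<lambda>v w. value_of (True # v) * value_of (True # w)) [] u"
proof -
  let ?K = "content (True # u)"
  have K: "finitary ?K" by (rule content_finitary)
  have "split_sum (\<lambda>x. x) (\<lambda>v w. convolution (\<Phi> (True # v)) (\<Phi> (True # w)) ?K) [] u
      = split_sum (\<lambda>x. x) (\<lambda>v w. value_of (True # v) * value_of (True # w)) [] u"
  proof (rule split_sum_cong)
    fix v x v' assume u: "u = v @ x # v'" and x: x
    have "\<forall>y. content (True # v) y + content (True # v') y = ?K y"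
      using content_append[of "True # v" "True # v'"] u x by simp
    thus "convolution (\<Phi> (True # [] @ v)) (\<Phi> (True # v')) ?K
      = value_of (True # [] @ v) * value_of (True # v')"
      by (subst convolution_concentrated[OF K support support]) (auto simp: value_of_def)
  qed
  moreover have "?K q \<ge> 1 \<longrightarrow> \<Phi> (True # True # u) (assignment_remove ?K q) = 0"
    using vanishing assignment_remove_finitary[OF K] by blast
  moreover have "?K p \<ge> 1" by (simp add: content_True)
  ultimately show ?thesis using master[OF K, of u]
    by (auto simp: value_of_def remove_content)
qed

abbreviation alternating :: "nat \<Rightarrow> bool list" where
  "alternating m \<equiv> concat (replicate m [True, False])"

lemma split_alternating:
  "split_sum (\<lambda>x. x) g v (alternating m @ replicate j False)
     = (\<Sum>k<m. g (v @ alternating k) (False # alternating (m - Suc k) @ replicate j False))"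
proof (induction m arbitrary: v)
  case 0
  show ?case using split_sum_none[of "replicate j False" "\<lambda>x. x"] by simp
next
  case (Suc m)
  show ?case by (subst sum.lessThan_Suc_shift) (simp add: Suc.IH)
qed

text \<open>The words \<open>(Q R)\<^sup>m R\<^sup>j\<close> are closed under the operations at their first letter: deleting it
  gives, up to rotation, \<open>(Q R)\<^bsup>m - 1\<^esup> R\<^bsup>j + 1\<^esup>\<close>, and splitting at another \<open>Q\<close> cuts off a power of
  \<open>Q R\<close>.\<close>
lemma alternating_recurrence:
  fixes f
  defines "f \<equiv> \<lambda>m j. value_of (alternating m @ replicate j False)"
  shows "f (Suc m) j = f m (Suc j) - (\<Sum>k<m. f (Suc k) 0 * f (m - k) j)"
proof -
  let ?u = "False # alternating m @ replicate j False"
  have "f (Suc m) j = value_of ?u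
     - split_sum (\<lambda>x. x) (\<lambda>v w. value_of (True # v) * value_of (True # w)) [] ?u"
    unfolding f_def using value_master[of ?u] by simp
  also have "value_of ?u = f m (Suc j)"
    using value_rotate[of "[False]" "alternating m @ replicate j False"]
    by (simp add: f_def replicate_append_same[symmetric])
  also have "split_sum (\<lambda>x. x) (\<lambda>v w. value_of (True # v) * value_of (True # w)) [] ?u
     = (\<Sum>k<m. f (Suc k) 0 * f (m - k) j)"
  proof -
    have "True # False # alternating (m - Suc k) @ replicate j False
      = alternating (m - k) @ replicate j False" if "k < m" for k
    proof -
      have "m - k = Suc (m - Suc k)" using that by simp
      thus ?thesis by simp
    qed
    note e = this
    show ?thesis
      using split_alternating[of "\<lambda>v w. value_of (True # v) * value_of (True # w)" "[False]" m j]
      by (simp add: f_def e)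
  qed
  finally show ?thesis .
qed

lemma alternating_values:
  "\<exists>\<psi>'. moment_series (Suc a) \<psi>' \<and>
     (\<forall>m K. finitary K \<longrightarrow> \<Phi> (alternating m) K
        = (if K = (\<lambda>x. m * (if x = p then Suc (L x) else L x)) then (1 + \<psi>') $ m else 0))"
proof -
  define f where "f = (\<lambda>m j. value_of (alternating m @ replicate j False))"

  have p0: "\<psi> $ 0 = 0" using moments by (simp add: moment_series_def)
  have f0: "f 0 j = (1 + \<psi>) $ j" for j
    using pure[OF content_finitary, of j "replicate j False"] by (simp add: f_def value_of_def content_pure)
  have rec: "f (Suc m) j = f m (Suc j) - (\<Sum>k<m. f (Suc k) 0 * f (m - k) j)" for m j
    unfolding f_def by (rule alternating_recurrence)
  have "moment_series (Suc a) (Abs_fps (\<lambda>m. if m = 0 then 0 else f m 0))" (is "moment_series _ ?\<psi>'")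
    by (rule moment_series_Suc[OF moments _ _ rec]) (simp_all add: f0 p0)
  moreover have "\<Phi> (alternating m) K
        = (if K = (\<lambda>x. m * (if x = p then Suc (L x) else L x)) then (1 + ?\<psi>') $ m else 0)"
    if K: "finitary K" for m K
  proof -
    have ct: "count_list (alternating m) True = m" "count_list (alternating m) False = m"
      by (induction m) simp_all
    have c: "content (alternating m) = (\<lambda>x. m * (if x = p then Suc (L x) else L x))"
      by (auto simp: content_def ct)
    have "value_of (alternating m) = (1 + ?\<psi>') $ m"
    proof (cases m)
      case 0 thus ?thesis using f0[of 0] by (simp add: f_def p0)
    qed (simp add: f_def)
    thus ?thesis using support[OF K, of "alternating m"] by (auto simp: value_of_def c)
  qed
  ultimately show ?thesis by blast
qed

end

section \<open>Walks, edges and plaquettes\<close>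

fun walk :: "vertex \<Rightarrow> oedge list \<Rightarrow> vertex \<Rightarrow> bool" where
  "walk u [] v \<longleftrightarrow> u = v"
| "walk u (e # l) v \<longleftrightarrow> e \<in> lattice_edges \<and> fst e = u \<and> walk (snd e) l v"

lemma walk_append: "walk u (a @ b) v \<longleftrightarrow> (\<exists>w. walk u a w \<and> walk w b v)"
  by (induction a arbitrary: u) auto

lemma walk_edges: "walk u l v \<Longrightarrow> set l \<subseteq> lattice_edges"
proof (induction l arbitrary: u)
  case (Cons e l)
  thus ?case using Cons.IH[of "snd e"] by simp
qed simp

lemma walk_iff:
  "l \<noteq> [] \<Longrightarrow> walk u l v \<longleftrightarrow> set l \<subseteq> lattice_edges \<and> fst (hd l) = u \<and> snd (last l) = v \<and>
     (\<forall>i. Suc i < length l \<longrightarrow> snd (l ! i) = fst (l ! Suc i))"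
proof (induction l arbitrary: u)
  case (Cons e l)
  show ?case
  proof (cases "l = []")
    case False
    have "(\<forall>i. Suc i < length (e # l) \<longrightarrow> snd ((e # l) ! i) = fst ((e # l) ! Suc i))
      \<longleftrightarrow> snd e = fst (hd l) \<and> (\<forall>i. Suc i < length l \<longrightarrow> snd (l ! i) = fst (l ! Suc i))"
      (is "?A \<longleftrightarrow> ?B")
    proof
      assume A: ?A
      have "snd (l ! i) = fst (l ! Suc i)" if "Suc i < length l" for i
        using A[rule_format, of "Suc i"] that by simp
      thus ?B using A[rule_format, of 0] False by (simp add: hd_conv_nth)
    next
      assume B: ?B
      show ?A
      proof (intro allI impI)
        fix i assume "Suc i < length (e # l)"
        thus "snd ((e # l) ! i) = fst ((e # l) ! Suc i)"
          using B False by (cases i) (simp_all add: hd_conv_nth)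
      qed
    qed
    thus ?thesis using Cons.IH[OF False, of "snd e"] False by auto
  qed auto
qed simp

lemma is_loop_iff_walk: "is_loop l \<longleftrightarrow> (\<exists>v. walk v l v)"
proof (cases "l = []")
  case True
  thus ?thesis by (auto simp: is_loop_def)
next
  case False
  have "(\<forall>i<length l. snd (l ! i) = fst (l ! (Suc i mod length l))) \<longleftrightarrow>
      snd (last l) = fst (hd l) \<and> (\<forall>i. Suc i < length l \<longrightarrow> snd (l ! i) = fst (l ! Suc i))"
    (is "?A \<longleftrightarrow> ?B")
  proof
    assume A: ?A
    have "snd (l ! i) = fst (l ! Suc i)" if "Suc i < length l" for i
      using A[rule_format, of i] that by simp
    moreover have "snd (last l) = fst (hd l)"
      using A[rule_format, of "length l - 1"] False by (simp add: last_conv_nth hd_conv_nth)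
    ultimately show ?B by blast
  next
    assume B: ?B
    show ?A
    proof (intro allI impI)
      fix i assume i: "i < length l"
      show "snd (l ! i) = fst (l ! (Suc i mod length l))"
      proof (cases "Suc i = length l")
        case True
        hence "i = length l - 1" by simp
        thus ?thesis using B False by (simp add: last_conv_nth hd_conv_nth)
      qed (use B i in simp)
    qed
  qed
  thus ?thesis unfolding is_loop_def using walk_iff[OF False] by metis
qed

lemma walk_loop: "walk v l v \<Longrightarrow> is_loop l"
  by (auto simp: is_loop_iff_walk)

lemma is_loop_append_commute: "is_loop (a @ b) \<longleftrightarrow> is_loop (b @ a)"
  unfolding is_loop_iff_walk walk_append by blast

lemma lattice_edge_cases:
  assumes "e \<in> lattice_edges"
  obtains x y where "e = ((x, y), (x, y + 1))"
  | x y where "e = ((x, y), (x + 1, y))"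
  | x y where "e = ((x, y + 1), (x, y))"
  | x y where "e = ((x + 1, y), (x, y))"
proof -
  obtain x y x' y' where e: "e = ((x, y), (x', y'))" by (metis prod.exhaust)
  have "\<bar>x - x'\<bar> + \<bar>y - y'\<bar> = 1" using assms by (simp add: lattice_edges_def e)
  hence "x' = x \<and> y' = y + 1 \<or> x' = x + 1 \<and> y' = y \<or> x' = x \<and> y = y' + 1 \<or> x = x' + 1 \<and> y' = y"
  proof (cases "x = x'")
    case True
    hence "\<bar>y - y'\<bar> = 1" using \<open>\<bar>x - x'\<bar> + \<bar>y - y'\<bar> = 1\<close> by simp
    thus ?thesis using True by (auto simp: abs_if split: if_splits)
  next
    case False
    hence "\<bar>x - x'\<bar> \<ge> 1" by simp
    hence "\<bar>y - y'\<bar> = 0" "\<bar>x - x'\<bar> = 1" using \<open>\<bar>x - x'\<bar> + \<bar>y - y'\<bar> = 1\<close> by simp_all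
    thus ?thesis by (auto simp: abs_if split: if_splits)
  qed
  thus ?thesis
  proof (elim disjE conjE)
    assume "x' = x" "y' = y + 1" thus ?thesis using that(1)[of x y] by (simp add: e)
  next
    assume "x' = x + 1" "y' = y" thus ?thesis using that(2)[of x y] by (simp add: e)
  next
    assume "x' = x" "y = y' + 1" thus ?thesis using that(3)[of x y'] by (simp add: e)
  next
    assume "x = x' + 1" "y' = y" thus ?thesis using that(4)[of x' y] by (simp add: e)
  qed
qed

lemma edge_inv_lattice [simp]: "edge_inv e \<in> lattice_edges \<longleftrightarrow> e \<in> lattice_edges"
  by (cases e) (auto simp: lattice_edges_def abs_minus_commute)

lemma edge_inv_neq: "e \<in> lattice_edges \<Longrightarrow> edge_inv e \<noteq> e"
  by (erule lattice_edge_cases) simp_all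

text \<open>The square to the right (\<open>b = True\<close>) or to the left of an edge; its centre lies half a unit
  to that side of the midpoint of the edge. Thus \<open>e\<close> is an edge of the plaquette \<open>(side e b, b)\<close>.\<close>
definition side :: "oedge \<Rightarrow> bool \<Rightarrow> vertex" where
  "side e b = (case e of ((x, y), (x', y')) \<Rightarrow> let s = (if b then 1 else - 1) in
     ((x + x' + s * (y' - y) - 1) div 2, (y + y' - s * (x' - x) - 1) div 2))"

lemma side_simps:
  "side ((x, y), (x, y + 1)) b = (if b then (x, y) else (x - 1, y))"
  "side ((x, y), (x + 1, y)) b = (if b then (x, y - 1) else (x, y))"
  "side ((x, y + 1), (x, y)) b = (if b then (x - 1, y) else (x, y))"
  "side ((x + 1, y), (x, y)) b = (if b then (x, y) else (x, y - 1))"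
  by (auto simp: side_def)

lemma side_edge_inv [simp]: "side (edge_inv e) b = side e (\<not> b)"
  by (cases e) (auto simp: side_def algebra_simps)

lemma plaq_path_simps:
  "plaq_path ((x, y), True) =
     [((x, y), (x, y + 1)), ((x, y + 1), (x + 1, y + 1)),
      ((x + 1, y + 1), (x + 1, y)), ((x + 1, y), (x, y))]"
  "plaq_path ((x, y), False) =
     [((x, y), (x + 1, y)), ((x + 1, y), (x + 1, y + 1)),
      ((x + 1, y + 1), (x, y + 1)), ((x, y + 1), (x, y))]"
  by (simp_all add: plaq_path_def)

lemma plaq_path_lattice: "set (plaq_path p) \<subseteq> lattice_edges"
proof -
  obtain x y b where "p = ((x, y), b)" by (metis prod.exhaust)
  thus ?thesis by (cases b) (auto simp: plaq_path_simps lattice_edges_def)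
qed

lemma in_plaq_path_iff:
  "e \<in> set (plaq_path (s, b)) \<longleftrightarrow> e \<in> lattice_edges \<and> side e b = s"
proof
  obtain x y where s: "s = (x, y)" by (cases s)
  assume e: "e \<in> set (plaq_path (s, b))"
  hence "e \<in> lattice_edges" using plaq_path_lattice by blast
  moreover have "side e b = s"
    using e by (cases b) (auto simp: s plaq_path_simps side_def)
  ultimately show "e \<in> lattice_edges \<and> side e b = s" by blast
next
  assume "e \<in> lattice_edges \<and> side e b = s"
  thus "e \<in> set (plaq_path (s, b))"
    by (elim conjE lattice_edge_cases) (auto simp: side_simps plaq_path_simps split: if_splits)
qed

lemma square_path_eq: "square_path s = plaq_path (s, True)"
  by (simp add: plaq_path_def)

lemma plaquettes_at_eq:
  assumes "e \<in> lattice_edges"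
  shows "plaquettes_at e = {(side e b, b), (side e (\<not> b), \<not> b)}"
proof (rule set_eqI)
  fix p :: plaquette
  obtain s b' where p: "p = (s, b')" by (cases p)
  have "p \<in> plaquettes_at e \<longleftrightarrow> s = side e b'"
    using assms by (auto simp: plaquettes_at_def p in_plaq_path_iff)
  thus "p \<in> plaquettes_at e \<longleftrightarrow> p \<in> {(side e b, b), (side e (\<not> b), \<not> b)}"
    by (cases b; cases b') (simp_all add: p)
qed

lemma square_step_iff:
  "square_step l s t \<longleftrightarrow>
     (\<exists>e\<in>lattice_edges. side e True = t \<and> side e False = s \<and> e \<notin> set l \<and> edge_inv e \<notin> set l)"
  by (auto simp: square_step_def square_path_eq in_plaq_path_iff)

lemma square_stepI:
  assumes "e \<in> lattice_edges" "e \<notin> set l" "edge_inv e \<notin> set l"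
  shows "square_step l (side e b) (side e (\<not> b))"
proof (cases b)
  case True
  thus ?thesis unfolding square_step_iff using assms by (intro bexI[of _ "edge_inv e"]) auto
next
  case False
  thus ?thesis unfolding square_step_iff using assms by (intro bexI[of _ e]) auto
qed

lemma square_step_sym: "square_step l s t \<Longrightarrow> square_step l t s"
proof -
  assume "square_step l s t"
  then obtain e where "e \<in> lattice_edges" "side e True = t" "side e False = s"
    "e \<notin> set l" "edge_inv e \<notin> set l"
    unfolding square_step_iff by blast
  thus "square_step l t s"
    using square_stepI[of e l True] by simp
qed

definition plaq_from :: "vertex \<Rightarrow> plaquette \<Rightarrow> oedge list" where
  "plaq_from v p =
     dropWhile (\<lambda>f. fst f \<noteq> v) (plaq_path p) @ takeWhile (\<lambda>f. fst f \<noteq> v) (plaq_path p)"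

lemma plaquette_readings:
  assumes "e \<in> set (plaq_path p)"
  shows "plaq_from (fst e) p = e # plaq_rest e p"
    and "plaq_from (snd e) p = plaq_rest e p @ [e]"
    and "walk (snd e) (plaq_rest e p) (fst e)"
    and "set (plaq_rest e p) = set (plaq_path p) - {e}"
    and "distinct (plaq_rest e p)"
proof -
  have "plaq_from (fst e) p = e # plaq_rest e p \<and>
     plaq_from (snd e) p = plaq_rest e p @ [e] \<and>
     walk (snd e) (plaq_rest e p) (fst e) \<and>
     set (plaq_rest e p) = set (plaq_path p) - {e} \<and>
     distinct (plaq_rest e p)"
  proof -
    obtain s b where "p = (s, b)" by (cases p)
    moreover obtain x y where "s = (x, y)" by (cases s)
    ultimately have p: "p = ((x, y), b)" by simp
    show ?thesis
    proof (cases b)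
      case True
      hence p: "p = ((x, y), True)" using p by simp
      from assms consider "e = ((x, y), (x, y + 1))" | "e = ((x, y + 1), (x + 1, y + 1))"
        | "e = ((x + 1, y + 1), (x + 1, y))" | "e = ((x + 1, y), (x, y))"
        unfolding p plaq_path_simps by auto
      thus ?thesis
        by cases (simp_all only: p, (auto simp: plaq_path_simps plaq_from_def plaq_rest_def lattice_edges_def)[4])
    next
      case False
      hence p: "p = ((x, y), False)" using p by simp
      from assms consider "e = ((x, y), (x + 1, y))" | "e = ((x + 1, y), (x + 1, y + 1))"
        | "e = ((x + 1, y + 1), (x, y + 1))" | "e = ((x, y + 1), (x, y))"
        unfolding p plaq_path_simps by auto
      thus ?thesis
        by cases (simp_all only: p, (auto simp: plaq_path_simps plaq_from_def plaq_rest_def lattice_edges_def)[4])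
    qed
  qed
  thus "plaq_from (fst e) p = e # plaq_rest e p"
    and "plaq_from (snd e) p = plaq_rest e p @ [e]"
    and "walk (snd e) (plaq_rest e p) (fst e)"
    and "set (plaq_rest e p) = set (plaq_path p) - {e}"
    and "distinct (plaq_rest e p)"
    by blast+
qed

lemma plaq_rest_edge_inv:
  assumes "e \<in> set (plaq_path (s, b))"
  shows "plaq_rest (edge_inv e) (s, \<not> b) = map edge_inv (rev (plaq_rest e (s, b)))"
proof -
  obtain x y where s: "s = (x, y)" by (cases s)
  show ?thesis
  proof (cases b)
    case True
    from assms consider "e = ((x, y), (x, y + 1))" | "e = ((x, y + 1), (x + 1, y + 1))"
      | "e = ((x + 1, y + 1), (x + 1, y))" | "e = ((x + 1, y), (x, y))"
      by (simp only: s True plaq_path_simps) auto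
    thus ?thesis
      by cases (simp_all only: s True simp_thms, simp_all add: plaq_path_simps plaq_rest_def)
  next
    case False
    from assms consider "e = ((x, y), (x + 1, y))" | "e = ((x + 1, y), (x + 1, y + 1))"
      | "e = ((x + 1, y + 1), (x, y + 1))" | "e = ((x, y + 1), (x, y))"
      by (simp only: s False plaq_path_simps) auto
    thus ?thesis
      by cases (simp_all only: s False simp_thms, simp_all add: plaq_path_simps plaq_rest_def)
  qed
qed

lemma in_plaq_path_edge_inv:
  "e \<in> set (plaq_path (s, b)) \<longleftrightarrow> edge_inv e \<in> set (plaq_path (s, \<not> b))"
  by (simp add: in_plaq_path_iff)

section \<open>Erasing backtracks\<close>

lemma sum_pair_guarded:
  assumes "A \<noteq> B"
  shows "(\<Sum>p | p \<in> {A, B} \<and> Q p. f p) = (if Q A then f A else 0) + (if Q B then f B else (0::real))"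
proof -
  have "{p. p \<in> {A, B} \<and> Q p} = (if Q A then {A} else {}) \<union> (if Q B then {B} else {})" by auto
  thus ?thesis using assms by auto
qed

text \<open>Only backtracks inside the list are erased. This keeps the base point of a walk, so that
  erasures can be performed inside a longer loop.\<close>
inductive cancels :: "oedge list \<Rightarrow> oedge list \<Rightarrow> bool" where
  none: "cancels l l"
| erase: "cancels (a @ b) l \<Longrightarrow> cancels (a @ e # edge_inv e # b) l"

lemma cancels_trans: "cancels l l' \<Longrightarrow> cancels l' l'' \<Longrightarrow> cancels l l''"
  by (induction rule: cancels.induct) (auto intro: cancels.intros)

lemma cancels_context: "cancels l l' \<Longrightarrow> cancels (a @ l @ b) (a @ l' @ b)"
proof (induction rule: cancels.induct)
  case (erase x y l e)
  thus ?case using cancels.erase[of "a @ x" "y @ b"] by simp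
qed (rule cancels.none)

lemma cancels_append: "cancels k k' \<Longrightarrow> cancels l l' \<Longrightarrow> cancels (k @ l) (k' @ l')"
  using cancels_context[of k k' "[]" l] cancels_context[of l l' k' "[]"]
  by (auto intro: cancels_trans)

lemma cancels_concat_replicate: "cancels l l' \<Longrightarrow> cancels (concat (replicate n l)) (concat (replicate n l'))"
  by (induction n) (auto intro: cancels_append cancels.none)

lemma cancels_inverse: "cancels (l @ map edge_inv (rev l)) []"
proof (induction l rule: rev_induct)
  case (snoc e l)
  thus ?case using cancels.erase[of l "map edge_inv (rev l)" "[]" e] by simp
qed (simp add: cancels.none)

lemma cancels_inverse': "cancels (map edge_inv (rev l) @ l) []"
  using cancels_inverse[of "map edge_inv (rev l)"] by (simp add: rev_map comp_def)

locale surface_sum =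
  fixes c :: "oedge list \<Rightarrow> assignment \<Rightarrow> real"
  assumes coefficients: "surface_coefficients c"
begin

lemma empty_loop: "finitary K \<Longrightarrow> c [] K = (if K = (\<lambda>_. 0) then 1 else 0)"
  using coefficients by (simp add: surface_coefficients_def)

lemma rotate_loop:
  assumes "finitary K" "is_loop (a @ b)"
  shows "c (a @ b) K = c (b @ a) K"
  using assms(2)
proof (induction a arbitrary: b)
  case (Cons e a)
  have "c ((e # a) @ b) K = c (rotate1 ((e # a) @ b)) K"
    using coefficients assms(1) Cons.prems unfolding surface_coefficients_def by metis
  also have "\<dots> = c (a @ (b @ [e])) K" by simp
  also have "\<dots> = c ((b @ [e]) @ a) K"
    using Cons.prems is_loop_append_commute[of "[e]" "a @ b"] by (intro Cons.IH) simp
  finally show ?case by simp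
qed simp

text \<open>A deformation term of the master loop equation: \<open>l\<close> has been deformed by the plaquette \<open>p\<close>,
  which is used up.\<close>
definition attach :: "assignment \<Rightarrow> plaquette \<Rightarrow> oedge list \<Rightarrow> real" where
  "attach K p l = (if K p \<ge> 1 then c l (assignment_remove K p) else 0)"

lemma attach_cong:
  assumes "finitary K"
    and "\<And>K'. finitary K' \<Longrightarrow> assignment_area K' < assignment_area K \<Longrightarrow> c l K' = c l' K'"
  shows "attach K p l = attach K p l'"
  using assignment_remove_finitary[OF assms(1)] assignment_remove_area[OF assms(1)] assms(2)
  by (simp add: attach_def)

lemma master_loop_equation:
  assumes K: "finitary K" and loop: "is_loop (e # l)"
  shows "c (e # l) K =
     split_sum (\<lambda>x. x = edge_inv e) (\<lambda>a b. convolution (c b) (c a) K) [] l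
   - split_sum (\<lambda>x. x = e) (\<lambda>a b. convolution (c (e # b)) (c (a @ [e])) K) [] l
   + attach K (side e b, \<not> b) (plaq_rest (edge_inv e) (side e b, \<not> b) @ l)
   + attach K (side e (\<not> b), b) (plaq_rest (edge_inv e) (side e (\<not> b), b) @ l)
   - attach K (side e b, b) (e # plaq_rest e (side e b, b) @ e # l)
   - attach K (side e (\<not> b), \<not> b) (e # plaq_rest e (side e (\<not> b), \<not> b) @ e # l)"
proof -
  have e: "e \<in> lattice_edges" using loop by (simp add: is_loop_def)
  have "c (e # l) K = master_rhs c e l K"
    using coefficients K loop unfolding surface_coefficients_def by blast
  moreover have "(\<Sum>(l1, l2)\<in>#negative_splittings e l.
      \<Sum>(K1, K2) | (\<forall>p. K1 p + K2 p = K p). c l1 K1 * c l2 K2)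
    = split_sum (\<lambda>x. x = edge_inv e) (\<lambda>a b. convolution (c b) (c a) K) [] l"
    by (simp add: negative_splittings_def split_sum_index convolution_def
        image_mset.compositionality comp_def sum_unfold_sum_mset)
  moreover have "(\<Sum>(l1, l2)\<in>#positive_splittings e l.
      \<Sum>(K1, K2) | (\<forall>p. K1 p + K2 p = K p). c l1 K1 * c l2 K2)
    = split_sum (\<lambda>x. x = e) (\<lambda>a b. convolution (c (e # b)) (c (a @ [e])) K) [] l"
    by (simp add: positive_splittings_def split_sum_index convolution_def
        image_mset.compositionality comp_def sum_unfold_sum_mset)
  moreover have "(\<Sum>p | p \<in> plaquettes_at (edge_inv e) \<and> K p \<ge> 1.
        c (negative_deformation e l p) (assignment_remove K p))
    = attach K (side e b, \<not> b) (plaq_rest (edge_inv e) (side e b, \<not> b) @ l)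
   + attach K (side e (\<not> b), b) (plaq_rest (edge_inv e) (side e (\<not> b), b) @ l)"
    using e by (simp only: plaquettes_at_eq[of "edge_inv e" "\<not> b"] edge_inv_lattice side_edge_inv not_not)
      (subst sum_pair_guarded, auto simp: attach_def negative_deformation_def)
  moreover have "(\<Sum>q | q \<in> plaquettes_at e \<and> K q \<ge> 1.
        c (positive_deformation e l q) (assignment_remove K q))
    = attach K (side e b, b) (e # plaq_rest e (side e b, b) @ e # l)
    + attach K (side e (\<not> b), \<not> b) (e # plaq_rest e (side e (\<not> b), \<not> b) @ e # l)"
    using e by (simp only: plaquettes_at_eq[of e b])
      (subst sum_pair_guarded, auto simp: attach_def positive_deformation_def)
  ultimately show ?thesis unfolding master_rhs_def by simp
qed

lemma plaq_rest_walk: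
  assumes "e \<in> lattice_edges"
  shows "walk (snd e) (plaq_rest e (side e b, b)) (fst e)"
    and "walk (fst e) (plaq_rest (edge_inv e) (side e b, \<not> b)) (snd e)"
proof -
  have "e \<in> set (plaq_path (side e b, b))" "edge_inv e \<in> set (plaq_path (side e b, \<not> b))"
    using assms by (simp_all add: in_plaq_path_iff)
  from this[THEN plaquette_readings(3)] show "walk (snd e) (plaq_rest e (side e b, b)) (fst e)"
    and "walk (fst e) (plaq_rest (edge_inv e) (side e b, \<not> b)) (snd e)" by simp_all
qed

text \<open>In the master loop equation at \<open>e\<close>, the splitting at the adjacent \<open>edge_inv e\<close> contributes
  \<open>c l K\<close>. All other terms change sign when the equation at \<open>edge_inv e\<close> is taken instead: by the
  induction hypothesis the positive splittings and positive deformations at one edge equal, up to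
  rotation and backtracks, the negative ones at the other. Hence the sum of the two equations is
  \<open>2 * c (e # edge_inv e # l) K = 2 * c l K\<close>.\<close>
lemma spur_erasure:
  assumes "finitary K" "e \<in> lattice_edges" "walk (fst e) l (fst e)"
  shows "c (e # edge_inv e # l) K = c l K"
  using assms
proof (induction "(assignment_area K, length l)" arbitrary: K l e
    rule: wf_induct_rule[OF wf_lex_prod[OF wf_less_than wf_less_than]])
  case (1 K l e)
  note K = \<open>finitary K\<close> and e = \<open>e \<in> lattice_edges\<close> and l = \<open>walk (fst e) l (fst e)\<close>
  let ?e' = "edge_inv e"
  have IH_len: "c (e # ?e' # l') K' = c l' K'"
    if "assignment_area K' \<le> assignment_area K" "length l' < length l" "finitary K'"
      "walk (fst e) l' (fst e)" for K' l'
    using 1(1)[of K' l' e] that e by (auto simp: le_less)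
  have IH_area: "c (e # ?e' # l') K' = c l' K'"
    if "assignment_area K' < assignment_area K" "finitary K'"
      "walk (fst e) l' (fst e)" for K' l'
    using 1(1)[of K' l' e] that e by auto
  have ne: "?e' \<noteq> e" using e by (rule edge_inv_neq)
  have e': "?e' \<in> lattice_edges" using e by simp
  note pw = plaq_rest_walk[OF e] plaq_rest_walk[OF e, of False] plaq_rest_walk[OF e, of True]
  have loop1: "is_loop (e # ?e' # l)"
    by (rule walk_loop[of "fst e"]) (use e l in simp)
  have loop2: "is_loop (?e' # l @ [e])"
    using is_loop_append_commute[of "[e]" "?e' # l"] loop1 by simp
  define N where "N = split_sum (\<lambda>x. x = ?e') (\<lambda>a b. convolution (c b) (c (?e' # a)) K) [] l"
  define P where "P = split_sum (\<lambda>x. x = e) (\<lambda>a b. convolution (c (e # b)) (c a) K) [] l"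
  have parts: "walk (fst e) a (fst x)" "walk (snd x) b (fst e)" "length a < length l" "length b < length l"
    if "l = a @ x # b" for a b x
    using l that by (auto simp: walk_append)
  have rot: "c (a @ [x]) K' = c (x # a) K'" if "finitary K'" "is_loop (x # a)" for a x K'
    using rotate_loop[of K' "[x]" a] that by simp
  have unit: "convolution f (c []) K = f K" for f
    by (rule convolution_unit[OF K empty_loop])
  \<comment> \<open>Splitting the spur at its own turning point detaches the null-loop and leaves \<open>l\<close>.\<close>
  have N1: "split_sum (\<lambda>x. x = ?e') (\<lambda>a b. convolution (c b) (c a) K) [] (?e' # l) = c l K + N"
    unfolding N_def by (simp add: unit, rule split_sum_cong) simp
  have P1: "split_sum (\<lambda>x. x = e) (\<lambda>a b. convolution (c (e # b)) (c (a @ [e])) K) [] (?e' # l) = P"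
  proof -
    have "split_sum (\<lambda>x. x = e) (\<lambda>a b. convolution (c (e # b)) (c (a @ [e])) K) [?e'] l = P"
      unfolding P_def
    proof (rule split_sum_cong)
      fix a x b assume s: "l = a @ x # b" and x: "x = e"
      have "c (?e' # a @ [e]) K' = c a K'" if "finitary K'" "assignment_area K' \<le> assignment_area K" for K'
      proof -
        have "is_loop (e # ?e' # a)"
          by (rule walk_loop[of "fst e"]) (use parts(1)[OF s] x e in simp)
        hence "c (?e' # a @ [e]) K' = c (e # ?e' # a) K'" using rot[of K' e "?e' # a"] that by simp
        also have "\<dots> = c a K'" using IH_len[of K' a] that parts[OF s] x by simp
        finally show ?thesis .
      qed
      thus "convolution (c (e # b)) (c (([?e'] @ a) @ [e])) K = convolution (c (e # b)) (c ([] @ a)) K"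
        by (intro convolution_cong[OF K]) simp_all
    qed
    thus ?thesis using ne by simp
  qed
  \<comment> \<open>The same loop read from \<open>edge_inv e\<close>: now the copies of \<open>e\<close> give the negative splittings, so
    that \<open>N\<close> and \<open>P\<close> change places.\<close>
  have N2: "split_sum (\<lambda>x. x = e) (\<lambda>a b. convolution (c b) (c a) K) [] (l @ [e]) = P + c l K"
  proof -
    have "split_sum (\<lambda>x. x = e) (\<lambda>a b. convolution (c (b @ [e])) (c a) K) [] l = P"
      unfolding P_def
    proof (rule split_sum_cong)
      fix a x b assume s: "l = a @ x # b" and x: "x = e"
      have "is_loop (e # b)"
        by (rule walk_loop[of "fst e"]) (use parts(2)[OF s] x e in simp)
      thus "convolution (c (b @ [e])) (c ([] @ a)) K = convolution (c (e # b)) (c ([] @ a)) K"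
        by (intro convolution_cong[OF K] rot) simp_all
    qed
    thus ?thesis
      by (simp add: split_sum_append convolution_commute[of "c []"] unit)
  qed
  have P2: "split_sum (\<lambda>x. x = ?e') (\<lambda>a b. convolution (c (?e' # b)) (c (a @ [?e'])) K) [] (l @ [e]) = N"
  proof -
    have "split_sum (\<lambda>x. x = ?e') (\<lambda>a b. convolution (c (?e' # b @ [e])) (c (a @ [?e'])) K) [] l = N"
      unfolding N_def
    proof (rule split_sum_cong)
      fix a x b assume s: "l = a @ x # b" and x: "x = ?e'"
      have 1: "c (?e' # b @ [e]) K' = c b K'" if "finitary K'" "assignment_area K' \<le> assignment_area K" for K'
      proof -
        have "is_loop (e # ?e' # b)"
          by (rule walk_loop[of "fst e"]) (use parts(2)[OF s] x e in simp)
        hence "c (?e' # b @ [e]) K' = c (e # ?e' # b) K'" using rot[of K' e "?e' # b"] that by simp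
        also have "\<dots> = c b K'" using IH_len[of K' b] that parts[OF s] x by simp
        finally show ?thesis .
      qed
      have "is_loop (?e' # a)"
        by (rule walk_loop[of "snd e"]) (use parts(1)[OF s] x e in simp)
      hence 2: "c (a @ [?e']) K' = c (?e' # a) K'" if "finitary K'" for K'
        using rot[of K' ?e' a] that by simp
      show "convolution (c (?e' # b @ [e])) (c (([] @ a) @ [?e'])) K = convolution (c b) (c (?e' # [] @ a)) K"
        by (rule convolution_cong[OF K]) (use 1 2 in simp_all)
    qed
    thus ?thesis using ne by (simp add: split_sum_append)
  qed
  have A: "attach K p (e # plaq_rest e p @ e # ?e' # l) = attach K p (plaq_rest e p @ l @ [e])"
    if "p = (side e b, b)" for p b
  proof (rule attach_cong[OF K])
    fix K' assume K': "finitary K'" "assignment_area K' < assignment_area K"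
    have w: "walk (fst e) (e # plaq_rest e p) (fst e)" using pw(1) e by (simp add: that)
    have "is_loop ((e # plaq_rest e p) @ e # ?e' # l)"
      by (rule walk_loop[of "fst e"]) (use w l e in \<open>auto simp: walk_append\<close>)
    hence "c (e # plaq_rest e p @ e # ?e' # l) K' = c (e # ?e' # l @ e # plaq_rest e p) K'"
      using rotate_loop[OF K'(1), of "e # plaq_rest e p" "e # ?e' # l"] by simp
    also have "\<dots> = c (l @ e # plaq_rest e p) K'"
      using w l by (intro IH_area[OF K'(2,1)]) (auto simp: walk_append)
    also have "\<dots> = c (plaq_rest e p @ l @ [e]) K'"
    proof -
      have "is_loop ((l @ [e]) @ plaq_rest e p)"
        by (rule walk_loop[of "fst e"]) (use w l e in \<open>auto simp: walk_append\<close>)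
      thus ?thesis using rotate_loop[OF K'(1), of "l @ [e]" "plaq_rest e p"] by simp
    qed
    finally show "c (e # plaq_rest e p @ e # ?e' # l) K' = c (plaq_rest e p @ l @ [e]) K'" .
  qed
  have B: "attach K p (?e' # plaq_rest ?e' p @ ?e' # l @ [e]) = attach K p (plaq_rest ?e' p @ ?e' # l)"
    if "p = (side e b, \<not> b)" for p b
  proof (rule attach_cong[OF K])
    fix K' assume K': "finitary K'" "assignment_area K' < assignment_area K"
    have w: "walk (fst e) (plaq_rest ?e' p) (snd e)" using pw(2) e by (simp add: that)
    have "is_loop ((?e' # plaq_rest ?e' p @ ?e' # l) @ [e])"
      by (rule walk_loop[of "snd e"]) (use w l e in \<open>auto simp: walk_append\<close>)
    hence "c (?e' # plaq_rest ?e' p @ ?e' # l @ [e]) K' = c (e # ?e' # plaq_rest ?e' p @ ?e' # l) K'"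
      using rotate_loop[OF K'(1), of "?e' # plaq_rest ?e' p @ ?e' # l" "[e]"] by simp
    also have "\<dots> = c (plaq_rest ?e' p @ ?e' # l) K'"
      using w l e by (intro IH_area[OF K'(2,1)]) (auto simp: walk_append)
    finally show "c (?e' # plaq_rest ?e' p @ ?e' # l @ [e]) K' = c (plaq_rest ?e' p @ ?e' # l) K'" .
  qed
  have "c (e # ?e' # l) K = c (?e' # l @ [e]) K"
    using rotate_loop[OF K, of "[e]" "?e' # l"] loop1 by simp
  moreover note master_loop_equation[OF K loop1, of True] master_loop_equation[OF K loop2, of True]
  moreover note A[OF refl, of True] A[OF refl, of False] B[OF refl, of True] B[OF refl, of False]
  ultimately show ?case
    unfolding N1 P1 side_edge_inv swap_swap N2 P2 by simp
qed

lemma spur_erasure_inside: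
  assumes "finitary K" "is_loop (a @ e # edge_inv e # b)"
  shows "c (a @ e # edge_inv e # b) K = c (a @ b) K"
proof -
  have loop: "is_loop (e # edge_inv e # b @ a)"
    using is_loop_append_commute[of a "e # edge_inv e # b"] assms(2) by simp
  hence e: "e \<in> lattice_edges" and w: "walk (fst e) (b @ a) (fst e)"
    by (auto simp: is_loop_iff_walk)
  have "c (a @ e # edge_inv e # b) K = c (e # edge_inv e # b @ a) K"
    using rotate_loop[OF assms] by simp
  also have "\<dots> = c (b @ a) K" by (rule spur_erasure[OF assms(1) e w])
  also have "\<dots> = c (a @ b) K" by (rule rotate_loop[OF assms(1) walk_loop[OF w]])
  finally show ?thesis .
qed

lemma cancels_coefficient:
  assumes "cancels l l'" "finitary K" "is_loop l"
  shows "c l K = c l' K"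
  using assms
proof (induction rule: cancels.induct)
  case (erase a b l e)
  have "is_loop (a @ b)" using erase.prems(2) by (auto simp: is_loop_iff_walk walk_append)
  thus ?case using spur_erasure_inside[of K a e b] erase by simp
qed simp

end

section \<open>Moving a plaquette to infinity\<close>

text \<open>A path without repetitions is obtained by cutting out closed detours.\<close>
lemma rtranclp_distinct_path:
  assumes "r\<^sup>*\<^sup>* x y"
  shows "\<exists>xs. distinct (x # xs) \<and> successively r (x # xs) \<and> last (x # xs) = y"
  using assms
proof (induction rule: converse_rtranclp_induct)
  case base
  show ?case by (rule exI[of _ "[]"]) simp
next
  case (step x z)
  then obtain zs where zs: "distinct (z # zs)" "successively r (z # zs)" "last (z # zs) = y" by blast
  show ?case
  proof (cases "x \<in> set (z # zs)")
    case False
    thus ?thesis using zs step(1) by (intro exI[of _ "z # zs"]) auto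
  next
    case True
    then obtain a b where ab: "z # zs = a @ x # b" by (meson split_list)
    hence "distinct (x # b)" "successively r (x # b)" "last (x # b) = y"
      using zs by (auto simp: successively_append_iff dest: arg_cong[of _ _ last])
    thus ?thesis by blast
  qed
qed

lemma edge_inv_image_iff: "e \<in> edge_inv ` A \<longleftrightarrow> edge_inv e \<in> A"
proof
  assume "edge_inv e \<in> A"
  thus "e \<in> edge_inv ` A" by (rule image_eqI[rotated]) simp
qed auto

lemma plaq_path_next:
  assumes "e \<in> set (plaq_path p)"
  shows "snd e \<in> fst ` set (plaq_path p)"
proof -
  have "e \<in> lattice_edges" using assms plaq_path_lattice by blast
  hence "plaq_rest e p \<noteq> []"
    using plaquette_readings(3)[OF assms] by (auto simp: lattice_edges_def)
  then obtain f fs where f: "plaq_rest e p = f # fs" by (cases "plaq_rest e p") auto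
  have "fst f = snd e" "f \<in> set (plaq_path p)"
    using plaquette_readings(3,4)[OF assms] f by auto
  thus ?thesis by (intro image_eqI[of _ _ f]) simp_all
qed

context surface_sum
begin

text \<open>The contribution of the square \<open>s\<close> to a master loop equation when its plaquettes are inserted at
  the corner \<open>v\<close>: the two orientations enter with opposite signs.\<close>
definition defect :: "assignment \<Rightarrow> vertex \<Rightarrow> vertex \<Rightarrow> oedge list \<Rightarrow> real" where
  "defect K s v l = attach K (s, False) (plaq_from v (s, False) @ l)
                  - attach K (s, True) (plaq_from v (s, True) @ l)"

text \<open>Conjugating the loop with an edge of the square moves the base point along the boundary of
  the square; the backtracks that arise can be erased.\<close>
lemma defect_move:
  assumes K: "finitary K" and g: "g \<in> set (plaq_path (s, True))" and l: "walk (fst g) l (fst g)"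
  shows "defect K s (fst g) l = defect K s (snd g) (edge_inv g # l @ [g])"
proof -
  let ?g' = "edge_inv g"
  have gl: "g \<in> lattice_edges" using g by (simp add: in_plaq_path_iff)
  have g': "?g' \<in> set (plaq_path (s, False))" using g in_plaq_path_edge_inv[of g s True] by simp
  note r = plaquette_readings[OF g] and r' = plaquette_readings[OF g']
  let ?B = "plaq_rest g (s, True)" and ?B' = "plaq_rest ?g' (s, False)"
  have "attach K (s, True) (?B @ g # ?g' # l @ [g]) = attach K (s, True) (g # ?B @ l)"
  proof (rule attach_cong[OF K])
    fix K' assume K': "finitary K'"
    have 1: "is_loop (?B @ g # ?g' # l @ [g])"
      by (rule walk_loop[of "snd g"]) (use r(3) l gl in \<open>auto simp: walk_append\<close>)
    have 2: "is_loop ([g] @ ?B @ l)"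
      by (rule walk_loop[of "fst g"]) (use r(3) l gl in \<open>auto simp: walk_append\<close>)
    show "c (?B @ g # ?g' # l @ [g]) K' = c (g # ?B @ l) K'"
      using spur_erasure_inside[OF K' 1] rotate_loop[OF K' 2] by simp
  qed
  moreover have "attach K (s, False) (?g' # ?B' @ ?g' # l @ [g]) = attach K (s, False) (?B' @ ?g' # l)"
  proof (rule attach_cong[OF K])
    fix K' assume K': "finitary K'"
    have w: "walk (fst g) (?B' @ ?g' # l) (fst g)"
      using r'(3) l gl by (auto simp: walk_append)
    have 1: "is_loop ((?g' # ?B' @ ?g' # l) @ [g])"
      by (rule walk_loop[of "snd g"]) (use r'(3) l gl in \<open>auto simp: walk_append\<close>)
    show "c (?g' # ?B' @ ?g' # l @ [g]) K' = c (?B' @ ?g' # l) K'"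
      using rotate_loop[OF K' 1] spur_erasure[OF K' gl w] by simp
  qed
  moreover have "plaq_from (fst g) (s, False) = ?B' @ [?g']" "plaq_from (snd g) (s, False) = ?g' # ?B'"
    using r'(1,2) by simp_all
  ultimately show ?thesis using r(1,2) by (simp add: defect_def)
qed

text \<open>The master loop equation at the first edge of \<open>e # edge_inv e # l\<close>, combined with the
  erasure of this backtrack. Since \<open>l\<close> avoids the edge, there is no other splitting, and the four
  deformation terms have to cancel.\<close>
lemma defect_cross:
  assumes K: "finitary K" and e: "e \<in> lattice_edges" and l: "walk (fst e) l (fst e)"
    and "e \<notin> set l" "edge_inv e \<notin> set l"
  shows "defect K (side e True) (fst e) l = defect K (side e False) (fst e) l"
proof -
  let ?e' = "edge_inv e"
  have loop: "is_loop (e # ?e' # l)"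
    by (rule walk_loop[of "fst e"]) (use e l in simp)
  have A: "attach K p (e # plaq_rest e p @ e # ?e' # l) = attach K p (plaq_from (fst e) p @ l)"
    if "p = (side e b, b)" for p b
  proof -
    have ep: "e \<in> set (plaq_path p)" using e by (simp add: that in_plaq_path_iff)
    have 1: "is_loop ((e # plaq_rest e p) @ e # ?e' # l)"
      by (rule walk_loop[of "fst e"]) (use plaquette_readings(3)[OF ep] l e in \<open>auto simp: walk_append\<close>)
    show ?thesis
      by (rule attach_cong[OF K])
        (use spur_erasure_inside[OF _ 1] plaquette_readings(1)[OF ep] in simp)
  qed
  have B: "plaq_rest ?e' p @ ?e' # l = plaq_from (fst e) p @ l"
    if "p = (side e b, \<not> b)" for p b
  proof -
    have "?e' \<in> set (plaq_path p)" using e by (simp add: that in_plaq_path_iff)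
    from plaquette_readings(2)[OF this] show ?thesis by simp
  qed
  have N: "split_sum (\<lambda>x. x = ?e') (\<lambda>a b. convolution (c b) (c a) K) [] (?e' # l) = c l K"
  proof -
    have "split_sum (\<lambda>x. x = ?e') (\<lambda>a b. convolution (c b) (c a) K) [?e'] l = 0"
      by (rule split_sum_none) (use assms(5) in blast)
    thus ?thesis by (simp add: convolution_unit[OF K empty_loop])
  qed
  have P: "split_sum (\<lambda>x. x = e) (\<lambda>a b. convolution (c (e # b)) (c (a @ [e])) K) [] (?e' # l) = 0"
    by (rule split_sum_none) (use assms(4) edge_inv_neq[OF e] in \<open>metis set_ConsD\<close>)
  have B1: "plaq_rest ?e' (side e True, False) @ ?e' # l = plaq_from (fst e) (side e True, False) @ l"
    by (rule B[of _ True]) simp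
  have B2: "plaq_rest ?e' (side e False, True) @ ?e' # l = plaq_from (fst e) (side e False, True) @ l"
    by (rule B[of _ False]) simp
  show ?thesis
    using master_loop_equation[OF K loop, of True] spur_erasure[OF K e l]
    unfolding N P not_True_eq_False A[OF refl] B1 B2
    by (simp add: defect_def)
qed

text \<open>Walking with the base point along an initial part of the boundary of the square adds only
  edges of that part to the loop.\<close>
lemma defect_slide:
  assumes K: "finitary K"
  shows "plaq_from v (s, True) = t @ r \<Longrightarrow> r \<noteq> [] \<Longrightarrow> v \<in> fst ` set (plaq_path (s, True)) \<Longrightarrow>
    walk v l v \<Longrightarrow>
    \<exists>l'. walk (fst (hd r)) l' (fst (hd r)) \<and> defect K s v l = defect K s (fst (hd r)) l' \<and>
      set l' \<subseteq> set l \<union> set t \<union> edge_inv ` set t"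
proof (induction t arbitrary: v r l)
  case Nil
  from Nil.prems(3) obtain g where g: "g \<in> set (plaq_path (s, True))" "v = fst g" by blast
  hence "fst (hd r) = v" using plaquette_readings(1)[OF g(1)] Nil.prems(1) by (metis append_Nil list.sel(1))
  thus ?case using Nil.prems by auto
next
  case (Cons g t)
  from Cons.prems(3) obtain g0 where g0: "g0 \<in> set (plaq_path (s, True))" "v = fst g0" by blast
  note R = plaquette_readings[OF g0(1)]
  have g: "g = g0" and rest: "plaq_rest g (s, True) = t @ r"
    using R(1) Cons.prems(1) g0(2) by auto
  have gp: "g \<in> set (plaq_path (s, True))" and v: "v = fst g" using g g0 by simp_all
  have gl: "g \<in> lattice_edges" using gp by (simp add: in_plaq_path_iff)
  have 1: "plaq_from (snd g) (s, True) = t @ (r @ [g])"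
    using plaquette_readings(2)[OF gp] rest by simp
  obtain f fs where f: "t @ r = f # fs" using Cons.prems(2) by (cases "t @ r") auto
  have "fst f = snd g" using plaquette_readings(3)[OF gp] by (simp add: rest f)
  moreover have "f \<in> set (plaq_path (s, True))"
    using plaquette_readings(4)[OF gp] rest f by (metis Diff_iff list.set_intros(1))
  ultimately have 2: "snd g \<in> fst ` set (plaq_path (s, True))" by force
  have 3: "walk (snd g) (edge_inv g # l @ [g]) (snd g)"
    using Cons.prems(4) gl by (auto simp: v walk_append)
  obtain l' where l': "walk (fst (hd (r @ [g]))) l' (fst (hd (r @ [g])))"
    "defect K s (snd g) (edge_inv g # l @ [g]) = defect K s (fst (hd (r @ [g]))) l'"
    "set l' \<subseteq> set (edge_inv g # l @ [g]) \<union> set t \<union> edge_inv ` set t"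
    using Cons.IH[OF 1 _ 2 3] by auto
  have "hd (r @ [g]) = hd r" using Cons.prems(2) by simp
  moreover have "defect K s v l = defect K s (snd g) (edge_inv g # l @ [g])"
    unfolding v by (rule defect_move[OF K gp]) (use Cons.prems(4) v in simp)
  moreover have "set l' \<subseteq> set l \<union> set (g # t) \<union> edge_inv ` set (g # t)"
    using l'(3) by auto
  ultimately show ?case using l'(1,2) by (intro exI[of _ l'] conjI) simp_all
qed

lemma set_plaq_from: "set (plaq_from v p) = set (plaq_path p)"
proof -
  let ?Q = "\<lambda>f :: oedge. fst f \<noteq> v"
  have "set (takeWhile ?Q (plaq_path p)) \<union> set (dropWhile ?Q (plaq_path p)) = set (plaq_path p)"
    by (simp only: set_append[symmetric] takeWhile_dropWhile_id)
  thus ?thesis unfolding plaq_from_def by (simp only: set_append Un_commute)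
qed

text \<open>The defect is carried from square to square, up to one that the assignment does not contain.
  Before crossing the edge \<open>e\<close> from \<open>s\<close> to the next square, the base point is moved clockwise
  around \<open>s\<close> to the starting point of \<open>e\<close>. The edges picked up on the way belong to \<open>s\<close>, and since
  the path does not return to \<open>s\<close>, the later crossings avoid them.\<close>
lemma defect_along_path:
  assumes K: "finitary K"
  shows "successively (square_step l) (s # ss) \<Longrightarrow> distinct (s # ss) \<Longrightarrow>
    K (last (s # ss), True) = 0 \<Longrightarrow> K (last (s # ss), False) = 0 \<Longrightarrow>
    v \<in> fst ` set (plaq_path (s, True)) \<Longrightarrow> walk v l v \<Longrightarrow> defect K s v l = 0"
proof (induction ss arbitrary: s v l)
  case Nil
  thus ?case by (simp add: defect_def attach_def)
next
  case (Cons t ss)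
  have "square_step l t s" using Cons.prems(1) by (auto intro: square_step_sym)
  then obtain e where e: "e \<in> lattice_edges" "side e True = s" "side e False = t"
    "e \<notin> set l" "edge_inv e \<notin> set l"
    unfolding square_step_iff by blast
  have "e \<in> set (plaq_from v (s, True))" using e by (simp add: set_plaq_from in_plaq_path_iff)
  then obtain a b where ab: "plaq_from v (s, True) = a @ e # b" "e \<notin> set a"
    by (meson split_list_first)
  obtain l' where l': "walk (fst e) l' (fst e)" "defect K s v l = defect K s (fst e) l'"
    "set l' \<subseteq> set l \<union> set a \<union> edge_inv ` set a"
    using defect_slide[OF K ab(1) _ Cons.prems(5,6)] by auto
  have a: "side f True = s" "f \<in> lattice_edges" if "f \<in> set a" for f
  proof -
    have "f \<in> set (plaq_path (s, True))" using that ab(1) set_plaq_from[of v "(s, True)"] by auto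
    thus "side f True = s" "f \<in> lattice_edges" by (simp_all add: in_plaq_path_iff)
  qed
  have st: "s \<noteq> t" using Cons.prems(2) by simp
  have avoid: "f \<notin> set l'" if "f \<notin> set l" "side f True \<noteq> s \<or> f = e" "side f False \<noteq> s" for f
  proof
    assume "f \<in> set l'"
    hence "f \<in> set a \<or> edge_inv f \<in> set a"
      using subsetD[OF l'(3), of f] that(1) unfolding Un_iff edge_inv_image_iff by blast
    then consider "f \<in> set a" | "edge_inv f \<in> set a" by blast
    thus False using a[of f] a[of "edge_inv f"] that(2,3) ab(2) by cases auto
  qed
  have "e \<notin> set l'" using avoid[of e] e st by simp
  moreover have "edge_inv e \<notin> set l'"
  proof
    assume "edge_inv e \<in> set l'"
    hence "edge_inv e \<in> set a \<or> e \<in> set a"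
      using subsetD[OF l'(3), of "edge_inv e"] e(5)
      unfolding Un_iff edge_inv_image_iff swap_swap by blast
    then consider "edge_inv e \<in> set a" | "e \<in> set a" by blast
    thus False using a[of "edge_inv e"] ab(2) e st by cases auto
  qed
  ultimately have "defect K s v l = defect K t (fst e) l'"
    using defect_cross[OF K e(1) l'(1)] l'(2) e(2,3) by simp
  also have "\<dots> = 0"
  proof (rule Cons.IH)
    have "square_step l' u w" if uw: "square_step l u w" "u \<in> set (t # ss)" "w \<in> set (t # ss)" for u w
    proof -
      obtain f where f: "f \<in> lattice_edges" "side f True = w" "side f False = u"
        "f \<notin> set l" "edge_inv f \<notin> set l" using uw(1) unfolding square_step_iff by blast
      have "w \<noteq> s" "u \<noteq> s" using uw(2,3) Cons.prems(2) by auto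
      hence "f \<notin> set l'" "edge_inv f \<notin> set l'" using avoid[of f] avoid[of "edge_inv f"] f by simp_all
      thus ?thesis using f unfolding square_step_iff by blast
    qed
    moreover have "successively (square_step l) (t # ss)" using Cons.prems(1) by simp
    ultimately show "successively (square_step l') (t # ss)"
      using successively_mono by metis
    show "distinct (t # ss)" "K (last (t # ss), True) = 0" "K (last (t # ss), False) = 0"
      using Cons.prems(2-4) by simp_all
    show "walk (fst e) l' (fst e)" by (rule l'(1))
    have et: "edge_inv e \<in> set (plaq_path (t, True))" using e by (simp add: in_plaq_path_iff)
    from plaq_path_next[OF this] show "fst e \<in> fst ` set (plaq_path (t, True))" by simp
  qed
  finally show ?case .
qed

lemma defect_outside:
  assumes K: "finitary K" and "infinite {t. (square_step l)\<^sup>*\<^sup>* s t}"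
    and "v \<in> fst ` set (plaq_path (s, True))" "walk v l v"
  shows "defect K s v l = 0"
proof -
  have "finite (fst ` {p. K p \<noteq> 0})" using K by (simp add: finite_assignments_def)
  then obtain t where t: "(square_step l)\<^sup>*\<^sup>* s t" "t \<notin> fst ` {p. K p \<noteq> 0}"
    using assms(2) by (metis (no_types, lifting) finite_subset mem_Collect_eq subsetI)
  have z: "K (t, b) = 0" for b using t(2) by force
  obtain ss where "distinct (s # ss)" "successively (square_step l) (s # ss)" "last (s # ss) = t"
    using rtranclp_distinct_path[OF t(1)] by blast
  thus ?thesis using defect_along_path[OF K _ _ _ _ assms(3,4), of ss] z by simp
qed

end

section \<open>Winding numbers\<close>

text \<open>The signed crossing of the vertical ray from the centre of the square \<open>s\<close> upwards.\<close>
definition ray_sign :: "vertex \<Rightarrow> oedge \<Rightarrow> int" where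
  "ray_sign s e = (if snd (fst e) > snd s
     then of_bool (fst (fst e) = fst s \<and> fst (snd e) = fst s + 1)
        - of_bool (fst (fst e) = fst s + 1 \<and> fst (snd e) = fst s) else 0)"

definition winding :: "oedge list \<Rightarrow> vertex \<Rightarrow> int" where
  "winding l s = (\<Sum>e\<leftarrow>l. ray_sign s e)"

lemma walk_flux: "walk u l v \<Longrightarrow> (\<Sum>e\<leftarrow>l. f (snd e) - f (fst e)) = f v - (f u :: int)"
  by (induction l arbitrary: u) auto

lemma count_list_sum: "int (count_list l e) = (\<Sum>f\<leftarrow>l. of_bool (f = e))"
  by (induction l) auto

lemma sum_list_diff: "(\<Sum>x\<leftarrow>l. f x - g x) = (\<Sum>x\<leftarrow>l. f x) - (\<Sum>x\<leftarrow>l. g x :: int)"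
  by (induction l) auto

lemma ray_sign_simps:
  "ray_sign (x, y) ((a, b), (a, b + 1)) = 0"
  "ray_sign (x, y) ((a, b + 1), (a, b)) = 0"
  "ray_sign (x, y) ((a, b), (a + 1, b)) = (if b > y \<and> a = x then 1 else 0)"
  "ray_sign (x, y) ((a + 1, b), (a, b)) = (if b > y \<and> a = x then - 1 else 0)"
  by (simp_all add: ray_sign_def)

text \<open>Across a horizontal edge the two rays differ exactly in that edge. Across a vertical edge, the
  difference of the two rays is the flux of the loop through the half-line of vertices from the
  upper end of the edge upwards, except for the part that passes through the edge itself; the total
  flux of a closed walk is zero.\<close>
lemma winding_cross:
  assumes l: "walk v l v" and e: "e \<in> lattice_edges"
  shows "winding l (side e True) =
     winding l (side e False) + int (count_list l e) - int (count_list l (edge_inv e))"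
proof -
  have lat: "f \<in> lattice_edges" if "f \<in> set l" for f using walk_edges[OF l] that by blast
  have H: "winding l (side e True) =
     winding l (side e False) + int (count_list l e) - int (count_list l (edge_inv e))"
    if e: "e = ((x, y), (x + 1, y))" for e x y
  proof -
    have "ray_sign (x, y - 1) f - ray_sign (x, y) f = of_bool (f = e) - of_bool (f = edge_inv e)"
      if "f \<in> set l" for f
      using lat[OF that] by (rule lattice_edge_cases) (auto simp add: ray_sign_simps e)
    hence "(\<Sum>f\<leftarrow>l. ray_sign (x, y - 1) f - ray_sign (x, y) f)
        = (\<Sum>f\<leftarrow>l. of_bool (f = e) - of_bool (f = edge_inv e))"
      by (metis (mono_tags, lifting) map_cong)
    thus ?thesis unfolding sum_list_diff winding_def count_list_sum by (simp add: e side_simps)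
  qed
  have V: "winding l (side e True) =
     winding l (side e False) + int (count_list l e) - int (count_list l (edge_inv e))"
    if e: "e = ((x, y), (x, y + 1))" for e x y
  proof -
    define A :: "vertex \<Rightarrow> int" where "A = (\<lambda>u. of_bool (fst u = x \<and> snd u > y))"
    have "ray_sign (x, y) f - ray_sign (x - 1, y) f
        = (of_bool (f = e) - of_bool (f = edge_inv e)) - (A (snd f) - A (fst f))"
      if "f \<in> set l" for f
      using lat[OF that] by (rule lattice_edge_cases) (auto simp add: ray_sign_simps e A_def)
    hence "(\<Sum>f\<leftarrow>l. ray_sign (x, y) f - ray_sign (x - 1, y) f)
        = (\<Sum>f\<leftarrow>l. (of_bool (f = e) - of_bool (f = edge_inv e)) - (A (snd f) - A (fst f)))"
      by (metis (mono_tags, lifting) map_cong)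
    moreover have "(\<Sum>f\<leftarrow>l. A (snd f) - A (fst f)) = 0" using walk_flux[OF l, of A] by simp
    ultimately have "(\<Sum>f\<leftarrow>l. ray_sign (x, y) f) - (\<Sum>f\<leftarrow>l. ray_sign (x - 1, y) f)
        = (\<Sum>f\<leftarrow>l. of_bool (f = e)) - (\<Sum>f\<leftarrow>l. of_bool (f = edge_inv e))"
      unfolding sum_list_diff by simp
    moreover have "side e True = (x, y)" "side e False = (x - 1, y)" by (simp_all add: e side_simps)
    ultimately show ?thesis unfolding winding_def count_list_sum by simp
  qed
  from e show ?thesis
  proof (rule lattice_edge_cases)
    fix x y assume "e = ((x, y + 1), (x, y))"
    hence "edge_inv e = ((x, y), (x, y + 1))" by simp
    from V[OF this] show ?thesis by simp
  next
    fix x y assume "e = ((x + 1, y), (x, y))"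
    hence "edge_inv e = ((x, y), (x + 1, y))" by simp
    from H[OF this] show ?thesis by simp
  qed (rule H V, assumption)+
qed

text \<open>Below the loop a ray meets all edges of its column, so that the crossings add up to the flux
  through a vertical line, which is zero. On the other sides the ray misses the loop.\<close>
lemma winding_outside_box:
  assumes l: "walk v l v" and box: "\<And>e. e \<in> set l \<Longrightarrow> in_box R (fst e) \<and> in_box R (snd e)"
    and s: "\<not> in_box R s"
  shows "winding l s = 0"
proof (cases "snd s < - R")
  case True
  define A :: "vertex \<Rightarrow> int" where "A = (\<lambda>u. of_bool (fst u > fst s))"
  have "ray_sign s f = A (snd f) - A (fst f)" if "f \<in> set l" for f
  proof -
    have "f \<in> lattice_edges" using walk_edges[OF l] that by blast
    moreover have "snd (fst f) > snd s" using box[OF that] True unfolding in_box_def by linarith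
    ultimately show ?thesis
      by (elim lattice_edge_cases) (auto simp add: ray_sign_def A_def)
  qed
  hence "winding l s = (\<Sum>f\<leftarrow>l. A (snd f) - A (fst f))"
    unfolding winding_def by (metis (mono_tags, lifting) map_cong)
  thus ?thesis using walk_flux[OF l, of A] by simp
next
  case False
  have "ray_sign s f = 0" if "f \<in> set l" for f
    using box[OF that] s False by (auto simp: ray_sign_def in_box_def)
  hence "winding l s = (\<Sum>f\<leftarrow>l. 0)"
    unfolding winding_def by (metis (mono_tags, lifting) map_cong)
  thus ?thesis by simp
qed

lemma box_exists: "\<exists>R. \<forall>e\<in>set l. in_box R (fst e) \<and> in_box R (snd e)"
proof (induction l)
  case (Cons e l)
  then obtain R where R: "\<forall>e\<in>set l. in_box R (fst e) \<and> in_box R (snd e)" by blast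
  define R' where "R' = \<bar>R\<bar> + \<bar>fst (fst e)\<bar> + \<bar>snd (fst e)\<bar> + \<bar>fst (snd e)\<bar> + \<bar>snd (snd e)\<bar>"
  have "in_box R' u" if "in_box R u" for u using that unfolding in_box_def R'_def by linarith
  moreover have "in_box R' (fst e)" "in_box R' (snd e)" by (simp_all add: in_box_def R'_def)
  ultimately show ?case using R by (intro exI[of _ R']) simp
qed simp

lemma finite_box: "finite {s. in_box R s}"
  by (rule finite_subset[of _ "{- R..R} \<times> {- R..R}"]) (auto simp: in_box_def)

lemma winding_support: 
  assumes "walk v l v"
  shows "finite {s. winding l s \<noteq> 0}"
proof -
  obtain R where "\<forall>e\<in>set l. in_box R (fst e) \<and> in_box R (snd e)" using box_exists by blast
  hence "{s. winding l s \<noteq> 0} \<subseteq> {s. in_box R s}"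
    using winding_outside_box[OF assms, of R] by blast
  thus ?thesis using finite_box finite_subset by blast
qed

lemma winding_step:
  assumes "walk v l v" "square_step l s t"
  shows "winding l s = winding l t"
proof -
  obtain e where "e \<in> lattice_edges" "side e True = t" "side e False = s"
    "e \<notin> set l" "edge_inv e \<notin> set l" using assms(2) unfolding square_step_iff by blast
  thus ?thesis using winding_cross[OF assms(1), of e] by (simp add: count_notin)
qed

lemma winding_reachable:
  assumes "walk v l v" "(square_step l)\<^sup>*\<^sup>* s t"
  shows "winding l s = winding l t"
  using assms(2) by (induction rule: rtranclp_induct) (simp_all add: winding_step[OF assms(1)])

lemma winding_unbounded:
  assumes "walk v l v" "infinite {t. (square_step l)\<^sup>*\<^sup>* s t}"
  shows "winding l s = 0"
proof (rule ccontr)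
  assume "winding l s \<noteq> 0"
  hence "{t. (square_step l)\<^sup>*\<^sup>* s t} \<subseteq> {t. winding l t \<noteq> 0}"
    using winding_reachable[OF assms(1), of s] by (intro subsetI) simp
  thus False using assms(2) winding_support[OF assms(1)] finite_subset by blast
qed

lemma winding_concat: "winding (loop_power l n) s = int n * winding l s"
  unfolding loop_power_def winding_def by (induction n) (simp_all add: algebra_simps)

lemma unoriented_eq_iff:
  "(\<lambda>(u, v). {u, v}) e = (\<lambda>(u, v). {u, v}) (f :: oedge) \<longleftrightarrow> e = f \<or> e = edge_inv f"
  by (cases e; cases f) (simp add: doubleton_eq_iff)

text \<open>Positive plaquettes traverse a common side in opposite directions, so a common side is an edge
  with the two squares on its two sides.\<close>
lemma shared_edge:
  "unoriented_edges (s, True) \<inter> unoriented_edges (t, True) =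
     (\<lambda>(u, v). {u, v}) ` {e \<in> lattice_edges. side e True = t \<and> side e False = s}"
  if "s \<noteq> t"
proof (rule set_eqI, rule iffI)
  let ?u = "\<lambda>(u, v). {u, v} :: vertex set"
  fix U assume "U \<in> unoriented_edges (s, True) \<inter> unoriented_edges (t, True)"
  hence U: "U \<in> ?u ` set (plaq_path (s, True))" "U \<in> ?u ` set (plaq_path (t, True))"
    by (simp_all only: unoriented_edges_def Int_iff)
  from U(1) obtain f where f: "U = ?u f" "f \<in> set (plaq_path (s, True))" by (rule imageE)
  from U(2) obtain e where e: "U = ?u e" "e \<in> set (plaq_path (t, True))" by (rule imageE)
  have ft: "side f True = s" "side e True = t" "e \<in> lattice_edges"
    using f(2) e(2) by (simp_all only: in_plaq_path_iff)
  have "?u e = ?u f" by (rule trans[OF e(1)[symmetric] f(1)])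
  hence "e = f \<or> e = edge_inv f" by (simp only: unoriented_eq_iff)
  hence "e = edge_inv f" using ft that by metis
  hence "side e False = s" using ft by simp
  hence "e \<in> {e \<in> lattice_edges. side e True = t \<and> side e False = s}" using ft by simp
  with e(1) show "U \<in> ?u ` {e \<in> lattice_edges. side e True = t \<and> side e False = s}"
    by (rule image_eqI)
next
  let ?u = "\<lambda>(u, v). {u, v} :: vertex set"
  fix U assume "U \<in> ?u ` {e \<in> lattice_edges. side e True = t \<and> side e False = s}"
  then obtain e where e: "U = ?u e" "e \<in> {e \<in> lattice_edges. side e True = t \<and> side e False = s}"
    by (rule imageE)
  have u: "U = ?u (edge_inv e)" unfolding e(1) unoriented_eq_iff by simp
  have "edge_inv e \<in> set (plaq_path (s, True))" "e \<in> set (plaq_path (t, True))"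
    using e(2) by (simp_all add: in_plaq_path_iff)
  hence "?u (edge_inv e) \<in> unoriented_edges (s, True)" "?u e \<in> unoriented_edges (t, True)"
    unfolding unoriented_edges_def by (simp_all only: imageI)
  hence "U \<in> unoriented_edges (s, True)" "U \<in> unoriented_edges (t, True)"
    by (simp_all only: u[symmetric] e(1)[symmetric])
  thus "U \<in> unoriented_edges (s, True) \<inter> unoriented_edges (t, True)" by (rule IntI)
qed

lemma adjacent_edge:
  assumes "adjacent (s, True) (t, True)"
  obtains e where "e \<in> lattice_edges"
    "\<And>f. f \<in> lattice_edges \<and> side f True = t \<and> side f False = s \<longleftrightarrow> f = e"
proof -
  let ?u = "\<lambda>(u, v). {u, v} :: vertex set"
  let ?E = "{e \<in> lattice_edges. side e True = t \<and> side e False = s}"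
  have st: "s \<noteq> t"
  proof
    assume "s = t"
    hence "card (unoriented_edges (s, True)) = 1" using assms by (simp add: adjacent_def)
    moreover obtain x y where s: "s = (x, y)" by (cases s)
    have "unoriented_edges (s, True) \<supseteq> {{(x, y), (x, y + 1)}, {(x, y + 1), (x + 1, y + 1)}}"
      by (auto simp: unoriented_edges_def s plaq_path_simps)
    moreover have "{(x, y), (x, y + 1)} \<noteq> {(x, y + 1), (x + 1, y + 1)}" by (simp add: doubleton_eq_iff)
    moreover have "finite (unoriented_edges (s, True))" by (simp add: unoriented_edges_def)
    ultimately show False by (metis card_1_singletonE insert_subset singletonD)
  qed
  have "card (?u ` ?E) = 1" using assms shared_edge[OF st] by (simp add: adjacent_def)
  then obtain U where U: "?u ` ?E = {U}" by (rule card_1_singletonE)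
  hence "U \<in> ?u ` ?E" by simp
  then obtain e where e: "U = ?u e" "e \<in> ?E" by (rule imageE)
  have uniq: "f = e" if "f \<in> ?E" for f
  proof -
    have "?u f \<in> {U}" unfolding U[symmetric] using that by (rule imageI)
    hence "?u f = ?u e" using e(1) by (simp only: singleton_iff)
    hence "f = e \<or> f = edge_inv e" by (simp only: unoriented_eq_iff)
    moreover have "f \<noteq> edge_inv e"
    proof
      assume "f = edge_inv e"
      hence "side f True = s" using e(2) by simp
      thus False using that st by simp
    qed
    ultimately show ?thesis by blast
  qed
  have "f \<in> lattice_edges \<and> side f True = t \<and> side f False = s \<longleftrightarrow> f = e" for f
    using uniq[of f] e(2) by blast
  moreover have "e \<in> lattice_edges" using e(2) by simp
  ultimately show ?thesis using that[of e] by blast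
qed

lemma crossings_eq:
  assumes "set l \<subseteq> lattice_edges"
    and "\<And>f. f \<in> lattice_edges \<and> side f True = t \<and> side f False = s \<longleftrightarrow> f = e"
  shows "crossings l (s, True) (t, True) = count_list l e"
proof -
  have "f \<in> set (plaq_path (t, True)) \<and> edge_inv f \<in> set (plaq_path (s, True)) \<longleftrightarrow> f = e" for f
    using assms(2)[of f] by (auto simp: in_plaq_path_iff)
  hence "crossings l (s, True) (t, True) = length (filter (\<lambda>f. f = e) l)"
    unfolding crossings_def by simp
  also have "\<dots> = count_list l e" by (induction l) auto
  finally show ?thesis .
qed

lemma winding_is_height:
  assumes l: "walk v l v"
  shows "is_height l (\<lambda>p. winding l (fst p))"
proof -
  have "winding l t = winding l s + int (crossings l (s, True) (t, True)) - int (crossings l (t, True) (s, True))"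
    if "adjacent (s, True) (t, True)" for s t
  proof -
    obtain e where e: "e \<in> lattice_edges"
      "\<And>f. f \<in> lattice_edges \<and> side f True = t \<and> side f False = s \<longleftrightarrow> f = e"
      using adjacent_edge[OF \<open>adjacent (s, True) (t, True)\<close>] by blast
    have "f \<in> lattice_edges \<and> side f True = s \<and> side f False = t \<longleftrightarrow> f = edge_inv e" for f
      using e(2)[of "edge_inv f"] by (auto simp: swap_swap)
    hence "crossings l (t, True) (s, True) = count_list l (edge_inv e)"
      by (intro crossings_eq walk_edges[OF l])
    moreover have "crossings l (s, True) (t, True) = count_list l e"
      by (intro crossings_eq walk_edges[OF l] e(2))
    moreover have "side e True = t" "side e False = s" using e by blast+
    ultimately show ?thesis using winding_cross[OF l e(1)] by simp
  qed
  moreover obtain R where R: "\<forall>e\<in>set l. in_box R (fst e) \<and> in_box R (snd e)" using box_exists by blast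
  moreover have "\<forall>p :: plaquette. \<not> in_box R (fst p) \<longrightarrow> winding l (fst p) = 0"
    using winding_outside_box[OF l, of R] R by blast
  ultimately show ?thesis unfolding is_height_def
    by (auto simp: plaq_inv_def positive_plaquettes_def split_paired_All)
qed

lemma adjacent_above: "adjacent ((x, y), True) ((x, y + 1), True)"
proof -
  let ?e = "((x + 1, y + 1), (x, y + 1)) :: oedge"
  have "{e \<in> lattice_edges. side e True = (x, y + 1) \<and> side e False = (x, y)} = {?e}"
  proof (rule set_eqI, rule iffI)
    fix f assume "f \<in> {e \<in> lattice_edges. side e True = (x, y + 1) \<and> side e False = (x, y)}"
    hence f: "f \<in> lattice_edges" "side f True = (x, y + 1)" "side f False = (x, y)" by simp_all
    from f(1) have "f = ?e" by (rule lattice_edge_cases) (use f(2,3) in \<open>auto simp: side_def\<close>)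
    thus "f \<in> {?e}" by simp
  next
    fix f assume "f \<in> {?e}"
    thus "f \<in> {e \<in> lattice_edges. side e True = (x, y + 1) \<and> side e False = (x, y)}"
      using side_simps(4)[of x "y + 1"] by (simp add: lattice_edges_def)
  qed
  thus ?thesis using shared_edge[of "(x, y)" "(x, y + 1)"] by (simp add: adjacent_def)
qed

text \<open>Two height functions differ by a function that does not change from a square to the one
  above it and that vanishes far away.\<close>
lemma height_eq:
  assumes l: "walk v l v"
  shows "height l p = winding l (fst p)"
proof -
  have "h = (\<lambda>p. winding l (fst p))" if h: "is_height l h" for h
  proof -
    let ?d = "\<lambda>p. h p - winding l (fst p)"
    have w: "is_height l (\<lambda>p. winding l (fst p))" by (rule winding_is_height[OF l])
    have step: "?d ((x, y), True) = ?d ((x, y + 1), True)" for x y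
    proof -
      let ?p = "((x, y), True) :: plaquette" and ?q = "((x, y + 1), True) :: plaquette"
      have D: "g ?q = g ?p + int (crossings l ?p ?q) - int (crossings l ?q ?p)"
        if "is_height l g" for g
      proof -
        have "\<forall>p\<in>positive_plaquettes. \<forall>q\<in>positive_plaquettes. adjacent p q \<longrightarrow>
          g q = g p + int (crossings l p q) - int (crossings l q p)"
          using that unfolding is_height_def by blast
        from this[rule_format, of ?p ?q] show ?thesis
          using adjacent_above[of x y] by (simp add: positive_plaquettes_def)
      qed
      show ?thesis using D[OF h] D[OF w] by simp
    qed
    have up: "?d ((x, y), True) = ?d ((x, y + int k), True)" for x y k
    proof (induction k)
      case (Suc k)
      thus ?case using step[of x "y + int k"] by (simp add: algebra_simps)
    qed simp
    obtain R1 where R1: "\<forall>p. \<not> in_box R1 (fst p) \<longrightarrow> h p = 0"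
      using h unfolding is_height_def by blast
    obtain R2 where R2: "\<forall>p :: plaquette. \<not> in_box R2 (fst p) \<longrightarrow> winding l (fst p) = 0"
      using w unfolding is_height_def by blast
    have pos: "?d (s, True) = 0" for s
    proof -
      obtain x y where s: "s = (x, y)" by (cases s)
      define k where "k = nat (\<bar>R1\<bar> + \<bar>R2\<bar> + \<bar>y\<bar> + 1)"
      have "\<not> in_box R1 (x, y + int k)" "\<not> in_box R2 (x, y + int k)"
        by (auto simp: in_box_def k_def)
      thus ?thesis unfolding s up[of x y k]
        using R1[rule_format, of "((x, y + int k), True)"] R2[rule_format, of "((x, y + int k), True)"]
        by simp
    qed
    show ?thesis
    proof
      fix p :: plaquette
      obtain s b where p: "p = (s, b)" by (cases p)
      have "\<forall>p. h (plaq_inv p) = h p" using h unfolding is_height_def by blast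
      from this[rule_format, of "(s, True)"] have "h (s, False) = h (s, True)"
        by (simp add: plaq_inv_def)
      thus "h p = winding l (fst p)" using pos[of s] p by (cases b) simp_all
    qed
  qed
  hence "height l = (\<lambda>p. winding l (fst p))"
    unfolding height_def using winding_is_height[OF l] by (intro the_equality)
  thus ?thesis by simp
qed

section \<open>Peeling squares\<close>

text \<open>Take a shortest non-empty closed subwalk. It visits its starting point only once, so its first
  edge is not repeated; the reversed edge could only follow after a non-empty closed part, which
  would be shorter.\<close>
lemma closed_subwalk:
  assumes "walk v l v" "l \<noteq> []" "\<And>a e b. l \<noteq> a @ e # edge_inv e # b"
  shows "\<exists>u C e. walk u C u \<and> set C \<subseteq> set l \<and> e \<in> set C \<and> count_list C e = 1 \<and> edge_inv e \<notin> set C"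
  using assms
proof (induction "length l" arbitrary: v l rule: less_induct)
  case less
  note IH = less.hyps and l = less.prems(1) and ne = less.prems(2) and nb = less.prems(3)
  obtain e r where er: "l = e # r" using ne by (cases l) auto
  have e: "e \<in> lattice_edges" "fst e = v" using l er by simp_all
  show ?case
  proof (cases "\<exists>a x b. l = a @ x # b \<and> a \<noteq> [] \<and> fst x = v")
    case True
    then obtain a x b where a: "l = a @ x # b" "a \<noteq> []" "fst x = v" by blast
    have w: "walk v a v" using l a by (auto simp: walk_append)
    have nba: "a \<noteq> p @ f # edge_inv f # q" for p f q
      using nb[of p f "q @ x # b"] a(1) by auto
    have "length a < length l" using a(1) by simp
    from IH[OF this w a(2) nba] show ?thesis using a(1) by fastforce
  next
    case False
    show ?thesis
    proof (cases "edge_inv e \<in> set r")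
      case False': False
      have "e \<notin> set r"
      proof
        assume "e \<in> set r"
        then obtain a b where "r = a @ e # b" by (meson split_list)
        thus False using False er e by (metis append_Cons list.distinct(1))
      qed
      moreover have "edge_inv e \<notin> set l" using False' er edge_inv_neq[OF e(1)] by simp
      ultimately show ?thesis using l er by (intro exI[of _ v] exI[of _ l] exI[of _ e]) (simp add: count_notin)
    next
      case True
      then obtain a b where r: "r = a @ edge_inv e # b" by (meson split_list)
      have "walk (snd e) a (snd e)" using l er r by (auto simp: walk_append)
      moreover have "a \<noteq> []" using nb[of "[]" e b] er r by auto
      moreover have "a \<noteq> p @ f # edge_inv f # q" for p f q
        using nb[of "e # p" f "q @ edge_inv e # b"] er r by auto
      moreover have "length a < length l" using er r by simp
      ultimately show ?thesis using IH[of a "snd e"] er r by fastforce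
    qed
  qed
qed

lemma square_step_mono: "set l' \<subseteq> set l \<Longrightarrow> square_step l s t \<Longrightarrow> square_step l' s t"
  unfolding square_step_iff by blast

lemma unbounded_mono:
  assumes "set l' \<subseteq> set l" "infinite {t. (square_step l)\<^sup>*\<^sup>* s t}"
  shows "infinite {t. (square_step l')\<^sup>*\<^sup>* s t}"
proof -
  have "(square_step l)\<^sup>*\<^sup>* s t \<Longrightarrow> (square_step l')\<^sup>*\<^sup>* s t" for t
    by (induction rule: rtranclp_induct)
      (auto intro: rtranclp.rtrancl_into_rtrancl square_step_mono[OF assms(1)])
  hence "{t. (square_step l)\<^sup>*\<^sup>* s t} \<subseteq> {t. (square_step l')\<^sup>*\<^sup>* s t}" by (intro subsetI) simp
  thus ?thesis using assms(2) finite_subset by blast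
qed

text \<open>If no square is cut off from infinity, the walk runs on a tree. Indeed a walk without
  backtracks would contain a closed part that uses some edge in one direction only; the winding
  numbers on the two sides of that edge differ, but they vanish because both squares reach infinity.\<close>
lemma tree_contour_cancels:
  assumes "walk v l v" "\<And>s. infinite {t. (square_step l)\<^sup>*\<^sup>* s t}"
  shows "cancels l []"
  using assms
proof (induction "length l" arbitrary: l rule: less_induct)
  case less
  show ?case
  proof (cases "\<exists>a e b. l = a @ e # edge_inv e # b")
    case True
    then obtain a e b where l: "l = a @ e # edge_inv e # b" by blast
    have "cancels (a @ b) []"
    proof (rule less.hyps)
      show "length (a @ b) < length l" by (simp add: l)
      show "walk v (a @ b) v" using less.prems(1) by (auto simp: l walk_append)
      show "infinite {t. (square_step (a @ b))\<^sup>*\<^sup>* s t}" for s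
        by (rule unbounded_mono[OF _ less.prems(2)]) (auto simp: l)
    qed
    thus ?thesis unfolding l by (rule cancels.erase)
  next
    case False
    show ?thesis
    proof (cases "l = []")
      case True
      thus ?thesis by (simp add: cancels.none)
    next
      case nonempty: False
      obtain u C e where C: "walk u C u" "set C \<subseteq> set l" "e \<in> set C" "count_list C e = 1" "edge_inv e \<notin> set C"
        using closed_subwalk[OF less.prems(1) nonempty] False by blast
      have z: "winding C s = 0" for s
        by (rule winding_unbounded[OF C(1) unbounded_mono[OF C(2) less.prems(2)]])
      have "e \<in> lattice_edges" using walk_edges[OF C(1)] C(3) by blast
      from winding_cross[OF C(1) this] have False using C(4,5) by (simp add: z count_notin)
      thus ?thesis ..
    qed
  qed
qed

lemma count_list_distinct: "distinct l \<Longrightarrow> count_list l x = of_bool (x \<in> set l)"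
  by (induction l) auto

text \<open>\<open>l\<close> is the contour of the set \<open>S\<close> of squares, run through with \<open>S\<close> on the right (\<open>b = True\<close>) or
  on the left. Besides the boundary of \<open>S\<close>, the contour may contain edges that are traversed once in
  each direction and have no square of \<open>S\<close> at their sides: these are the threads that remain when
  squares are peeled off, and they join the components of \<open>S\<close>. The last clause says that the
  union of \<open>S\<close> and the threads has no holes.\<close>
definition bounds :: "bool \<Rightarrow> oedge list \<Rightarrow> vertex set \<Rightarrow> bool" where
  "bounds b l S \<longleftrightarrow> is_loop l \<and> finite S \<and>
     (\<forall>e\<in>lattice_edges. int (count_list l e) - int (count_list l (edge_inv e))
        = of_bool (side e b \<in> S) - of_bool (side e (\<not> b) \<in> S)) \<and>
     (\<forall>e. count_list l e \<le> 1) \<and>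
     (\<forall>e\<in>set l. edge_inv e \<in> set l \<longrightarrow> side e True \<notin> S \<and> side e False \<notin> S) \<and>
     (\<forall>s. s \<notin> S \<longrightarrow> infinite {t. (square_step l)\<^sup>*\<^sup>* s t})"

lemma bounds_rotate: "bounds b (l @ r) S \<Longrightarrow> bounds b (r @ l) S"
proof -
  assume B: "bounds b (l @ r) S"
  have "square_step (r @ l) = square_step (l @ r)"
    by (intro ext) (auto simp: square_step_def)
  thus "bounds b (r @ l) S"
    using B is_loop_append_commute[of l r] unfolding bounds_def
    by (simp add: add.commute Un_commute)
qed

text \<open>The upper side of a topmost square is such an edge.\<close>
lemma boundary_edge_exists:
  assumes "finite S" "S \<noteq> {}"
  shows "\<exists>e\<in>lattice_edges. side e b \<in> S \<and> side e (\<not> b) \<notin> S"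
proof -
  have fin: "finite (snd ` S)" "snd ` S \<noteq> {}" using assms by simp_all
  from Max_in[OF fin] obtain s where s: "Max (snd ` S) = snd s" "s \<in> S" by (rule imageE)
  obtain x y where xy: "s = (x, y)" by (cases s)
  have above: "(x, y + 1) \<notin> S"
  proof
    assume "(x, y + 1) \<in> S"
    hence "y + 1 \<le> Max (snd ` S)" using fin(1) by (intro Max_ge) (auto intro: rev_image_eqI)
    thus False using s xy by simp
  qed
  let ?e = "((x, y + 1), (x + 1, y + 1)) :: oedge"
  have "?e \<in> lattice_edges" "side ?e True = (x, y)" "side ?e False = (x, y + 1)"
    by (simp_all add: lattice_edges_def side_def)
  then obtain e where e: "e \<in> lattice_edges" "side e True \<in> S" "side e False \<notin> S"
    using s(2) above xy by metis
  show ?thesis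
  proof (cases b)
    case True
    thus ?thesis using e by (intro bexI[of _ e]) simp_all
  next
    case False
    thus ?thesis using e by (intro bexI[of _ "edge_inv e"]) simp_all
  qed
qed

text \<open>A path that leaves \<open>S\<close> aside and does not cross the contour stays outside \<open>S\<close>, hence never
  crosses a side of a square of \<open>S\<close> either.\<close>
lemma bounds_outside:
  assumes B: "bounds b l S" and u: "u \<notin> S"
    and l': "\<And>f. f \<in> set l' \<Longrightarrow> f \<in> set l \<or> side f True \<in> S \<or> side f False \<in> S"
  shows "infinite {t. (square_step l')\<^sup>*\<^sup>* u t}"
proof -
  have step: "square_step l' x w \<and> w \<notin> S" if xw: "square_step l x w" "x \<notin> S" for x w
  proof -
    obtain f where f: "f \<in> lattice_edges" "side f True = w" "side f False = x"
      "f \<notin> set l" "edge_inv f \<notin> set l" using xw(1) unfolding square_step_iff by blast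
    have "int (count_list l f) - int (count_list l (edge_inv f))
        = of_bool (side f b \<in> S) - of_bool (side f (\<not> b) \<in> S)"
      using B f(1) unfolding bounds_def by blast
    hence "of_bool (side f b \<in> S) = (of_bool (side f (\<not> b) \<in> S) :: int)"
      using f(4,5) by (simp add: count_notin)
    hence w: "w \<notin> S" using f(2,3) xw(2) by (cases b) (auto split: if_splits)
    have "f \<notin> set l'" "edge_inv f \<notin> set l'"
      using l'[of f] l'[of "edge_inv f"] f w xw(2) by auto
    thus ?thesis using f w unfolding square_step_iff by blast
  qed
  have "(square_step l)\<^sup>*\<^sup>* u w \<Longrightarrow> (square_step l')\<^sup>*\<^sup>* u w \<and> w \<notin> S" for w
    by (induction rule: rtranclp_induct)
      (use u in \<open>auto dest: step intro: rtranclp.rtrancl_into_rtrancl\<close>)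
  hence "{t. (square_step l)\<^sup>*\<^sup>* u t} \<subseteq> {t. (square_step l')\<^sup>*\<^sup>* u t}"
    by (intro subsetI) simp
  moreover have "infinite {t. (square_step l)\<^sup>*\<^sup>* u t}" using B u unfolding bounds_def by blast
  ultimately show ?thesis using finite_subset by blast
qed

text \<open>Replacing a free edge \<open>e\<close> of the square \<open>s\<close> by the other three sides of \<open>s\<close> is an elementary
  collapse. A side of \<open>s\<close> that was already traversed in the opposite direction turns into a thread,
  and \<open>s\<close> becomes connected to infinity through \<open>e\<close>.\<close>
lemma peel_bounds:
  assumes B: "bounds b (e # r) S" and e: "side e b \<in> S" "side e (\<not> b) \<notin> S"
  defines "s \<equiv> side e b"
  shows "e \<notin> set r" "edge_inv e \<notin> set r"
    and "bounds b (plaq_rest (edge_inv e) (s, \<not> b) @ r) (S - {s})"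
proof -
  let ?e' = "edge_inv e" and ?l = "e # r"
  let ?t = "plaq_rest ?e' (s, \<not> b)"
  have loop: "is_loop ?l" and fin: "finite S" using B by (simp_all add: bounds_def)
  have diff: "int (count_list ?l f) - int (count_list ?l (edge_inv f))
      = of_bool (side f b \<in> S) - of_bool (side f (\<not> b) \<in> S)" if "f \<in> lattice_edges" for f
    using B that unfolding bounds_def by blast
  have le1: "count_list ?l f \<le> 1" for f using B unfolding bounds_def by blast
  have both: "side f c \<notin> S" if "f \<in> set ?l" "edge_inv f \<in> set ?l" for f c
  proof -
    have "side f True \<notin> S \<and> side f False \<notin> S" using B that unfolding bounds_def by blast
    thus ?thesis by (cases c) simp_all
  qed
  have el: "e \<in> lattice_edges" using loop by (simp add: is_loop_def)
  have count_mem: "count_list l f = 0 \<longleftrightarrow> f \<notin> set l" for l :: "oedge list" and f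
    by (rule count_list_0_iff)
  show er: "e \<notin> set r" using le1[of e] count_mem[of r e] by simp
  have "edge_inv e \<notin> set ?l" using both[of e b] e by auto
  thus e'r: "?e' \<notin> set r" by simp
  have e'p: "?e' \<in> set (plaq_path (s, \<not> b))" using el by (simp add: in_plaq_path_iff s_def)
  note R = plaquette_readings[OF e'p]
  have mem_t: "f \<in> set ?t \<longleftrightarrow> f \<in> lattice_edges \<and> side f (\<not> b) = s \<and> f \<noteq> ?e'" for f
    using R(4) by (auto simp: in_plaq_path_iff)
  have count_t: "count_list ?t f = of_bool (side f (\<not> b) = s \<and> f \<noteq> ?e')" if "f \<in> lattice_edges" for f
    using count_list_distinct[OF R(5), of f] mem_t[of f] that by simp
  have sb: "side e (\<not> b) \<noteq> s" using e by (auto simp: s_def)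
  let ?r' = "?t @ r"
  have diff': "int (count_list ?r' f) - int (count_list ?r' (edge_inv f))
      = of_bool (side f b \<in> S - {s}) - of_bool (side f (\<not> b) \<in> S - {s})" if f: "f \<in> lattice_edges" for f
  proof -
    have eq: "edge_inv f = ?e' \<longleftrightarrow> f = e" "edge_inv f = e \<longleftrightarrow> f = ?e'"
      by (metis swap_swap)+
    have l: "int (count_list ?l f) = of_bool (f = e) + int (count_list r f)"
      "int (count_list ?l (edge_inv f)) = of_bool (f = ?e') + int (count_list r (edge_inv f))"
      using eq(2) by auto
    have "f = ?e' \<Longrightarrow> side f (\<not> b) = s" by (simp add: s_def)
    hence t1: "int (count_list ?t f) = of_bool (side f (\<not> b) = s) - of_bool (f = ?e')"
      unfolding count_t[OF f] by auto
    have "f = e \<Longrightarrow> side f b = s" by (simp add: s_def)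
    hence t2: "int (count_list ?t (edge_inv f)) = of_bool (side f b = s) - of_bool (f = e)"
      using count_t[of "edge_inv f"] f eq(1) by auto
    have S: "(of_bool (u \<in> S - {s}) :: int) = of_bool (u \<in> S) - of_bool (u = s)" for u
      using e(1) by (auto simp: s_def)
    show ?thesis using diff[OF f] unfolding l S count_list_append of_nat_add t1 t2 by linarith
  qed
  \<comment> \<open>A side of \<open>s\<close> that the old contour traverses with \<open>s\<close> on the wrong side would be traversed in
    both directions, although \<open>s\<close> lies in \<open>S\<close>.\<close>
  have le1': "count_list ?r' f \<le> 1" for f
  proof (cases "f \<in> set ?t")
    case True
    hence f: "f \<in> lattice_edges" "side f (\<not> b) = s" "f \<noteq> ?e'" using mem_t by auto
    have "f \<noteq> e" using f(2) sb by auto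
    have "f \<notin> set r"
    proof
      assume "f \<in> set r"
      hence c1: "count_list ?l f \<ge> 1" using count_mem[of ?l f] by (simp add: Suc_le_eq)
      have "edge_inv f \<notin> set ?l" using both[of f "\<not> b"] \<open>f \<in> set r\<close> f(2) e(1) by (auto simp: s_def)
      hence "count_list ?l (edge_inv f) = 0" using count_mem[of ?l] by blast
      moreover have "(of_bool (side f (\<not> b) \<in> S) :: int) = 1" using f(2) e(1) by (simp add: s_def)
      moreover have "(of_bool (side f b \<in> S) :: int) \<le> 1" by simp
      ultimately show False using diff[OF f(1)] c1 by linarith
    qed
    thus ?thesis using count_t[OF f(1)] by (simp add: count_mem)
  next
    case False
    hence "count_list ?t f = 0" by (simp add: count_mem)
    thus ?thesis using le1[of f] by (simp split: if_splits)
  qed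
  have both': "side f True \<notin> S - {s} \<and> side f False \<notin> S - {s}"
    if f: "f \<in> set ?r'" "edge_inv f \<in> set ?r'" for f
  proof (rule ccontr)
    have fl: "f \<in> lattice_edges"
    proof -
      have "set ?r' \<subseteq> lattice_edges" using mem_t loop by (auto simp: is_loop_def)
      thus ?thesis using f by blast
    qed
    have one: "count_list ?r' f = 1" "count_list ?r' (edge_inv f) = 1"
      using le1'[of f] le1'[of "edge_inv f"] f count_mem[of ?r'] by (metis le_antisym less_one not_le)+
    assume "\<not> (side f True \<notin> S - {s} \<and> side f False \<notin> S - {s})"
    hence in_S: "side f b \<in> S - {s} \<and> side f (\<not> b) \<in> S - {s}"
      using diff'[OF fl] unfolding one by (cases b) (auto split: if_splits)
    hence "f \<notin> set ?t" "edge_inv f \<notin> set ?t" using mem_t[of f] mem_t[of "edge_inv f"] by auto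
    hence "f \<in> set ?l" "edge_inv f \<in> set ?l" using f by auto
    thus False using both[of f b] in_S by blast
  qed
  have out1: "infinite {t. (square_step ?r')\<^sup>*\<^sup>* u t}" if "u \<notin> S" for u
  proof (rule bounds_outside[OF B that])
    fix f assume "f \<in> set ?r'"
    thus "f \<in> set ?l \<or> side f True \<in> S \<or> side f False \<in> S"
      using mem_t[of f] e(1) by (cases b) (auto simp: s_def)
  qed
  have out': "infinite {t. (square_step ?r')\<^sup>*\<^sup>* u t}" if "u \<notin> S - {s}" for u
  proof (cases "u = s")
    case True
    have "e \<notin> set ?r'" "?e' \<notin> set ?r'" using er e'r mem_t[of e] mem_t[of ?e'] sb by auto
    from square_stepI[OF el this, of b] have "square_step ?r' s (side e (\<not> b))"
      by (simp only: s_def)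
    hence "{t. (square_step ?r')\<^sup>*\<^sup>* (side e (\<not> b)) t} \<subseteq> {t. (square_step ?r')\<^sup>*\<^sup>* u t}"
      unfolding True by (intro subsetI) (simp add: converse_rtranclp_into_rtranclp)
    thus ?thesis using out1[OF e(2)] finite_subset by blast
  next
    case False
    thus ?thesis using that by (intro out1) simp
  qed
  have "is_loop ?r'"
  proof -
    have "walk (fst e) ?l (fst e)" using loop by (auto simp: is_loop_iff_walk)
    hence "walk (snd e) r (fst e)" by simp
    moreover have "walk (fst e) ?t (snd e)" using R(3) by simp
    ultimately show ?thesis by (intro walk_loop[of "fst e"]) (auto simp: walk_append)
  qed
  thus "bounds b ?r' (S - {s})"
    unfolding bounds_def using fin diff' le1' both' out' by blast
qed

section \<open>Simple loops\<close>

text \<open>Rotation of an edge by a right angle to the left, about its starting point.\<close>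
definition turn :: "oedge \<Rightarrow> oedge" where
  "turn e = (let (x, y) = fst e; (x', y') = snd e in ((x, y), (x - (y' - y), y + (x' - x))))"

lemma turn_simps:
  "turn ((x, y), (x', y')) = ((x, y), (x - (y' - y), y + (x' - x)))"
  by (simp add: turn_def)

lemma turn_lattice: "e \<in> lattice_edges \<Longrightarrow> turn e \<in> lattice_edges"
  by (erule lattice_edge_cases) (simp_all add: turn_simps lattice_edges_def)

lemma fst_turn: "fst (turn e) = fst e"
  by (simp add: turn_def split: prod.splits)

lemma side_turn: "e \<in> lattice_edges \<Longrightarrow> side (turn e) True = side e False"
  by (erule lattice_edge_cases) (simp_all add: turn_simps side_def)

lemma turn_distinct:
  assumes "e \<in> lattice_edges"
  shows "turn e \<noteq> e" "turn (turn e) \<noteq> e" "turn (turn (turn e)) \<noteq> e"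
  using assms by (auto elim!: lattice_edge_cases simp: turn_simps)

lemma turn_exhaust:
  assumes "e \<in> lattice_edges" "f \<in> lattice_edges" "fst e = fst f"
  shows "f = e \<or> f = turn e \<or> f = turn (turn e) \<or> f = turn (turn (turn e))"
proof -
  obtain x y a b where e: "e = ((x, y), (x + a, y + b))"
    by (metis add.commute diff_add_cancel prod.exhaust)
  obtain a' b' where f: "f = ((x, y), (x + a', y + b'))"
    using assms(3) e by (metis add.commute diff_add_cancel fst_conv prod.exhaust)
  have "\<bar>a\<bar> + \<bar>b\<bar> = 1" "\<bar>a'\<bar> + \<bar>b'\<bar> = 1"
    using assms(1,2) by (simp_all add: e f lattice_edges_def)
  hence "(a', b') = (a, b) \<or> (a', b') = (- b, a) \<or> (a', b') = (- a, - b) \<or> (a', b') = (b, - a)"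
    by (smt (verit) prod.inject)
  thus ?thesis by (auto simp: e f turn_simps)
qed

text \<open>Rotating to the left about the common starting point of \<open>o1\<close> and \<open>o2\<close>, from the left side of \<open>o1\<close>
  to the right side of \<open>o2\<close>, one crosses only edges strictly between them, which are not on the
  loop.\<close>
lemma around_vertex:
  assumes o: "o1 \<in> lattice_edges" "o2 \<in> lattice_edges" "fst o1 = fst o2" "o1 \<noteq> o2"
    and free: "\<And>f. f \<in> lattice_edges \<Longrightarrow> fst f = fst o1 \<Longrightarrow> f \<noteq> o1 \<Longrightarrow> f \<noteq> o2 \<Longrightarrow>
      f \<notin> set l \<and> edge_inv f \<notin> set l"
  shows "(square_step l)\<^sup>*\<^sup>* (side o1 False) (side o2 True)"
proof -
  let ?t1 = "turn o1" and ?t2 = "turn (turn o1)" and ?t3 = "turn (turn (turn o1))"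
  have lat: "?t1 \<in> lattice_edges" "?t2 \<in> lattice_edges" "?t3 \<in> lattice_edges"
    using o(1) by (simp_all add: turn_lattice)
  note d = turn_distinct[OF o(1)] turn_distinct[OF lat(1)]
  have step: "square_step l (side f True) (side (turn f) True)"
    if "f \<in> lattice_edges" "fst f = fst o1" "f \<noteq> o1" "f \<noteq> o2" for f
    using square_stepI[OF that(1), of l True] free[OF that] side_turn[OF that(1)] by simp
  consider "o2 = ?t1" | "o2 = ?t2" | "o2 = ?t3" using turn_exhaust[OF o(1,2,3)] o(4) by metis
  thus ?thesis
  proof cases
    case 1
    thus ?thesis using side_turn[OF o(1)] by simp
  next
    case 2
    thus ?thesis using side_turn[OF o(1)] step[of ?t1] lat d by (simp add: fst_turn r_into_rtranclp)
  next
    case 3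
    have "square_step l (side ?t1 True) (side ?t2 True)"
      by (rule step) (use lat d 3 in \<open>simp_all add: fst_turn\<close>)
    moreover have "square_step l (side ?t2 True) (side ?t3 True)"
      by (rule step) (use lat d turn_distinct[OF lat(2)] 3 in \<open>simp_all add: fst_turn\<close>)
    ultimately show ?thesis using side_turn[OF o(1)] 3
      by (metis converse_rtranclp_into_rtranclp r_into_rtranclp)
  qed
qed

lemma reach_sym: "(square_step l)\<^sup>*\<^sup>* s t \<Longrightarrow> (square_step l)\<^sup>*\<^sup>* t s"
  by (induction rule: rtranclp_induct) (auto intro: converse_rtranclp_into_rtranclp square_step_sym)

lemma reach_infinite:
  assumes "(square_step l)\<^sup>*\<^sup>* s t" "infinite {u. (square_step l)\<^sup>*\<^sup>* t u}"
  shows "infinite {u. (square_step l)\<^sup>*\<^sup>* s u}"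
proof -
  have "{u. (square_step l)\<^sup>*\<^sup>* t u} \<subseteq> {u. (square_step l)\<^sup>*\<^sup>* s u}"
    using assms(1) by (intro subsetI) (simp add: rtranclp_trans)
  thus ?thesis using assms(2) finite_subset by blast
qed

text \<open>The upper side of a topmost square of the region cannot be crossed.\<close>
lemma bounded_region_touches:
  assumes "finite {t. (square_step l)\<^sup>*\<^sup>* s t}"
  shows "\<exists>f\<in>set l. \<exists>b. (square_step l)\<^sup>*\<^sup>* s (side f b) \<and> snd (fst f) = snd (snd f)"
proof -
  let ?T = "{t. (square_step l)\<^sup>*\<^sup>* s t}"
  have fin: "finite (snd ` ?T)" "snd ` ?T \<noteq> {}" using assms by auto
  from Max_in[OF fin] obtain t where t: "Max (snd ` ?T) = snd t" "t \<in> ?T" by (rule imageE)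
  obtain x y where xy: "t = (x, y)" by (cases t)
  let ?e = "((x, y + 1), (x + 1, y + 1)) :: oedge"
  have e: "?e \<in> lattice_edges" "side ?e True = (x, y)" "side ?e False = (x, y + 1)"
    by (simp_all add: lattice_edges_def side_def)
  then obtain e where e: "e \<in> lattice_edges" "side e True = t" "side e False = (x, y + 1)"
    "snd (fst e) = snd (snd e)" using xy by (metis fst_conv snd_conv)
  have "e \<in> set l \<or> edge_inv e \<in> set l"
  proof (rule ccontr)
    assume "\<not> (e \<in> set l \<or> edge_inv e \<in> set l)"
    hence "square_step l t (x, y + 1)" using square_stepI[OF e(1), of l True] e(2,3) by simp
    hence "(x, y + 1) \<in> ?T" using t(2) by auto
    hence "snd (x, y + 1) \<in> snd ` ?T" by (rule imageI)
    hence "y + 1 \<le> Max (snd ` ?T)" using fin(1) by simp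
    thus False using t(1) xy by simp
  qed
  thus ?thesis
  proof
    assume "e \<in> set l"
    thus ?thesis using t(2) e by (intro bexI[of _ e] exI[of _ True]) simp_all
  next
    assume "edge_inv e \<in> set l"
    thus ?thesis using t(2) e by (intro bexI[of _ "edge_inv e"] exI[of _ False]) simp_all
  qed
qed

text \<open>From the square above a topmost horizontal edge of the loop one can go straight up.\<close>
lemma unbounded_side_exists:
  assumes lat: "set l \<subseteq> lattice_edges" and f: "f \<in> set l" "snd (fst f) = snd (snd f)"
  shows "\<exists>e\<in>set l. \<exists>b. infinite {t. (square_step l)\<^sup>*\<^sup>* (side e b) t}"
proof -
  let ?H = "{e \<in> set l. snd (fst e) = snd (snd e)}"
  have fin: "finite ((\<lambda>e. snd (fst e)) ` ?H)" "(\<lambda>e. snd (fst e)) ` ?H \<noteq> {}" using f by auto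
  from Max_in[OF fin] obtain e where e: "Max ((\<lambda>e. snd (fst e)) ` ?H) = snd (fst e)" "e \<in> ?H"
    by (rule imageE)
  have top: "snd (fst g) \<le> snd (fst e)" if "g \<in> ?H" for g
  proof -
    have "snd (fst g) \<in> (\<lambda>e. snd (fst e)) ` ?H" using that by (rule imageI)
    thus ?thesis unfolding e(1)[symmetric] using fin(1) by simp
  qed
  have el: "e \<in> lattice_edges" using lat e(2) by blast
  obtain x y b where b: "side e b = (x, y)" "snd (fst e) = y"
  proof -
    show ?thesis using el e(2) that[of False] that[of True]
      by (elim lattice_edge_cases) (simp_all add: side_simps)
  qed
  have up: "square_step l (x, y + int k) (x, y + int k + 1)" for k
  proof -
    let ?g = "((x, y + int k + 1), (x + 1, y + int k + 1)) :: oedge"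
    have g: "?g \<in> lattice_edges" "side ?g True = (x, y + int k)" "side ?g False = (x, y + int k + 1)"
      by (simp_all add: lattice_edges_def side_def)
    have "?g \<notin> set l" "edge_inv ?g \<notin> set l" using top[of ?g] top[of "edge_inv ?g"] b(2) by auto
    from square_stepI[OF g(1) this, of True] show ?thesis using g(2,3) by simp
  qed
  have "(square_step l)\<^sup>*\<^sup>* (x, y) (x, y + int k)" for k
  proof (induction k)
    case (Suc k)
    thus ?case using up[of k] by (auto simp: algebra_simps intro: rtranclp.rtrancl_into_rtrancl)
  qed simp
  hence "range (\<lambda>k. (x, y + int k)) \<subseteq> {t. (square_step l)\<^sup>*\<^sup>* (side e b) t}"
    unfolding b(1) by (intro subsetI) auto
  moreover have "infinite (range (\<lambda>k. (x, y + int k)))"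
    by (rule range_inj_infinite) (simp add: inj_def)
  ultimately show ?thesis using e(2) finite_subset by blast
qed

lemma simple_loop_props:
  assumes "simple_loop l"
  shows "distinct l"
    and "\<And>e. e \<in> set l \<Longrightarrow> edge_inv e \<notin> set l"
    and "\<And>i. i < length l \<Longrightarrow> snd (l ! i) = fst (l ! (Suc i mod length l))"
    and "\<And>e f. e \<in> set l \<Longrightarrow> f \<in> set l \<Longrightarrow> fst e = fst f \<Longrightarrow> e = f"
    and "\<And>e f. e \<in> set l \<Longrightarrow> f \<in> set l \<Longrightarrow> snd e = snd f \<Longrightarrow> e = f"
proof -
  have loop: "is_loop l" and dist: "distinct (map snd l)" and nb: "\<And>l'. \<not> removes_backtrack l l'"
    using assms by (auto simp: simple_loop_def)
  let ?n = "length l"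
  show "distinct l" using dist by (simp add: distinct_map)
  show nxt: "snd (l ! i) = fst (l ! (Suc i mod ?n))" if "i < ?n" for i
    using loop that by (simp add: is_loop_def)
  show snd_inj: "e = f" if "e \<in> set l" "f \<in> set l" "snd e = snd f" for e f
    using dist that by (auto simp: distinct_map dest: inj_onD)
  show fst_inj: "e = f" if ef: "e \<in> set l" "f \<in> set l" "fst e = fst f" for e f
  proof -
    have pred: "\<exists>j<?n. g = l ! (Suc j mod ?n)" if g: "g \<in> set l" for g
    proof -
      obtain i where i: "i < ?n" "g = l ! i" using g by (metis in_set_conv_nth)
      show ?thesis
      proof (cases i)
        case 0
        thus ?thesis using i by (intro exI[of _ "?n - 1"]) auto
      next
        case (Suc j)
        thus ?thesis using i by (intro exI[of _ j]) auto
      qed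
    qed
    obtain i j where i: "i < ?n" "e = l ! (Suc i mod ?n)" and j: "j < ?n" "f = l ! (Suc j mod ?n)"
      using pred ef by metis
    have "snd (l ! i) = snd (l ! j)" using nxt[OF i(1)] nxt[OF j(1)] i(2) j(2) ef(3) by simp
    hence "i = j" using dist i(1) j(1) by (metis length_map nth_eq_iff_index_eq nth_map)
    thus ?thesis using i j by simp
  qed
  show "edge_inv e \<notin> set l" if e: "e \<in> set l" for e
  proof
    assume e': "edge_inv e \<in> set l"
    obtain i where i: "i < ?n" "e = l ! i" using e by (metis in_set_conv_nth)
    have m: "l ! (Suc i mod ?n) \<in> set l" using i(1) by (intro nth_mem mod_less_divisor) linarith
    have "l ! (Suc i mod ?n) = edge_inv e"
      by (rule fst_inj[OF m e']) (use nxt[OF i(1)] i(2) in simp)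
    show False
    proof (cases "Suc i < ?n")
      case True
      hence "l ! Suc i = edge_inv e" using \<open>l ! (Suc i mod ?n) = edge_inv e\<close> by simp
      hence "l = take i l @ e # edge_inv e # drop (Suc (Suc i)) l"
        using i True by (metis Cons_nth_drop_Suc append_take_drop_id)
      thus False using nb removes_backtrack.inner by metis
    next
      case False
      hence n: "?n = Suc i" using i by simp
      hence 0: "l ! 0 = edge_inv e" using \<open>l ! (Suc i mod ?n) = edge_inv e\<close> by simp
      have "e \<in> lattice_edges" using loop e by (auto simp: is_loop_def)
      hence "i \<noteq> 0" using 0 i(2) edge_inv_neq by metis
      have "l = take i l @ [e]" using i n by (metis take_Suc_conv_app_nth take_all_iff order_refl)
      moreover have "take i l = edge_inv e # tl (take i l)"
        using 0 \<open>i \<noteq> 0\<close> i by (cases l) (auto simp: take_Cons')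
      ultimately have "l = edge_inv e # tl (take i l) @ [e]" by (metis append_Cons)
      thus False using nb removes_backtrack.cyclic by metis
    qed
  qed
qed

text \<open>At the end of \<open>e\<close> a simple loop has no other edges than \<open>e\<close> and its successor, so one can turn
  around that vertex on either side of the loop. On the right one turns from the reversed \<open>e\<close> to
  the successor, on the left from the successor to the reversed \<open>e\<close>.\<close>
lemma simple_loop_sides_connected:
  assumes sl: "simple_loop l" and e: "e \<in> set l" and f: "f \<in> set l"
  shows "(square_step l)\<^sup>*\<^sup>* (side e b) (side f b)"
proof -
  note P = simple_loop_props[OF sl]
  let ?n = "length l"
  have loop: "is_loop l" using sl by (simp add: simple_loop_def)
  have lat: "g \<in> lattice_edges" if "g \<in> set l" for g using loop that by (auto simp: is_loop_def)
  have next_step: "(square_step l)\<^sup>*\<^sup>* (side e b) (side g b)"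
    if eg: "e \<in> set l" "g \<in> set l" "snd e = fst g" for e g
  proof -
    have ne: "edge_inv e \<noteq> g" using P(2)[OF eg(1)] eg(2) by metis
    have free: "h \<notin> set l \<and> edge_inv h \<notin> set l"
      if "fst h = snd e" "h \<noteq> edge_inv e" "h \<noteq> g" for h
    proof
      show "h \<notin> set l" using P(4)[of h g] that eg by auto
      show "edge_inv h \<notin> set l"
      proof
        assume "edge_inv h \<in> set l"
        from P(5)[OF this eg(1)] have "edge_inv h = e" using that(1) by simp
        thus False using that(2) by auto
      qed
    qed
    show ?thesis
    proof (cases b)
      case True
      have "(square_step l)\<^sup>*\<^sup>* (side (edge_inv e) False) (side g True)"
        by (rule around_vertex) (use lat eg ne free in \<open>simp_all\<close>)
      thus ?thesis using True by simp
    next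
      case False
      have "(square_step l)\<^sup>*\<^sup>* (side g False) (side (edge_inv e) True)"
        by (rule around_vertex) (use lat eg ne free in \<open>simp_all\<close>)
      thus ?thesis using False by (simp add: reach_sym)
    qed
  qed
  have from0: "i < ?n \<Longrightarrow> (square_step l)\<^sup>*\<^sup>* (side (l ! 0) b) (side (l ! i) b)" for i
  proof (induction i)
    case (Suc i)
    have "snd (l ! i) = fst (l ! Suc i)" using P(3)[of i] Suc.prems by simp
    hence "(square_step l)\<^sup>*\<^sup>* (side (l ! i) b) (side (l ! Suc i) b)"
      using Suc.prems by (intro next_step) simp_all
    thus ?case using Suc by (meson Suc_lessD rtranclp_trans)
  qed simp
  obtain i j where "i < ?n" "e = l ! i" "j < ?n" "f = l ! j" using e f by (metis in_set_conv_nth)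
  thus ?thesis using from0[of i] from0[of j] by (metis reach_sym rtranclp_trans)
qed

text \<open>The discrete Jordan curve theorem. All squares along one side of the loop are connected, so
  the winding number takes one value on each side, and these values differ by 1. One side \<open>c\<close> reaches
  infinity and has winding number 0. Every square that does not reach infinity is connected to a side
  of the loop, which must be the side \<open>b\<close> opposite to \<open>c\<close>.\<close>
lemma simple_loop_bounds:
  assumes sl: "simple_loop l"
  obtains b where "bounds b l (enclosed_squares l)" "enclosed_squares l \<noteq> {}"
    "\<And>s. winding l s = (if s \<in> enclosed_squares l then if b then 1 else - 1 else 0)"
proof -
  note P = simple_loop_props[OF sl] and C = simple_loop_sides_connected[OF sl]
  have loop: "is_loop l" and ne: "l \<noteq> []" using sl by (simp_all add: simple_loop_def)
  obtain v where v: "walk v l v" using loop by (auto simp: is_loop_iff_walk)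
  have lat: "set l \<subseteq> lattice_edges" by (rule walk_edges[OF v])
  let ?inf = "\<lambda>s. infinite {t. (square_step l)\<^sup>*\<^sup>* s t}"
  define e0 where "e0 = hd l"
  have e0: "e0 \<in> set l" using ne by (simp add: e0_def)
  define H where "H = (\<lambda>c. winding l (side e0 c))"
  have H: "winding l (side f c) = H c" if "f \<in> set l" for f c
    unfolding H_def using winding_reachable[OF v C[OF e0 that, of c]] by simp
  have cnt: "count_list l e = of_bool (e \<in> set l)" for e by (rule count_list_distinct[OF P(1)])
  have H1: "H True = H False + 1"
    using winding_cross[OF v, of e0] lat e0 P(2)[OF e0] by (auto simp: H_def cnt)
  have inf0: "winding l s = 0" if "?inf s" for s using winding_unbounded[OF v that] .
  have touch: "\<exists>f\<in>set l. \<exists>d. (square_step l)\<^sup>*\<^sup>* s (side f d) \<and> winding l s = H d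
      \<and> snd (fst f) = snd (snd f)" if fin: "\<not> ?inf s" for s
  proof -
    obtain f d where fd: "f \<in> set l" "(square_step l)\<^sup>*\<^sup>* s (side f d)" "snd (fst f) = snd (snd f)"
      using bounded_region_touches[of l s] fin by blast
    thus ?thesis using winding_reachable[OF v fd(2)] H[OF fd(1)] by auto
  qed
  have "\<exists>s. \<not> ?inf s"
  proof (rule ccontr)
    assume "\<nexists>s. \<not> ?inf s"
    hence "H True = 0" "H False = 0" using inf0 by (simp_all add: H_def)
    thus False using H1 by simp
  qed
  then obtain f where "f \<in> set l" "snd (fst f) = snd (snd f)" using touch by blast
  then obtain e c where ec: "e \<in> set l" "?inf (side e c)"
    using unbounded_side_exists[OF lat] by blast
  have infc: "?inf (side f c)" if "f \<in> set l" for f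
    using reach_infinite[OF C[OF that ec(1)] ec(2)] .
  have Hc: "H c = 0" using inf0[OF infc[OF e0]] by (simp add: H_def)
  define b where "b = (\<not> c)"
  have Hb: "H b = (if b then 1 else - 1)" using H1 Hc by (cases c) (simp_all add: b_def)
  have cb: "d = c \<or> d = b" for d by (cases d; cases c) (simp_all add: b_def)
  let ?S = "enclosed_squares l"
  have S: "s \<in> ?S \<longleftrightarrow> \<not> ?inf s" for s by (simp add: enclosed_squares_def)
  have w: "winding l s = (if s \<in> ?S then if b then 1 else - 1 else 0)" for s
  proof (cases "?inf s")
    case True
    thus ?thesis using inf0 S by simp
  next
    case False
    then obtain f d where fd: "f \<in> set l" "(square_step l)\<^sup>*\<^sup>* s (side f d)" "winding l s = H d"
      using touch by blast
    have "d \<noteq> c"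
    proof
      assume "d = c"
      hence "?inf (side f d)" using infc[OF fd(1)] by blast
      from reach_infinite[OF fd(2) this] False show False by blast
    qed
    hence "d = b" using cb[of d] by blast
    thus ?thesis using fd(3) Hb False S by simp
  qed
  have "side e0 b \<in> ?S" using w[of "side e0 b"] Hb by (auto simp: H_def split: if_splits)
  hence "?S \<noteq> {}" by blast
  moreover have "bounds b l ?S" unfolding bounds_def
  proof (intro conjI ballI allI impI)
    show "is_loop l" by (rule loop)
    have "?S \<subseteq> {s. winding l s \<noteq> 0}" using w by auto
    thus "finite ?S" using winding_support[OF v] finite_subset by blast
    show "int (count_list l e) - int (count_list l (edge_inv e))
        = of_bool (side e b \<in> ?S) - of_bool (side e (\<not> b) \<in> ?S)" if "e \<in> lattice_edges" for e
    proof -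
      have "int (count_list l e) - int (count_list l (edge_inv e))
          = winding l (side e True) - winding l (side e False)"
        using winding_cross[OF v that] by simp
      thus ?thesis unfolding w by (cases b) auto
    qed
    show "count_list l e \<le> 1" for e by (simp add: cnt)
    show "side e True \<notin> ?S" "side e False \<notin> ?S" if "e \<in> set l" "edge_inv e \<in> set l" for e
      using P(2) that by blast+
    show "?inf s" if "s \<notin> ?S" for s using S that by blast
  qed
  ultimately show ?thesis using that w by blast
qed

section \<open>Coefficients of powers of contours\<close>

definition filling :: "vertex set \<Rightarrow> bool \<Rightarrow> assignment" where
  "filling S b p = of_bool (fst p \<in> S \<and> snd p = b)"

lemma filling_finitary: "finite S \<Longrightarrow> finitary (filling S b)"
  unfolding finite_assignments_def filling_def
  by (rule CollectI, rule finite_subset[of _ "S \<times> UNIV"]) auto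

lemma moment_series_0: "moment_series 0 (Abs_fps (\<lambda>n. if n = 0 then 0 else 1))" (is "moment_series 0 ?\<psi>")
proof -
  have "?\<psi> = fps_X * (1 + ?\<psi>)"
  proof (rule fps_ext)
    fix n show "?\<psi> $ n = (fps_X * (1 + ?\<psi>)) $ n"
      by (cases n) auto
  qed
  thus ?thesis by (simp add: moment_series_def)
qed

lemma walk_concat_replicate: "walk v l v \<Longrightarrow> walk v (concat (replicate n l)) v"
  by (induction n) (auto simp: walk_append)

lemma concat_replicate_shift: "concat (replicate k (x @ y)) @ x = x @ concat (replicate k (y @ x))"
  by (induction k) simp_all

text \<open>The copies of \<open>e\<close> in a word are the first edges of its letters \<open>e # u\<close>.\<close>
lemma split_sum_words:
  assumes "e \<notin> set u" "e \<notin> set R"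
  defines "W \<equiv> \<lambda>w. concat (map (\<lambda>x. if x then e # u else R) w)"
  shows "split_sum (\<lambda>x. x = e) g (a @ W z) (W w)
     = split_sum (\<lambda>x. x) (\<lambda>v v'. g (a @ W v) (u @ W v')) z w"
proof (induction w arbitrary: z)
  case Nil
  show ?case by (simp add: W_def)
next
  case (Cons x w)
  have skip: "split_sum (\<lambda>x. x = e) g k (m @ W w) = split_sum (\<lambda>x. x = e) g (k @ m) (W w)"
    if "e \<notin> set m" for k m
  proof -
    have "split_sum (\<lambda>x. x = e) h k m = 0" for h
      by (rule split_sum_none) (use that in blast)
    thus ?thesis by (simp add: split_sum_append)
  qed
  have snoc: "W (z @ [x]) = W z @ (if x then e # u else R)" by (simp add: W_def)
  show ?case
  proof (cases x)
    case True
    have "W (x # w) = e # u @ W w" using True by (simp add: W_def)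
    hence "split_sum (\<lambda>x. x = e) g (a @ W z) (W (x # w))
      = g (a @ W z) (u @ W w) + split_sum (\<lambda>x. x = e) g (a @ W z @ e # u) (W w)"
      using skip[OF assms(1)] by simp
    also have "\<dots> = g (a @ W z) (u @ W w) + split_sum (\<lambda>x. x = e) g (a @ W (z @ [x])) (W w)"
      using snoc True by simp
    finally show ?thesis using Cons.IH[of "z @ [x]"] True by simp
  next
    case False
    have "W (x # w) = R @ W w" using False by (simp add: W_def)
    hence "split_sum (\<lambda>x. x = e) g (a @ W z) (W (x # w))
      = split_sum (\<lambda>x. x = e) g (a @ W (z @ [x])) (W w)"
      using skip[OF assms(2)] snoc False by simp
    thus ?thesis using Cons.IH[of "z @ [x]"] False by simp
  qed
qed

context surface_sum
begin

lemma cancels_attach: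
  assumes "finitary K" "cancels l l'" "is_loop l"
  shows "attach K p l = attach K p l'"
  by (rule attach_cong[OF assms(1)]) (rule cancels_coefficient[OF assms(2) _ assms(3)])

text \<open>The master loop equation at \<open>e\<close> for a word that starts with \<open>Q\<close>. A deformation by the square \<open>s\<close>
  deletes \<open>Q\<close> or doubles it. The two deformations by the square on the other side of \<open>e\<close> make up a
  defect, which vanishes because that square reaches infinity without crossing \<open>Q\<close> or \<open>R\<close>.\<close>
lemma peeled_words:
  assumes B: "bounds b (e # r) S" and e: "side e b \<in> S" "side e (\<not> b) \<notin> S"
    and ms: "moment_series n \<psi>"
  defines "s \<equiv> side e b"
  defines "u \<equiv> plaq_rest e (s, b)" and "R \<equiv> plaq_rest (edge_inv e) (s, \<not> b) @ r"
  defines "W \<equiv> \<lambda>w. concat (map (\<lambda>x. if x then e # u else R) w)"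
  assumes IH: "\<And>j K. finitary K \<Longrightarrow> c (concat (replicate j R)) K
      = (if K = (\<lambda>p. j * filling (S - {s}) (\<not> b) p) then (1 + \<psi>) $ j else 0)"
  shows "two_letter_sum (\<lambda>w. c (W w)) (s, \<not> b) (s, b) (filling (S - {s}) (\<not> b)) \<psi> n"
proof
  let ?e' = "edge_inv e" and ?v = "fst e"
  let ?t = "plaq_rest ?e' (s, \<not> b)"
  note peel = peel_bounds[OF B e]
  have loop: "is_loop (e # r)" and fin: "finite S" using B by (simp_all add: bounds_def)
  have el: "e \<in> lattice_edges" using loop by (simp add: is_loop_def)
  have ep: "e \<in> set (plaq_path (s, b))" using el by (simp add: in_plaq_path_iff s_def)
  have e'p: "?e' \<in> set (plaq_path (s, \<not> b))" using el by (simp add: in_plaq_path_iff s_def)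
  have s': "side e (\<not> b) \<noteq> s" using e by (auto simp: s_def)
  note U = plaquette_readings[OF ep, folded u_def] and T = plaquette_readings[OF e'p]
  have t: "?t = map edge_inv (rev u)" unfolding u_def by (rule plaq_rest_edge_inv[OF ep])
  have eu: "e \<notin> set u" "?e' \<notin> set u"
    using U(4) s' by (auto simp: in_plaq_path_iff)
  have eR: "e \<notin> set R" "?e' \<notin> set R"
    using peel(1,2) T(4) s' by (auto simp: R_def in_plaq_path_iff)
  have wr: "walk (snd e) r ?v" using loop by (auto simp: is_loop_iff_walk)
  have wQ: "walk ?v (e # u) ?v" using U(3) el by simp
  have wR: "walk ?v R ?v" using T(3) wr by (auto simp: R_def walk_append)
  have wW: "walk ?v (W w) ?v" for w
    unfolding W_def by (induction w) (use wQ wR in \<open>auto simp: walk_append\<close>)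
  have W_append: "W (x @ y) = W x @ W y" for x y by (simp add: W_def)
  have W_True: "W (True # w) = e # u @ W w" for w by (simp add: W_def)
  show "moment_series n \<psi>" by (rule ms)
  show "finitary (filling (S - {s}) (\<not> b))" using fin by (intro filling_finitary) simp
  show "c (W (x @ y)) K = c (W (y @ x)) K" if "finitary K" for x y K
    unfolding W_append by (rule rotate_loop[OF that], rule walk_loop[of ?v])
      (use wW in \<open>auto simp: walk_append\<close>)
  show "c (W (replicate j False)) K = (if K = (\<lambda>x. j * filling (S - {s}) (\<not> b) x) then (1 + \<psi>) $ j else 0)"
    if "finitary K" for j K
    using IH[OF that, of j] by (simp add: W_def map_replicate)
  fix w K assume K: "finitary K"
  let ?l = "u @ W w" and ?s' = "side e (\<not> b)"
  have wl: "walk (snd e) ?l ?v" using U(3) wW by (auto simp: walk_append)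
  have lp: "is_loop (e # ?l)" using walk_loop[OF wW, of "True # w"] by (simp add: W_True)
  have "?e' \<notin> set (W w)" using eu eR edge_inv_neq[OF el] unfolding W_def by auto
  hence neg: "split_sum (\<lambda>x. x = ?e') (\<lambda>a b. convolution (c b) (c a) K) [] ?l = 0"
    by (intro split_sum_none) (use eu in auto)
  have pos: "split_sum (\<lambda>x. x = e) (\<lambda>a b. convolution (c (e # b)) (c (a @ [e])) K) [] ?l
    = split_sum (\<lambda>x. x) (\<lambda>v w. convolution (c (W (True # v))) (c (W (True # w))) K) [] w"
  proof -
    have "split_sum (\<lambda>x. x = e) (\<lambda>a b. convolution (c (e # b)) (c (a @ [e])) K) [] ?l
      = split_sum (\<lambda>x. x = e) (\<lambda>a b. convolution (c (e # b)) (c (a @ [e])) K) (u @ W []) (W w)"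
    proof -
      have "split_sum (\<lambda>x. x = e) h [] u = 0" for h
        by (rule split_sum_none) (use eu in blast)
      thus ?thesis by (simp add: split_sum_append W_def)
    qed
    also have "\<dots> = split_sum (\<lambda>x. x)
        (\<lambda>v v'. convolution (c (e # u @ W v')) (c ((u @ W v) @ [e])) K) [] w"
      unfolding W_def by (rule split_sum_words[OF eu(1) eR(1)])
    also have "\<dots> = split_sum (\<lambda>x. x)
        (\<lambda>v w. convolution (c (W (True # v))) (c (W (True # w))) K) [] w"
    proof (rule split_sum_cong)
      fix v x v'
      have "c ((u @ W v) @ [e]) K' = c (W (True # v)) K'" if "finitary K'" for K'
        using rotate_loop[OF that, of "[e]" "u @ W v"] walk_loop[OF wW, of "True # v"]
        by (simp add: W_True)
      hence "convolution (c (e # u @ W v')) (c ((u @ W v) @ [e])) K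
          = convolution (c (W (True # v'))) (c (W (True # v))) K"
        by (intro convolution_cong[OF K]) (simp_all add: W_True)
      thus "convolution (c (e # u @ W v')) (c ((u @ W ([] @ v)) @ [e])) K
          = convolution (c (W (True # [] @ v))) (c (W (True # v'))) K"
        using convolution_commute[of "c (W (True # v'))"] by simp
    qed
    finally show ?thesis .
  qed
  have A: "attach K (s, \<not> b) (?t @ ?l) = attach K (s, \<not> b) (W w)"
  proof (rule cancels_attach[OF K])
    show "cancels (?t @ ?l) (W w)"
      using cancels_append[OF cancels_inverse'[of u] cancels.none[of "W w"]] by (simp add: t)
    show "is_loop (?t @ ?l)"
      by (rule walk_loop[of ?v]) (use T(3) wl in \<open>auto simp: walk_append\<close>)
  qed
  have D: "attach K (?s', b) (plaq_rest ?e' (?s', b) @ ?l)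
         = attach K (?s', \<not> b) (e # plaq_rest e (?s', \<not> b) @ e # ?l)"
  proof -
    have p1: "?e' \<in> set (plaq_path (?s', b))" "e \<in> set (plaq_path (?s', \<not> b))"
      using el by (simp_all add: in_plaq_path_iff)
    note P1 = plaquette_readings[OF p1(1)] and P2 = plaquette_readings[OF p1(2)]
    have "infinite {t. (square_step (e # ?l))\<^sup>*\<^sup>* ?s' t}"
    proof (rule bounds_outside[OF B e(2)])
      fix f assume "f \<in> set (e # ?l)"
      hence "f \<in> set (e # r) \<or> f \<in> set u \<or> f \<in> set ?t"
        unfolding W_def R_def by (auto split: if_splits)
      moreover have "side f b \<in> S" if "f \<in> set u" using that U(4) e(1) by (auto simp: in_plaq_path_iff s_def)
      moreover have "side f (\<not> b) \<in> S" if "f \<in> set ?t" using that T(4) e(1) by (auto simp: in_plaq_path_iff s_def)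
      ultimately show "f \<in> set (e # r) \<or> side f True \<in> S \<or> side f False \<in> S" by (cases b) auto
    qed
    moreover have "?v \<in> fst ` set (plaq_path (?s', True))"
    proof (cases b)
      case True
      thus ?thesis using plaq_path_next[OF p1(1)] by simp
    next
      case False
      thus ?thesis using p1(2) by auto
    qed
    moreover have "walk ?v (e # ?l) ?v" using wl el by simp
    ultimately have "defect K ?s' ?v (e # ?l) = 0" by (rule defect_outside[OF K])
    hence "attach K (?s', b) (plaq_from ?v (?s', b) @ e # ?l)
         = attach K (?s', \<not> b) (plaq_from ?v (?s', \<not> b) @ e # ?l)"
      by (cases b) (simp_all add: defect_def)
    moreover have "plaq_from ?v (?s', b) = plaq_rest ?e' (?s', b) @ [?e']" using P1(2) by simp
    moreover have "plaq_from ?v (?s', \<not> b) = e # plaq_rest e (?s', \<not> b)" by (rule P2(1))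
    moreover have "attach K (?s', b) (plaq_rest ?e' (?s', b) @ ?e' # e # ?l)
        = attach K (?s', b) (plaq_rest ?e' (?s', b) @ ?l)"
    proof (rule cancels_attach[OF K])
      show "cancels (plaq_rest ?e' (?s', b) @ ?e' # e # ?l) (plaq_rest ?e' (?s', b) @ ?l)"
        using cancels.erase[OF cancels.none, of "plaq_rest ?e' (?s', b)" ?e' ?l] by simp
      show "is_loop (plaq_rest ?e' (?s', b) @ ?e' # e # ?l)"
        by (rule walk_loop[of ?v]) (use P1(3) wl el in \<open>auto simp: walk_append\<close>)
    qed
    ultimately show ?thesis by simp
  qed
  have "c (W (True # w)) K = attach K (s, \<not> b) (W w) - attach K (s, b) (W (True # True # w))
     - split_sum (\<lambda>x. x) (\<lambda>v w. convolution (c (W (True # v))) (c (W (True # w))) K) [] w"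
    using master_loop_equation[OF K lp, of b, folded s_def, folded u_def] A D neg pos
    by (simp add: W_True)
  thus "c (W (True # w)) K
      = (if K (s, \<not> b) \<ge> 1 then c (W w) (assignment_remove K (s, \<not> b)) else 0)
      - (if K (s, b) \<ge> 1 then c (W (True # True # w)) (assignment_remove K (s, b)) else 0)
      - split_sum (\<lambda>x. x) (\<lambda>v w. convolution (c (W (True # v))) (c (W (True # w))) K) [] w"
    by (simp add: attach_def)
qed

text \<open>Induction on the number of squares: the words \<open>(Q R)\<^sup>n\<close> reduce to the powers of the contour by
  erasing backtracks. Without squares the contour itself reduces to the null-loop, all of whose
  moments are 1.\<close>
lemma power_coefficients:
  assumes "bounds b l S"
  shows "\<exists>\<psi>. moment_series (card S) \<psi> \<and> (\<forall>n K. finitary K \<longrightarrow> c (loop_power l n) K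
      = (if K = (\<lambda>p. n * filling S (\<not> b) p) then (1 + \<psi>) $ n else 0))"
  using assms
proof (induction "card S" arbitrary: l S)
  case 0
  hence S: "S = {}" by (simp add: bounds_def)
  obtain v where v: "walk v l v" using 0 unfolding bounds_def is_loop_iff_walk by blast
  have "cancels l []"
    by (rule tree_contour_cancels[OF v]) (use 0(2) in \<open>simp add: bounds_def S\<close>)
  hence "cancels (loop_power l n) []" for n
    using cancels_concat_replicate[of l "[]" n] by (simp add: loop_power_def)
  hence "c (loop_power l n) K = c [] K" if "finitary K" for n K
    by (rule cancels_coefficient[OF _ that])
      (simp add: loop_power_def walk_loop[OF walk_concat_replicate[OF v]])
  hence "c (loop_power l n) K = (if K = (\<lambda>_. 0) then 1 else 0)" if "finitary K" for n K
    using empty_loop[OF that] that by simp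
  moreover have "(1 + Abs_fps (\<lambda>n. if n = 0 then 0 else 1)) $ n = (1 :: real)" for n by simp
  ultimately show ?case using moment_series_0
    by (intro exI[of _ "Abs_fps (\<lambda>n. if n = 0 then 0 else 1)"]) (auto simp: S filling_def)
next
  case (Suc k)
  have fin: "finite S" "S \<noteq> {}" using Suc.hyps(2) card.infinite by fastforce+
  obtain e where e: "e \<in> lattice_edges" "side e b \<in> S" "side e (\<not> b) \<notin> S"
    using boundary_edge_exists[OF fin] by blast
  have "int (count_list l e) - int (count_list l (edge_inv e)) = 1"
    using Suc.prems e unfolding bounds_def by simp
  hence "e \<in> set l" using count_notin[of e l] by fastforce
  then obtain a d where l: "l = a @ e # d" by (meson split_list)
  let ?r = "d @ a"
  have B: "bounds b (e # ?r) S" using bounds_rotate[of b a "e # d" S] Suc.prems l by simp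
  let ?s = "side e b"
  let ?u = "plaq_rest e (?s, b)" and ?t = "plaq_rest (edge_inv e) (?s, \<not> b)"
  note peel = peel_bounds[OF B e(2,3)]
  have k: "k = card (S - {?s})" using Suc.hyps(2) e(2) by simp
  obtain \<psi> where \<psi>: "moment_series (card (S - {?s})) \<psi>"
    "\<And>j K. finitary K \<Longrightarrow> c (concat (replicate j (?t @ ?r))) K
      = (if K = (\<lambda>p. j * filling (S - {?s}) (\<not> b) p) then (1 + \<psi>) $ j else 0)"
    using Suc.hyps(1)[OF k peel(3)] unfolding loop_power_def by blast
  interpret two_letter_sum "\<lambda>w. c (concat (map (\<lambda>x. if x then e # ?u else ?t @ ?r) w))"
    "(?s, \<not> b)" "(?s, b)" "filling (S - {?s}) (\<not> b)" \<psi> "card (S - {?s})"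
    using peeled_words[OF B e(2,3) \<psi>] .
  obtain \<psi>' where \<psi>': "moment_series (Suc (card (S - {?s}))) \<psi>'"
    "\<And>m K. finitary K \<Longrightarrow> c (concat (map (\<lambda>x. if x then e # ?u else ?t @ ?r) (alternating m))) K
      = (if K = (\<lambda>x. m * (if x = (?s, \<not> b) then Suc (filling (S - {?s}) (\<not> b) x) else filling (S - {?s}) (\<not> b) x))
         then (1 + \<psi>') $ m else 0)"
    using alternating_values by blast
  have fill: "(if x = (?s, \<not> b) then Suc (filling (S - {?s}) (\<not> b) x) else filling (S - {?s}) (\<not> b) x)
      = filling S (\<not> b) x" for x
    using e(2) by (cases x) (auto simp: filling_def)
  have ep: "e \<in> set (plaq_path (?s, b))" using e by (simp add: in_plaq_path_iff)
  have t: "?t = map edge_inv (rev ?u)" by (rule plaq_rest_edge_inv[OF ep])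
  have main: "c (loop_power l m) K = (if K = (\<lambda>p. m * filling S (\<not> b) p) then (1 + \<psi>') $ m else 0)"
    if K: "finitary K" for m K
  proof -
    obtain v where v: "walk v l v" using Suc.prems unfolding bounds_def is_loop_iff_walk by blast
    have loop: "is_loop (concat (replicate m l))"
      by (rule walk_loop[OF walk_concat_replicate[OF v]])
    have "c (concat (replicate m l)) K = c (concat (replicate m (e # ?r))) K"
    proof (cases m)
      case (Suc i)
      have 1: "concat (replicate m l) = a @ concat (replicate i ((e # d) @ a)) @ (e # d)"
        using concat_replicate_shift[of i a "e # d"] by (simp add: Suc l)
          (metis append.assoc append_Cons concat_replicate_shift replicate_app_Cons_same)
      have 2: "concat (replicate m (e # ?r)) = (concat (replicate i ((e # d) @ a)) @ (e # d)) @ a"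
        using concat_replicate_shift[of i "(e # d) @ a" "[]"] by (simp add: Suc)
      show ?thesis using rotate_loop[OF K] loop unfolding 1 2 by blast
    qed simp
    also have "\<dots> = c (concat (map (\<lambda>x. if x then e # ?u else ?t @ ?r) (alternating m))) K"
    proof -
      have 1: "concat (map (\<lambda>x. if x then e # ?u else ?t @ ?r) (alternating m))
          = concat (replicate m (e # ?u @ ?t @ ?r))"
        by (induction m) simp_all
      have "cancels ([e] @ (?u @ ?t) @ ?r) ([e] @ [] @ ?r)"
        by (rule cancels_context) (simp only: t cancels_inverse)
      hence 2: "cancels (concat (replicate m (e # ?u @ ?t @ ?r))) (concat (replicate m (e # ?r)))"
        by (intro cancels_concat_replicate) simp
      have "walk (fst e) (e # ?r) (fst e)" using B by (auto simp: bounds_def is_loop_iff_walk)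
      hence "walk (fst e) (e # ?u @ ?t @ ?r) (fst e)"
        using plaq_rest_walk[OF e(1), of b] by (auto simp: walk_append)
      hence "is_loop (concat (replicate m (e # ?u @ ?t @ ?r)))"
        by (rule walk_loop[OF walk_concat_replicate])
      thus ?thesis unfolding 1 using cancels_coefficient[OF 2 K] by simp
    qed
    finally show ?thesis using \<psi>'(2)[OF K, of m] by (simp add: loop_power_def fill)
  qed
  have "Suc (card (S - {?s})) = card S" using Suc.hyps(2) k by simp
  thus ?case using \<psi>'(1) main by (intro exI[of _ \<psi>']) simp
qed

end

section \<open>Powers of simple loops\<close>

text \<open>The height of the power is \<open>n\<close> on the enclosed squares, with the sign of the orientation, and
  the height assignment puts plaquettes of the orientation opposite to the loop there.\<close>
lemma height_assignment_power:
  assumes v: "walk v l v"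
    and w: "\<And>s. winding l s = (if s \<in> S then if b then 1 else - 1 else 0)"
  shows "height_assignment (loop_power l n) = (\<lambda>p. n * filling S (\<not> b) p)"
proof
  fix p :: plaquette
  obtain s d where p: "p = (s, d)" by (cases p)
  have "walk v (loop_power l n) v" unfolding loop_power_def by (rule walk_concat_replicate[OF v])
  from height_eq[OF this] have h: "height (loop_power l n) q = int n * winding l (fst q)" for q
    by (simp add: winding_concat)
  show "height_assignment (loop_power l n) p = n * filling S (\<not> b) p"
    unfolding height_assignment_def h w
    by (cases b; cases d) (auto simp: p positive_plaquettes_def plaq_inv_def filling_def)
qed

lemma filling_area:
  assumes "finite S"
  shows "assignment_area (\<lambda>p. n * filling S b p) = n * card S"
proof -
  have "assignment_area (\<lambda>p. n * filling S b p) = (\<Sum>p\<in>S \<times> {b}. n * filling S b p)"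
    by (rule assignment_area_superset) (use assms in \<open>auto simp: filling_def split: if_splits\<close>)
  also have "\<dots> = (\<Sum>p\<in>S \<times> {b}. n)"
    by (rule sum.cong) (auto simp: filling_def)
  finally show ?thesis by (simp add: card_cartesian_product)
qed

theorem theorem1p15:
  fixes \<beta> :: real and l :: "oedge list" and n :: nat
    and c :: "oedge list \<Rightarrow> assignment \<Rightarrow> real"
  assumes "surface_coefficients c" and "simple_loop l" and "n \<ge> 1"
  shows "let a = loop_area l;
             r = (if a = 1 then (if n = 1 then 1 else 0)
                  else (-1) ^ (n + 1) / real n * real ((n * a - 2) choose (n - 1)))
         in c (loop_power l n) (height_assignment (loop_power l n)) = r \<and>
            phi_term c \<beta> (loop_power l n) summable_on finite_assignments \<and>
            phi c \<beta> (loop_power l n) = r * \<beta> ^ (n * a)"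
proof -
  interpret surface_sum c by (rule surface_sum.intro[OF assms(1)])
  let ?S = "enclosed_squares l"
  obtain b where b: "bounds b l ?S" "?S \<noteq> {}"
    and w: "\<And>s. winding l s = (if s \<in> ?S then if b then 1 else - 1 else 0)"
    using simple_loop_bounds[OF assms(2)] by blast
  have fin: "finite ?S" using b(1) by (simp add: bounds_def)
  obtain v where v: "walk v l v" using b(1) unfolding bounds_def is_loop_iff_walk by blast
  define a where "a = loop_area l"
  define r where "r = (if a = 1 then (if n = 1 then 1 else 0)
                  else (-1) ^ (n + 1) / real n * real ((n * a - 2) choose (n - 1)))"
  define K where "K = height_assignment (loop_power l n)"
  have K_eq: "K = (\<lambda>p. n * filling ?S (\<not> b) p)"
    unfolding K_def by (rule height_assignment_power[OF v w])
  have K: "finitary K"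
  proof -
    have "{p. K p \<noteq> 0} \<subseteq> {p. filling ?S (\<not> b) p \<noteq> 0}" by (auto simp: K_eq)
    thus ?thesis using filling_finitary[OF fin, of "\<not> b"] finite_subset
      unfolding finite_assignments_def by blast
  qed
  have a: "a = card ?S" by (simp add: a_def loop_area_def)
  obtain \<psi> where \<psi>: "moment_series a \<psi>"
    and coeff: "\<And>n K'. finitary K' \<Longrightarrow> c (loop_power l n) K'
      = (if K' = (\<lambda>p. n * filling ?S (\<not> b) p) then (1 + \<psi>) $ n else 0)"
    using power_coefficients[OF b(1)] unfolding a by blast
  have "a \<ge> 1" using b(2) fin by (simp add: a card_gt_0_iff Suc_le_eq)
  hence "\<psi> $ n = r" unfolding r_def using moment_series_nth[OF \<psi> _ assms(3)] by blast
  hence val: "c (loop_power l n) K' = (if K' = K then r else 0)" if "finitary K'" for K'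
    using coeff[OF that, of n] assms(3) by (simp add: K_eq)
  have "(phi_term c \<beta> (loop_power l n) has_sum r * \<beta> ^ (n * a)) finite_assignments"
  proof (rule has_sum_finite_neutralI)
    show "finite {K}" "{K} \<subseteq> finite_assignments" using K by simp_all
    show "phi_term c \<beta> (loop_power l n) K' = 0" if "K' \<in> finite_assignments - {K}" for K'
      using that val[of K'] by (simp add: phi_term_def)
    show "r * \<beta> ^ (n * a) = (\<Sum>K'\<in>{K}. phi_term c \<beta> (loop_power l n) K')"
      using val[OF K] filling_area[OF fin, of n "\<not> b"] by (simp add: phi_term_def K_eq a)
  qed
  hence "phi_term c \<beta> (loop_power l n) summable_on finite_assignments"
    "phi c \<beta> (loop_power l n) = r * \<beta> ^ (n * a)"
    unfolding phi_def by (auto simp: summable_on_def infsumI)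
  thus ?thesis using val[OF K] by (simp add: Let_def K_def r_def a_def)
qed

end
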